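(* Let $n\ge2$ and $K<0$. The local isometry moduli space of $n$-dimensional strongly convex Randers spaces of constant flag curvature $K$ is parametrized by $a=(a_1,\dots,a_m)\in\mathbb R^m$ as follows. $(e)$ $h$ is the Euclidean metric and $\sigma=\pm4\sqrt{|K|}$. The parameter space is $$a_1\ge\cdots\ge a_m\ge0,$$ where $m=n/2$ when $n$ is even, and $m=(n-1)/2$ when $n$ is odd. These metrics may not be extended to all of $\mathbb R^n$. $(k)$ $h$ is the Klein metric (of sectional curvature $K$, in which case $\sigma=0$). The parameter space is the disjoint union of three sets. When $n$ is even, $m=n/2$ and the three sets are $$(J):\ a_1\ge\cdots\ge a_m\ge0;\qquad (S):\ \sqrt{|K|}>a_1>0,\ a_2\ge\cdots\ge a_m\ge0;\qquad (T):\ a_1>0,\ a_2\ge\cdots\ge a_m\ge0.$$ When $n$ is odd, $m=(n+1)/2$ and the three sets are $$(J):\ a_1\ge\cdots\ge a_m=0;\qquad (S):\ \sqrt{|K|}>a_1>0,\ a_2\ge\cdots\ge a_m\ge0;\qquad (T):\ a_1>0,\ a_2\ge\cdots\ge a_m=0.$$ The globally defined metrics in case $(k)$ (those strongly convex on the whole open unit ball) are parametrized by $a=0$. In each case the parameter $a$ is the one appearing in the normal forms of $W$ described in the context.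
   Context: A strongly convex Randers metric is a Finsler metric $F=\sqrt{a_{ij}(x)y^iy^j}+b_i(x)y^i$ with $(a_{ij})$ Riemannian and $a^{ij}b_ib_j<1$. It corresponds uniquely to navigation data $(h,W)$, where $h$ is a Riemannian metric and $W$ a vector field with $|W|^2=h(W,W)<1$, via $a_{ij}=\frac{h_{ij}}\lambda+\frac{W_iW_j}{\lambda^2}$, $b_i=-\frac{W_i}\lambda$, $W_i=h_{ij}W^j$, $\lambda=1-|W|^2$. Flag curvature: for $0\ne y\in T_xM$ and $V\in T_xM$ transverse to $y$, $K(x,y,V)=\dfrac{V^i(y^jR_{jikl}y^l)V^k}{g(y,y)g(V,V)-[g(y,V)]^2}$, where $g_{ij}=\frac12(F^2)_{y^iy^j}$ and $R$ is the $hh$-curvature of the Chern connection on the pulled-back tangent bundle $\pi^*TM$. Constant flag curvature $K$ means $K(x,y,V)=K$ for all $x,y,V$. A strongly convex Randers metric has constant flag curvature $K<0$ exactly when, up to local isometry, its navigation data are of one of two kinds: $(e)$ $h$ is the Euclidean metric on $\mathbb R^n$ and $W=-\frac12\sigma x+Qx+C$ with $\sigma=\pm4\sqrt{|K|}$; or $(k)$ $h$ is the Klein metric of sectional curvature $K$ on the unit ball $\mathbb B^n$, with norm $|y|=\frac1{\sqrt{|K|}}\frac{\sqrt{(y\cdot y)(1-x\cdot x)+(x\cdot y)^2}}{1-x\cdot x}$, and $W=Qx+C-(x\cdot C)x$ (a Killing field). Here $Q$ is a constant skew-symmetric matrix, $C$ a constant vector, and $|W|<1$ is required on the domain of the metric.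 Moduli space: for each of $(e)$ and $(k)$ consider the vector fields $W$ of the indicated form such that $|W|<1$ on some nonempty open set. The isometry group $G$ of $h$ (the Euclidean group $E(n)$ for $(e)$; the orthochronous Lorentz group $O_+(1,n)$ for $(k)$) acts by push-forward $W\mapsto\phi_*W$; navigation data on the same $G$-orbit give locally isometric Randers metrics, and the points of the moduli space are the $G$-orbits. The value of $\sigma$ is invariant under isometries. Each orbit has a privileged representative, its normal form; "parametrized" means that these normal forms provide a concrete parametrization of the points of the moduli space, the number of parameters being its dimension. Let $J=\begin{pmatrix}0&1\\-1&0\end{pmatrix}$. Normal forms for $(e)$: $W=-\frac12\sigma x+Qx$ with $-Q=a_1J\oplus\cdots\oplus a_mJ$ ($n$ even) or $-Q=a_1J\oplus\cdots\oplus a_mJ\oplus0$ ($n$ odd). Normal forms for $(k)$, $W=Qx+C-(x\cdot C)x$: Type $(J)$: $C=0$ and $-Q=a_1J\oplus\cdots\oplus a_mJ$ ($n$ even, $m=n/2$), $-Q=a_1J\oplus\cdots\oplus a_{m-1}J\oplus0$ ($n$ odd, $m=(n+1)/2$, $a_m=0$). Type $(S)$: $C=(a_1,0,\dots,0)$ and $-Q=0\oplus a_2J\oplus\cdots\oplus a_mJ\oplus0$ ($n$ even, $m=n/2$), $-Q=0\oplus a_2J\oplus\cdots\oplus a_mJ$ ($n$ odd, $m=(n+1)/2$). Type $(T)$: $C=(a_1,0,\dots,0)$ and $-Q=a_1J\oplus a_2J\oplus\cdots\oplus a_mJ$ ($n$ even, $m=n/2$), $-Q=a_1J\oplus\cdots\oplus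 a_{m-1}J\oplus0$ ($n$ odd, $m=(n+1)/2$, $a_m=0$).
   Formalization: In type (T) the parameter a_1>0 is not determined by the point of the moduli space (Lorentz boosts rescale it to any positive value); the normal forms still cover the moduli space, and the type and all other parameters are uniquely determined. *)

theory Defs
  imports "HOL-Analysis.Analysis"
begin

section \<open>Navigation data and Randers metrics\<close>

text \<open>
  A Riemannian metric \<open>h\<close> is given by its inner products \<open>h x u v\<close>, a vector field by its values
  \<open>W x\<close>; both are only meant on the domain \<open>D\<close> of \<open>h\<close>, which is an open subset of
  \<open>real ^ 'n\<close>.
\<close>

type_synonym 'n metric = "real ^ 'n \<Rightarrow> real ^ 'n \<Rightarrow> real ^ 'n \<Rightarrow> real"
type_synonym 'n vfield = "real ^ 'n \<Rightarrow> real ^ 'n"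

definition nav_norm :: "'n::finite metric \<Rightarrow> 'n vfield \<Rightarrow> real ^ 'n \<Rightarrow> real" where
  "nav_norm h W x = sqrt (h x (W x) (W x))"

definition nav_lambda :: "'n::finite metric \<Rightarrow> 'n vfield \<Rightarrow> real ^ 'n \<Rightarrow> real" where
  "nav_lambda h W x = 1 - h x (W x) (W x)"

definition randers_a :: "'n::finite metric \<Rightarrow> 'n vfield \<Rightarrow> 'n metric" where
  "randers_a h W x u v =
     h x u v / nav_lambda h W x + h x (W x) u * h x (W x) v / (nav_lambda h W x)\<^sup>2"

definition randers_b :: "'n::finite metric \<Rightarrow> 'n vfield \<Rightarrow> real ^ 'n \<Rightarrow> real ^ 'n \<Rightarrow> real" where
  "randers_b h W x u = - h x (W x) u / nav_lambda h W x"

definition randers_F :: "'n::finite metric \<Rightarrow> 'n vfield \<Rightarrow> real ^ 'n \<Rightarrow> real ^ 'n \<Rightarrow> real" where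
  "randers_F h W x y = sqrt (randers_a h W x y y) + randers_b h W x y"

text \<open>
  In the second conjunct, \<open>w\<close> is the vector dual to \<open>b\<close> under \<open>a\<close>, so that \<open>a w w\<close> is
  the number usually written \<open>a\<^sup>i\<^sup>j b\<^sub>i b\<^sub>j\<close>.
\<close>

definition strongly_convex :: "'n::finite metric \<Rightarrow> 'n vfield \<Rightarrow> real ^ 'n \<Rightarrow> bool" where
  "strongly_convex h W x \<longleftrightarrow>
     (\<forall>u. u \<noteq> 0 \<longrightarrow> randers_a h W x u u > 0) \<and>
     (\<exists>w. (\<forall>u. randers_a h W x w u = randers_b h W x u) \<and> randers_a h W x w w < 1)"

definition admissible :: "'n::finite metric \<Rightarrow> (real ^ 'n) set \<Rightarrow> 'n vfield \<Rightarrow> bool" where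
  "admissible h D W \<longleftrightarrow>
     (\<exists>U. open U \<and> U \<noteq> {} \<and> U \<subseteq> D \<and> (\<forall>x\<in>U. nav_norm h W x < 1))"

text \<open>Push-forward under a diffeomorphism \<open>\<phi>\<close> of the open set \<open>D\<close>.\<close>

definition push_forward ::
    "(real ^ 'n) set \<Rightarrow> (real ^ 'n \<Rightarrow> real ^ 'n) \<Rightarrow> 'n::finite vfield \<Rightarrow> 'n vfield" where
  "push_forward D \<phi> W =
     restrict (\<lambda>y. let x = inv_into D \<phi> y in frechet_derivative \<phi> (at x) (W x)) D"


section \<open>Case (e): the Euclidean metric on the whole space\<close>

definition euclid_metric :: "'n::finite metric" where
  "euclid_metric x u v = u \<bullet> v"

definition euclidean_group :: "(real ^ 'n \<Rightarrow> real ^ 'n::finite) set" where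
  "euclidean_group = {\<lambda>x. A *v x + b | A b. orthogonal_matrix A}"

definition sigmas :: "real \<Rightarrow> real set" where
  "sigmas K = {4 * sqrt \<bar>K\<bar>, - 4 * sqrt \<bar>K\<bar>}"

definition field_e :: "real \<Rightarrow> real ^ 'n ^ 'n \<Rightarrow> real ^ 'n \<Rightarrow> 'n::finite vfield" where
  "field_e \<sigma> Q C = (\<lambda>x. (- (1/2) * \<sigma>) *\<^sub>R x + Q *v x + C)"

definition fields_e :: "real \<Rightarrow> 'n::finite vfield set" where
  "fields_e K = {field_e \<sigma> Q C | \<sigma> Q C.
     \<sigma> \<in> sigmas K \<and> transpose Q = - Q \<and> admissible euclid_metric UNIV (field_e \<sigma> Q C)}"

definition orbit_e :: "'n::finite vfield \<Rightarrow> 'n vfield set" where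
  "orbit_e W = (\<lambda>\<phi>. push_forward UNIV \<phi> W) ` euclidean_group"

definition moduli_e :: "real \<Rightarrow> 'n::finite vfield set set" where
  "moduli_e K = orbit_e ` fields_e K"


section \<open>Case (k): the Klein metric on the unit ball\<close>

text \<open>
  The inner product obtained by polarization from the norm
  \<open>|y| = sqrt ((y \<bullet> y) * (1 - x \<bullet> x) + (x \<bullet> y)\<^sup>2) / (sqrt \<bar>K\<bar> * (1 - x \<bullet> x))\<close>.
\<close>

definition klein_metric :: "real \<Rightarrow> 'n::finite metric" where
  "klein_metric K x u v =
     ((u \<bullet> v) * (1 - x \<bullet> x) + (x \<bullet> u) * (x \<bullet> v)) / (\<bar>K\<bar> * (1 - x \<bullet> x)\<^sup>2)"

text \<open>
  The group \<open>O\<^sub>+(1,n)\<close> consists of the linear maps of Minkowski space \<open>real \<times> (real ^ 'n)\<close> (time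
  coordinate first) that preserve the Lorentz form and the direction of time.  The point \<open>x\<close> of
  the ball stands for the timelike line through \<open>(1, x)\<close>, and the group acts on these lines.
\<close>

definition lorentz_form :: "real \<times> (real ^ 'n) \<Rightarrow> real \<times> (real ^ 'n::finite) \<Rightarrow> real" where
  "lorentz_form u v = - (fst u * fst v) + snd u \<bullet> snd v"

definition lorentz_group :: "(real \<times> (real ^ 'n) \<Rightarrow> real \<times> (real ^ 'n::finite)) set" where
  "lorentz_group = {L. linear L \<and> (\<forall>u v. lorentz_form (L u) (L v) = lorentz_form u v) \<and>
     fst (L (1, 0)) > 0}"

definition klein_action ::
    "(real \<times> (real ^ 'n) \<Rightarrow> real \<times> (real ^ 'n)) \<Rightarrow> real ^ 'n \<Rightarrow> real ^ 'n::finite" where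
  "klein_action L x = snd (L (1, x)) /\<^sub>R fst (L (1, x))"

text \<open>
  Fields on the ball are represented by functions that are \<open>undefined\<close> outside the ball, so
  that two of them are equal iff they agree on the ball.
\<close>

definition field_k :: "real ^ 'n ^ 'n \<Rightarrow> real ^ 'n \<Rightarrow> 'n::finite vfield" where
  "field_k Q C = restrict (\<lambda>x. Q *v x + C - (x \<bullet> C) *\<^sub>R x) (ball 0 1)"

definition fields_k :: "real \<Rightarrow> 'n::finite vfield set" where
  "fields_k K = {field_k Q C | Q C.
     transpose Q = - Q \<and> admissible (klein_metric K) (ball 0 1) (field_k Q C)}"

definition orbit_k :: "'n::finite vfield \<Rightarrow> 'n vfield set" where
  "orbit_k W = (\<lambda>L. push_forward (ball 0 1) (klein_action L) W) ` lorentz_group"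

definition moduli_k :: "real \<Rightarrow> 'n::finite vfield set set" where
  "moduli_k K = orbit_k ` fields_k K"


section \<open>Normal forms\<close>

text \<open>
  The linear order on the index type only serves to number the coordinates: \<open>idx\<close> maps the
  index type increasingly onto \<open>{1..CARD('n)}\<close>.
\<close>

definition idx :: "'n::{finite,linorder} \<Rightarrow> nat" where
  "idx i = card {..i}"

text \<open>
  The direct sum of the blocks \<open>a r * J\<close>, \<open>r \<in> R\<close>, with \<open>J = ((0, 1), (-1, 0))\<close>, the
  \<open>r\<close>-th block occupying the rows and columns \<open>p r\<close> and \<open>p r + 1\<close>.  Rows and columns not
  covered by any block are zero.
\<close>

definition J_blocks ::
    "nat set \<Rightarrow> (nat \<Rightarrow> nat) \<Rightarrow> (nat \<Rightarrow> real) \<Rightarrow> (real ^ 'n::{finite,linorder}) ^ 'n::{finite,linorder}" where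
  "J_blocks R p a = (\<chi> i j. \<Sum>r\<in>R.
     if idx i = p r \<and> idx j = p r + 1 then a r
     else if idx i = p r + 1 \<and> idx j = p r then - a r
     else 0)"

text \<open>\<open>\<real>\<^sup>m\<close>, with coordinates numbered from 1.\<close>

definition rvec :: "nat \<Rightarrow> (nat \<Rightarrow> real) set" where
  "rvec m = {1..m} \<rightarrow>\<^sub>E UNIV"

text \<open>The chain \<open>a l \<ge> a (l + 1) \<ge> ... \<ge> a m \<ge> 0\<close> (no condition if \<open>m < l\<close>).\<close>

definition chain :: "nat \<Rightarrow> nat \<Rightarrow> (nat \<Rightarrow> real) \<Rightarrow> bool" where
  "chain l m a \<longleftrightarrow> (\<forall>i\<in>{l..<m}. a i \<ge> a (Suc i)) \<and> (\<forall>i\<in>{l..m}. a i \<ge> 0)"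

definition m_e :: "nat \<Rightarrow> nat" where
  "m_e n = (if even n then n div 2 else (n - 1) div 2)"

definition params_e :: "nat \<Rightarrow> (nat \<Rightarrow> real) set" where
  "params_e n = {a \<in> rvec (m_e n). chain 1 (m_e n) a}"

definition nf_e :: "real \<Rightarrow> (nat \<Rightarrow> real) \<Rightarrow> 'n::{finite,linorder} vfield" where
  "nf_e \<sigma> a = field_e \<sigma> (- J_blocks {1..m_e CARD('n)} (\<lambda>r. 2 * r - 1) a) 0"

datatype ktype = Type_J | Type_S | Type_T

definition m_k :: "nat \<Rightarrow> nat" where
  "m_k n = (if even n then n div 2 else (n + 1) div 2)"

fun params_k :: "real \<Rightarrow> nat \<Rightarrow> ktype \<Rightarrow> (nat \<Rightarrow> real) set" where
  "params_k K n Type_J = {a \<in> rvec (m_k n). chain 1 (m_k n) a \<and> (odd n \<longrightarrow> a (m_k n) = 0)}"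
| "params_k K n Type_S = {a \<in> rvec (m_k n). sqrt \<bar>K\<bar> > a 1 \<and> a 1 > 0 \<and> chain 2 (m_k n) a}"
| "params_k K n Type_T =
     {a \<in> rvec (m_k n). a 1 > 0 \<and> chain 2 (m_k n) a \<and> (odd n \<longrightarrow> a (m_k n) = 0)}"

definition first_coord :: "real \<Rightarrow> real ^ 'n::{finite,linorder}" where
  "first_coord c = (\<chi> i. if idx i = 1 then c else 0)"

text \<open>In types (J) and (T) with odd dimension, the last parameter has no block of its own.\<close>

definition Q_JT :: "(nat \<Rightarrow> real) \<Rightarrow> (real ^ 'n::{finite,linorder}) ^ 'n::{finite,linorder}" where
  "Q_JT a = - J_blocks {1..if even CARD('n) then m_k CARD('n) else m_k CARD('n) - 1}
                (\<lambda>r. 2 * r - 1) a"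

definition Q_S :: "(nat \<Rightarrow> real) \<Rightarrow> (real ^ 'n::{finite,linorder}) ^ 'n::{finite,linorder}" where
  "Q_S a = - J_blocks {2..m_k CARD('n)} (\<lambda>r. 2 * r - 2) a"

fun nf_k :: "ktype \<Rightarrow> (nat \<Rightarrow> real) \<Rightarrow> 'n::{finite,linorder} vfield" where
  "nf_k Type_J a = field_k (Q_JT a) 0"
| "nf_k Type_S a = field_k (Q_S a) (first_coord (a 1))"
| "nf_k Type_T a = field_k (Q_JT a) (first_coord (a 1))"

end

theory Submission
  imports Defs
begin

text \<open>
  In both cases a field of the classification is encoded by a linear map that is skew for a symmetric
  bilinear form, and isometries act by conjugation (up to translations in the Euclidean case), so that
  the points of the moduli space are conjugacy classes of skew maps.  On a subspace where the form is
  positive definite a skew map splits into plane rotations (\<open>exists_rotation_frame\<close>); this is the source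
  of all the blocks \<open>a r * J\<close>.

  Euclidean case.  As \<open>\<sigma> \<noteq> 0\<close>, every field has a zero, which is moved to the origin; what remains is the
  skew matrix \<open>Q\<close> up to orthogonal conjugation (\<open>field_e_normal_form\<close>).  The speeds of the rotations are
  recovered from the dimensions of the eigenspaces of the square of \<open>Q\<close> (\<open>nf_e_determined\<close>).  No field is
  strongly convex on the whole space, because all of them are unbounded while strong convexity means
  that the field is shorter than 1 (\<open>strongly_convex_iff\<close>).

  Klein case.  The fields are the projections of the generators \<open>M\<close> of the Lorentz group to the ball
  (\<open>field_k_eq\<close>, \<open>orbit_k_iff\<close>), and with \<open>p = (1, x)\<close> the squared length of a field at \<open>x\<close> is the quotient of
  the Lorentz squares of \<open>M p\<close> and \<open>p\<close>, up to the factor \<open>- 1 / \<bar>K\<bar>\<close> (\<open>klein_metric_field_k\<close>).  By Brouwer's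
  theorem a field has a zero in the closed ball (\<open>field_k_has_zero_in_cball\<close>), that is, \<open>M\<close> has an eigenvector
  which is timelike or null.  If it is timelike, its eigenvalue is 0 and \<open>M\<close> is a sum of rotations in
  the spacelike complement: type J.  If it is null with a nonzero eigenvalue, there is a second null
  eigenvector, and \<open>M\<close> is the sum of a boost and rotations: type S (\<open>hyperbolic_plane\<close>).  If it is null in the
  kernel, then either a timelike vector is in the kernel too, or \<open>M\<close> has a nilpotent part of order 3,
  complemented by rotations: type T (\<open>parabolic_space\<close>).

  The type and the parameters are invariants (\<open>normal_form_determined\<close>): only type J has a timelike kernel
  vector, only type S has a positive eigenvalue of \<open>M \<circ> M\<close>, and negative eigenvalues of \<open>M \<circ> M\<close> count the
  speeds of the rotations.  The exception is \<open>a 1\<close> in type T, which a boost changes into any other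
  positive number (\<open>type_T_rescaled\<close>).  A boost of speed \<open>a 1\<close> has length at least \<open>a 1 / sqrt \<bar>K\<bar>\<close> everywhere,
  with equality on its axis, whence the upper bound in type S; the other types have points where
  the field is arbitrarily short.  Finally, a field shorter than 1 on the whole ball vanishes on the boundary
  sphere, and then identically (\<open>bounded_field_k_is_zero\<close>).
\<close>

section \<open>Skew maps for a symmetric bilinear form\<close>

locale symmetric_form =
  fixes g :: "'a::euclidean_space \<Rightarrow> 'a \<Rightarrow> real"
  assumes bilinear: "bilinear g" and commute: "g x y = g y x"
begin

lemma form_simps [simp]:
  "g (x + y) z = g x z + g y z" "g z (x + y) = g z x + g z y"
  "g (x - y) z = g x z - g y z" "g z (x - y) = g z x - g z y"
  "g (- x) z = - g x z" "g z (- x) = - g z x"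
  "g (c *\<^sub>R x) z = c * g x z" "g z (c *\<^sub>R x) = c * g z x"
  "g 0 z = 0" "g z 0 = 0"
  using bilinear
  by (simp_all add: bilinear_ladd bilinear_radd bilinear_lsub bilinear_rsub bilinear_lneg
      bilinear_rneg bilinear_lmul bilinear_rmul bilinear_lzero bilinear_rzero)

lemma normalized: "g y y > 0 \<Longrightarrow> g (y /\<^sub>R sqrt (g y y)) (y /\<^sub>R sqrt (g y y)) = 1"
  by (simp add: field_simps)

lemma form_sum_left: "g (\<Sum>i\<in>A. F i) z = (\<Sum>i\<in>A. g (F i) z)"
  by (induction A rule: infinite_finite_induct) auto

lemma continuous_on_form:
  assumes "continuous_on S F" "continuous_on S G"
  shows "continuous_on S (\<lambda>x. g (F x) (G x))"
  using bounded_bilinear.continuous_on[OF _ assms] bilinear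
  by (simp add: bilinear_conv_bounded_bilinear)

definition orthonormal :: "'a list \<Rightarrow> bool" where
  "orthonormal es \<longleftrightarrow>
     (\<forall>i<length es. \<forall>j<length es. g (es ! i) (es ! j) = (if i = j then 1 else 0))"

end

text \<open>
  The list \<open>es\<close> is grouped into consecutive pairs, each spanning a plane in which \<open>f\<close> is a rotation
  generator of speed \<open>\<alpha> r\<close>; if the length is odd, \<open>f\<close> kills the last vector.  Speeds are decreasing, as
  in a normal form.
\<close>

definition rotation_frame :: "('a::real_vector \<Rightarrow> 'a) \<Rightarrow> 'a list \<Rightarrow> (nat \<Rightarrow> real) \<Rightarrow> bool" where
  "rotation_frame f es \<alpha> \<longleftrightarrow>
     (\<forall>r. 2 * r + 1 < length es \<longrightarrow> 0 \<le> \<alpha> r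
        \<and> f (es ! (2 * r)) = \<alpha> r *\<^sub>R es ! (2 * r + 1)
        \<and> f (es ! (2 * r + 1)) = - \<alpha> r *\<^sub>R es ! (2 * r)) \<and>
     (\<forall>r. 2 * r + 3 < length es \<longrightarrow> \<alpha> (Suc r) \<le> \<alpha> r) \<and>
     (\<forall>k. length es = 2 * k + 1 \<longrightarrow> f (es ! (2 * k)) = 0)"

lemma rotation_frame_Cons:
  assumes "rotation_frame f es \<alpha>" "f u = a *\<^sub>R v" "f v = - a *\<^sub>R u" "0 \<le> a"
    and "1 < length es \<Longrightarrow> \<alpha> 0 \<le> a"
  shows "rotation_frame f (u # v # es) (case_nat a \<alpha>)"
  unfolding rotation_frame_def
proof (intro conjI allI impI)
  fix r
  assume "2 * r + 1 < length (u # v # es)"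
  then show "0 \<le> (case r of 0 \<Rightarrow> a | Suc r \<Rightarrow> \<alpha> r)"
    and "f ((u # v # es) ! (2 * r)) = (case r of 0 \<Rightarrow> a | Suc r \<Rightarrow> \<alpha> r) *\<^sub>R (u # v # es) ! (2 * r + 1)"
    and "f ((u # v # es) ! (2 * r + 1)) = - (case r of 0 \<Rightarrow> a | Suc r \<Rightarrow> \<alpha> r) *\<^sub>R (u # v # es) ! (2 * r)"
    using assms by (cases r; auto simp: rotation_frame_def)+
next
  fix r
  assume "2 * r + 3 < length (u # v # es)"
  then show "(case Suc r of 0 \<Rightarrow> a | Suc r \<Rightarrow> \<alpha> r) \<le> (case r of 0 \<Rightarrow> a | Suc r \<Rightarrow> \<alpha> r)"
    using assms by (cases r) (auto simp: rotation_frame_def)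
next
  fix k
  assume "length (u # v # es) = 2 * k + 1"
  then show "f ((u # v # es) ! (2 * k)) = 0"
    using assms by (cases k) (auto simp: rotation_frame_def)
qed

text \<open>
  The first-order condition at a maximum, for a function quadratic in \<open>t\<close>.
\<close>

lemma linear_coeff_zero:
  fixes b c :: real
  assumes "\<And>t. 2 * t * b + t\<^sup>2 * c \<le> 0"
  shows "b = 0"
proof (rule ccontr)
  assume "b \<noteq> 0"
  \<comment> \<open>For this small \<open>t\<close> of the sign of \<open>b\<close> the linear term dominates.\<close>
  define t where "t = b / (\<bar>c\<bar> + 1)"
  have "t\<^sup>2 * c \<ge> - (t\<^sup>2 * \<bar>c\<bar>)"
    by (metis abs_ge_minus_self abs_minus_commute abs_mult abs_power2 minus_le_iff)
  moreover have "t * b = t\<^sup>2 * (\<bar>c\<bar> + 1)"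
    by (simp add: t_def power2_eq_square)
  moreover have "t \<noteq> 0"
    using \<open>b \<noteq> 0\<close> by (simp add: t_def)
  ultimately have "2 * t * b + t\<^sup>2 * c \<ge> t\<^sup>2 * \<bar>c\<bar> + 2 * t\<^sup>2" "t\<^sup>2 > 0"
    by (auto simp: algebra_simps)
  moreover have "t\<^sup>2 * \<bar>c\<bar> \<ge> 0" by simp
  ultimately show False
    using assms[of t] by linarith
qed

context symmetric_form
begin

lemma orthonormal_Cons:
  assumes "orthonormal es" "g u u = 1" "\<And>e. e \<in> set es \<Longrightarrow> g u e = 0"
  shows "orthonormal (u # es)"
proof -
  have "g ((u # es) ! i) ((u # es) ! j) = (if i = j then 1 else 0)"
    if "i < length (u # es)" "j < length (u # es)" for i j
    using that assms commute[of "es ! (i - 1)" u]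
    by (cases i; cases j) (auto simp: orthonormal_def)
  then show ?thesis by (simp add: orthonormal_def)
qed

text \<open>
  The unit vector \<open>u\<close> maximizes the quotient of the forms \<open>g (f x) (f x)\<close> and \<open>g x x\<close>; it exists because
  the quotient is scale invariant and the Euclidean unit sphere of \<open>S\<close> is compact.  The first-order
  condition at \<open>u\<close> says that \<open>f (f u) + A *\<^sub>R u\<close> is \<open>g\<close>-orthogonal to \<open>S\<close>.
\<close>

lemma maximal_rotation:
  assumes f: "linear f" "\<And>x y. g (f x) y = - g x (f y)"
    and S: "subspace S" "\<And>x. x \<in> S \<Longrightarrow> f x \<in> S" "\<And>x. x \<in> S \<Longrightarrow> x \<noteq> 0 \<Longrightarrow> g x x > 0"
    and "S \<noteq> {0}"
  obtains u A where "u \<in> S" "g u u = 1" "0 \<le> A" "f (f u) = - A *\<^sub>R u"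
    "\<And>x. x \<in> S \<Longrightarrow> g (f x) (f x) \<le> A * g x x"
proof -
  interpret f: linear f by fact
  define D where "D = S \<inter> sphere 0 1"
  define q where "q = (\<lambda>x. g (f x) (f x) / g x x)"
  have "compact D"
    unfolding D_def using S(1) by (intro closed_Int_compact closed_subspace) auto
  moreover have "D \<noteq> {}"
  proof -
    obtain x where "x \<in> S" "x \<noteq> 0" using \<open>S \<noteq> {0}\<close> S(1) subspace_0 by blast
    then have "x /\<^sub>R norm x \<in> D" using S(1) by (auto simp: D_def subspace_scale)
    then show ?thesis by blast
  qed
  moreover have "continuous_on D q"
  proof -
    have "\<And>x. x \<in> D \<Longrightarrow> g x x \<noteq> 0"
      using S(3) by (force simp: D_def)
    then show ?thesis
      unfolding q_def using f(1)
      by (intro continuous_on_divide continuous_on_form linear_continuous_on continuous_on_id)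
        (auto simp: linear_conv_bounded_linear)
  qed
  ultimately obtain u0 where u0: "u0 \<in> D" "\<And>x. x \<in> D \<Longrightarrow> q x \<le> q u0"
    using continuous_attains_sup[of D q] by blast
  define A where "A = q u0"
  have max: "g (f x) (f x) \<le> A * g x x" if "x \<in> S" for x
  proof (cases "x = 0")
    case True
    then show ?thesis by (simp add: f.zero)
  next
    case False
    have "x /\<^sub>R norm x \<in> D" using that False S(1) by (auto simp: D_def subspace_scale)
    then have "q (x /\<^sub>R norm x) \<le> A" using u0 by (simp add: A_def)
    then show ?thesis
      using S(3)[OF that False] False by (simp add: q_def f.scale field_simps)
  qed
  have u0': "u0 \<in> S" "u0 \<noteq> 0" using u0 by (auto simp: D_def)
  have g0: "g u0 u0 > 0" using S(3) u0' by blast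
  define u where "u = u0 /\<^sub>R sqrt (g u0 u0)"
  have u: "u \<in> S" "g u u = 1" "g (f u) (f u) = A"
    using u0' g0 S(1)
    by (auto simp: u_def subspace_scale f.scale A_def q_def field_simps)
  have "A \<ge> 0"
    using S(3)[of "f u"] S(2) u by (cases "f u = 0") auto
  have crit: "g (f u) (f v) = A * g u v" if "v \<in> S" for v
  proof -
    have "2 * t * (g (f u) (f v) - A * g u v) + t\<^sup>2 * (g (f v) (f v) - A * g v v) \<le> 0" for t
      using max[of "u + t *\<^sub>R v"] that u S(1) commute[of "f v" "f u"] commute[of v u]
      by (simp add: subspace_add subspace_scale f.add f.scale algebra_simps power2_eq_square)
    from linear_coeff_zero[OF this] show ?thesis by simp
  qed
  define w where "w = f (f u) + A *\<^sub>R u"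
  have "w \<in> S" using u S by (simp add: w_def subspace_add subspace_scale)
  have "g w w = g (f (f u)) w + A * g u w"
    by (subst (1) w_def) simp
  also have "\<dots> = - g (f u) (f w) + A * g u w"
    using f(2)[of "f u" w] by simp
  also have "\<dots> = 0" using crit[OF \<open>w \<in> S\<close>] by simp
  finally have "w = 0" using S(3)[OF \<open>w \<in> S\<close>] by force
  then have "f (f u) = - A *\<^sub>R u"
    by (simp add: w_def eq_neg_iff_add_eq_0)
  with u \<open>A \<ge> 0\<close> max show thesis by (intro that)
qed

text \<open>
  For \<open>A > 0\<close> the second vector is the normalized \<open>f u\<close>.  For \<open>A = 0\<close> maximality makes \<open>f\<close> vanish on \<open>S\<close>,
  and any unit vector orthogonal to \<open>u\<close> will do.
\<close>

lemma rotation_plane: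
  assumes f: "linear f" "\<And>x y. g (f x) y = - g x (f y)"
    and S: "subspace S" "\<And>x. x \<in> S \<Longrightarrow> f x \<in> S" "\<And>x. x \<in> S \<Longrightarrow> x \<noteq> 0 \<Longrightarrow> g x x > 0"
    and u: "u \<in> S" "g u u = 1" "0 \<le> A" "f (f u) = - A *\<^sub>R u"
    and max: "\<And>x. x \<in> S \<Longrightarrow> g (f x) (f x) \<le> A * g x x"
    and "S \<noteq> span {u}"
  obtains v where "v \<in> S" "g v v = 1" "g u v = 0" "f u = sqrt A *\<^sub>R v" "f v = - sqrt A *\<^sub>R u"
proof (cases "A = 0")
  case True
  have f0: "f x = 0" if "x \<in> S" for x
    using max[OF that] S(3)[of "f x"] S(2)[OF that] True by force
  have "span {u} \<subseteq> S" using u S(1) by (simp add: span_minimal)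
  then obtain x where x: "x \<in> S" "x \<notin> span {u}" using \<open>S \<noteq> span {u}\<close> by blast
  define y where "y = x - g x u *\<^sub>R u"
  have y: "y \<in> S" "g u y = 0"
    using x u S(1) commute[of x u]
    by (auto simp: y_def subspace_diff subspace_scale)
  have "y \<noteq> 0"
  proof
    assume "y = 0"
    then have "x = g x u *\<^sub>R u" by (simp add: y_def)
    then show False using x by (metis span_base span_scale singletonI)
  qed
  then have "g y y > 0" using S(3) y by blast
  then show thesis
    using y u f0 S(1) True normalized[of y]
    by (intro that[of "y /\<^sub>R sqrt (g y y)"]) (auto simp del: form_simps(7) simp: subspace_scale)
next
  case False
  interpret f: linear f by fact
  have "g (f u) u = 0" using f(2)[of u u] commute[of u "f u"] by simp
  moreover have "g (f u) (f u) = A" using f(2)[of u "f u"] u by simp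
  moreover have "A > 0" using False u by simp
  ultimately show thesis
    using u S f(2)[of u u]
    by (intro that[of "f u /\<^sub>R sqrt A"]) (auto simp: subspace_scale f.scale commute field_simps)
qed

text \<open>
  Spectral theorem for a skew map on a positive definite subspace: split off the plane of fastest
  rotation and continue in its orthogonal complement, which is invariant by skewness.  Taking the
  fastest plane first makes the speeds decreasing without any sorting.
\<close>

lemma exists_rotation_frame:
  assumes f: "linear f" "\<And>x y. g (f x) y = - g x (f y)"
    and S: "subspace S" "\<And>x. x \<in> S \<Longrightarrow> f x \<in> S" "\<And>x. x \<in> S \<Longrightarrow> x \<noteq> 0 \<Longrightarrow> g x x > 0"
  shows "\<exists>es \<alpha>. orthonormal es \<and> span (set es) = S \<and> rotation_frame f es \<alpha>"
  using S
proof (induction "dim S" arbitrary: S rule: less_induct)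
  case less
  interpret f: linear f by fact
  note S = less.prems
  show ?case
  proof (cases "S = {0}")
    case True
    then show ?thesis
      by (intro exI[of _ "[]"] exI[of _ "\<lambda>_. 0"]) (auto simp: orthonormal_def rotation_frame_def)
  next
    case False
    obtain u A where u: "u \<in> S" "g u u = 1" "0 \<le> A" "f (f u) = - A *\<^sub>R u"
      and max: "\<And>x. x \<in> S \<Longrightarrow> g (f x) (f x) \<le> A * g x x"
      using maximal_rotation[OF f S False] by blast
    show ?thesis
    proof (cases "S = span {u}")
      case True
      obtain c where c: "f u = c *\<^sub>R u"
        using S(2)[OF u(1)] True by (auto simp: span_singleton)
      have "g (f u) u = 0" using f(2)[of u u] commute[of u "f u"] by simp
      then have "f u = 0" using c u by simp
      then show ?thesis
        using u True
        by (intro exI[of _ "[u]"] exI[of _ "\<lambda>_. 0"]) (auto simp: orthonormal_def rotation_frame_def)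
    next
      case False
      obtain v where v: "v \<in> S" "g v v = 1" "g u v = 0" "f u = sqrt A *\<^sub>R v" "f v = - sqrt A *\<^sub>R u"
        using rotation_plane[OF f S u max False] by blast
      define T where "T = {x \<in> S. g u x = 0 \<and> g v x = 0}"
      have T: "subspace T"
        using S(1) unfolding T_def subspace_def by auto
      have "f x \<in> T" if "x \<in> T" for x
        using that S(2) f(2)[of u x] f(2)[of v x] v by (auto simp: T_def)
      moreover have "u \<notin> T" using u by (simp add: T_def)
      then have "T \<subset> S" using u unfolding T_def by blast
      then have "dim T < dim S"
        using T S(1) by (intro dim_psubset) (simp add: span_eq_iff[THEN iffD2])
      ultimately obtain es \<alpha>
        where es: "orthonormal es" "span (set es) = T" "rotation_frame f es \<alpha>"
        using less.hyps[of T] T S(3) by (auto simp: T_def)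
      have mem: "e \<in> T" if "e \<in> set es" for e using es(2) that span_base by blast
      have "orthonormal (v # es)"
        using es(1) v(2) mem by (rule_tac orthonormal_Cons) (auto simp: T_def)
      then have "orthonormal (u # v # es)"
        using u(2) v(3) mem by (rule_tac orthonormal_Cons) (auto simp: T_def)
      moreover have "span (set (u # v # es)) = S"
      proof
        show "span (set (u # v # es)) \<subseteq> S"
          using u v mem S(1) by (intro span_minimal) (auto simp: T_def)
        show "S \<subseteq> span (set (u # v # es))"
        proof
          fix x assume "x \<in> S"
          define y where "y = x - g u x *\<^sub>R u - g v x *\<^sub>R v"
          have "y \<in> T"
            using \<open>x \<in> S\<close> u v S(1) commute[of v u]
            by (simp add: y_def T_def subspace_diff subspace_scale)
          then have "y \<in> span (set (u # v # es))"
            using es(2) span_mono[of "set es" "set (u # v # es)"] by auto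
          moreover have "x = y + g u x *\<^sub>R u + g v x *\<^sub>R v" by (simp add: y_def)
          ultimately show "x \<in> span (set (u # v # es))"
            by (metis list.set_intros(1) list.set_intros(2) span_add span_base span_scale)
        qed
      qed
      moreover have "rotation_frame f (u # v # es) (case_nat (sqrt A) \<alpha>)"
      proof (rule rotation_frame_Cons)
        assume "1 < length es"
        \<comment> \<open>The fastest rotation in the complement is no faster than the one split off.\<close>
        then have "2 * 0 + 1 < length es" by simp
        with es(3) have "0 \<le> \<alpha> 0 \<and> f (es ! (2 * 0)) = \<alpha> 0 *\<^sub>R es ! (2 * 0 + 1)"
          unfolding rotation_frame_def by blast
        then have "f (es ! 0) = \<alpha> 0 *\<^sub>R es ! 1" by simp
        have "es ! 0 \<in> set es"
          using \<open>1 < length es\<close> by (intro nth_mem) linarith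
        then have "g (f (es ! 0)) (f (es ! 0)) \<le> A * g (es ! 0) (es ! 0)"
          using mem max by (simp add: T_def)
        moreover have unit: "g (es ! i) (es ! i) = 1" if "i < length es" for i
          using es(1) that by (simp add: orthonormal_def)
        moreover have "g (es ! 0) (es ! 0) = 1"
          using \<open>1 < length es\<close> by (intro unit) linarith
        ultimately have "\<alpha> 0 * \<alpha> 0 \<le> A"
          using \<open>1 < length es\<close> unfolding \<open>f (es ! 0) = _\<close> by simp
        then show "\<alpha> 0 \<le> sqrt A"
          by (intro real_le_rsqrt) (simp add: power2_eq_square)
      qed (use es(3) v(4,5) u(3) in simp_all)
      ultimately show ?thesis
        by (intro exI conjI)
    qed
  qed
qed

lemma orthonormal_distinct: "orthonormal es \<Longrightarrow> distinct es"
proof -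
  assume es: "orthonormal es"
  have "es ! i \<noteq> es ! j" if "i < length es" "j < length es" "i \<noteq> j" for i j
  proof
    assume "es ! i = es ! j"
    moreover have "g (es ! i) (es ! j) = 0" "g (es ! i) (es ! i) = 1"
      using es that by (simp_all add: orthonormal_def)
    ultimately show False by simp
  qed
  then show ?thesis by (simp add: distinct_conv_nth)
qed

end

section \<open>Strong convexity and the length of the vector field\<close>

lemma exists_orthogonal_form:
  fixes v :: "real ^ 'n::finite"
  assumes "symmetric_form g" "CARD('n) \<ge> 2"
  obtains u where "u \<noteq> 0" "g v u = 0"
proof -
  interpret symmetric_form g by fact
  have lin: "linear (g v)" by (intro linearI) auto
  obtain u where "u \<noteq> 0" "orthogonal (adjoint (g v) 1) u"
    using orthogonal_to_vector_exists[of "adjoint (g v) 1"] assms(2) by auto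
  moreover have "g v u = u \<bullet> adjoint (g v) 1"
    using adjoint_works[OF lin, of u 1] by simp
  ultimately show thesis
    by (intro that) (auto simp: orthogonal_def inner_commute)
qed

text \<open>
  On the orthogonal complement of \<open>W x\<close>, which is not 0 in dimension at least 2, the form \<open>a\<close> is
  \<open>h x / \<lambda>\<close>, so positivity forces \<open>\<lambda> > 0\<close>.  Conversely \<open>- \<lambda> *\<^sub>R W x\<close> is dual to \<open>b\<close> under \<open>a\<close>, and its
  length under \<open>a\<close> is that of \<open>W x\<close> under \<open>h x\<close>.
\<close>

lemma strongly_convex_iff:
  fixes W :: "'n::finite vfield"
  assumes "symmetric_form (h x)" "\<And>u. u \<noteq> 0 \<Longrightarrow> h x u u > 0" "CARD('n) \<ge> 2"
  shows "strongly_convex h W x \<longleftrightarrow> h x (W x) (W x) < 1"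
proof
  interpret symmetric_form "h x" by fact
  define N where "N = h x (W x) (W x)"
  define l where "l = nav_lambda h W x"
  have Nl: "N = 1 - l" by (simp add: N_def l_def nav_lambda_def)
  {
    assume "strongly_convex h W x"
    obtain u where u: "u \<noteq> 0" "h x (W x) u = 0"
      using exists_orthogonal_form[OF assms(1,3)] by blast
    then have "h x u u / l > 0"
      using \<open>strongly_convex h W x\<close>
      by (auto simp: strongly_convex_def randers_a_def l_def)
    then have "l > 0"
      using assms(2)[OF u(1)] zero_less_divide_iff by (metis less_asym)
    then show "h x (W x) (W x) < 1" using Nl by (simp add: N_def)
  next
    assume "h x (W x) (W x) < 1"
    then have "l > 0" using Nl by (simp add: N_def)
    have "randers_a h W x u u > 0" if "u \<noteq> 0" for u
      using assms(2)[OF that] \<open>l > 0\<close> unfolding randers_a_def l_def[symmetric]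
      by (simp add: add_pos_nonneg)
    moreover have "randers_a h W x (- l *\<^sub>R W x) u = randers_b h W x u" for u
      using \<open>l > 0\<close> unfolding randers_a_def randers_b_def l_def[symmetric]
      by (simp add: N_def[symmetric] Nl field_simps power2_eq_square)
    moreover have "randers_a h W x (- l *\<^sub>R W x) (- l *\<^sub>R W x) < 1"
      using \<open>l > 0\<close> unfolding randers_a_def l_def[symmetric]
      by (simp add: N_def[symmetric] Nl field_simps power2_eq_square)
    ultimately show "strongly_convex h W x"
      unfolding strongly_convex_def by blast
  }
qed

lemma symmetric_form_inner: "symmetric_form ((\<bullet>) :: 'a::euclidean_space \<Rightarrow> 'a \<Rightarrow> real)"
  by unfold_locales
    (auto simp: bilinear_def inner_add inner_commute intro!: linearI)

lemma strongly_convex_euclid_iff: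
  fixes W :: "'n::finite vfield"
  assumes "CARD('n) \<ge> 2"
  shows "strongly_convex euclid_metric W x \<longleftrightarrow> W x \<bullet> W x < 1"
proof -
  have eq: "euclid_metric x = (\<bullet>)" by (simp add: euclid_metric_def fun_eq_iff)
  show ?thesis
    using strongly_convex_iff[of euclid_metric x W] symmetric_form_inner assms
    by (simp add: eq)
qed

lemma ball_inner_less_one: "x \<in> ball 0 1 \<longleftrightarrow> x \<bullet> x < 1" for x :: "real ^ 'n::finite"
  by (simp add: dist_norm norm_eq_sqrt_inner)

lemma strongly_convex_klein_iff:
  fixes W :: "'n::finite vfield"
  assumes "CARD('n) \<ge> 2" "K < 0" "x \<in> ball 0 1"
  shows "strongly_convex (klein_metric K) W x \<longleftrightarrow> klein_metric K x (W x) (W x) < 1"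
proof (rule strongly_convex_iff)
  show "symmetric_form (klein_metric K x)"
    by unfold_locales
      (auto simp: bilinear_def klein_metric_def inner_add inner_commute algebra_simps
        add_divide_distrib diff_divide_distrib intro!: linearI)
  fix u :: "real ^ 'n"
  assume "u \<noteq> 0"
  moreover have "1 - x \<bullet> x > 0" using assms(3) unfolding ball_inner_less_one by simp
  ultimately have "(u \<bullet> u) * (1 - x \<bullet> x) + (x \<bullet> u)\<^sup>2 > 0"
    by (intro add_pos_nonneg mult_pos_pos) auto
  then show "klein_metric K x u u > 0"
    using assms(2) \<open>1 - x \<bullet> x > 0\<close> unfolding klein_metric_def
    by (intro divide_pos_pos mult_pos_pos zero_less_power) (auto simp: power2_eq_square)
qed (use assms in auto)

section \<open>Numbered coordinates and block matrices\<close>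

lemma bij_betw_idx: "bij_betw (idx :: 'n::{finite,linorder} \<Rightarrow> nat) UNIV {1..CARD('n)}"
proof -
  have less: "idx i < idx j" if "i < j" for i j :: 'n
    unfolding idx_def using that by (intro psubset_card_mono) auto
  have "inj (idx :: 'n \<Rightarrow> nat)"
  proof (rule injI)
    fix i j :: 'n
    assume "idx i = idx j"
    then show "i = j" using less[of i j] less[of j i] by (cases i j rule: linorder_cases) auto
  qed
  moreover have "range (idx :: 'n \<Rightarrow> nat) \<subseteq> {1..CARD('n)}"
  proof
    fix k assume "k \<in> range (idx :: 'n \<Rightarrow> nat)"
    then obtain i :: 'n where k: "k = card {..i}" by (auto simp: idx_def)
    have "card {..i} > 0" by (auto simp: card_gt_0_iff)
    moreover have "card {..i} \<le> CARD('n)" by (intro card_mono) auto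
    ultimately show "k \<in> {1..CARD('n)}" using k by simp
  qed
  moreover have "card (range (idx :: 'n \<Rightarrow> nat)) = CARD('n)"
    using \<open>inj idx\<close> by (simp add: card_image)
  ultimately have "range (idx :: 'n \<Rightarrow> nat) = {1..CARD('n)}"
    by (intro card_subset_eq) auto
  with \<open>inj idx\<close> show ?thesis by (simp add: bij_betw_def)
qed

lemma idx_range: "idx (i :: 'n::{finite,linorder}) \<in> {1..CARD('n)}"
  using bij_betw_idx bij_betwE by blast

lemma idx_eq_iff [simp]: "idx i = idx j \<longleftrightarrow> i = j"
  using bij_betw_idx by (metis UNIV_I bij_betw_inv_into_left)

definition coord :: "nat \<Rightarrow> 'n::{finite,linorder}" where
  "coord = inv_into UNIV idx"

lemma idx_coord: "k \<in> {1..CARD('n)} \<Longrightarrow> idx (coord k :: 'n::{finite,linorder}) = k"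
  unfolding coord_def using bij_betw_idx by (metis bij_betw_inv_into_right)

lemma coord_idx [simp]: "coord (idx i) = i"
  unfolding coord_def by (metis bij_betw_idx UNIV_I bij_betw_inv_into_left)

lemma eq_coord_iff:
  "k \<in> {1..CARD('n)} \<Longrightarrow> idx i = k \<longleftrightarrow> i = (coord k :: 'n::{finite,linorder})"
  by (metis idx_coord idx_eq_iff)

text \<open>
  The blocks fit into \<open>{1..n}\<close> and do not overlap, so that the sum in \<open>J_blocks\<close> has at most one nonzero
  term per entry.
\<close>

definition disjoint_blocks :: "nat set \<Rightarrow> (nat \<Rightarrow> nat) \<Rightarrow> nat \<Rightarrow> bool" where
  "disjoint_blocks R p n \<longleftrightarrow> finite R \<and> (\<forall>r\<in>R. 1 \<le> p r \<and> p r + 1 \<le> n) \<and>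
     (\<forall>r\<in>R. \<forall>s\<in>R. r \<noteq> s \<longrightarrow> p r \<noteq> p s \<and> p r \<noteq> p s + 1)"

lemma disjoint_blocksD:
  assumes "disjoint_blocks R p n" "r \<in> R" "s \<in> R" "r \<noteq> s"
  shows "p r \<noteq> p s" "p r \<noteq> p s + 1" "p s \<noteq> p r + 1"
proof -
  have *: "\<forall>r\<in>R. \<forall>s\<in>R. r \<noteq> s \<longrightarrow> p r \<noteq> p s \<and> p r \<noteq> p s + 1"
    using assms(1) by (simp add: disjoint_blocks_def)
  show "p r \<noteq> p s" "p r \<noteq> p s + 1" using * assms(2-4) by blast+
  show "p s \<noteq> p r + 1" using * assms(2,3) assms(4)[symmetric] by blast
qed

text \<open>
  The \<open>j\<close>-th column, read in an arbitrary family \<open>u\<close> in place of the standard basis.  This form serves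
  both to compute with the matrix (\<open>u\<close> the standard basis) and to recognize it as the matrix of a map
  in some frame.
\<close>

lemma J_blocks_column_sum:
  fixes u :: "nat \<Rightarrow> 'a::real_vector" and j :: "'n::{finite,linorder}"
  assumes "disjoint_blocks R p CARD('n)"
  shows "(\<Sum>i\<in>UNIV. (- J_blocks R p a) $ i $ j *\<^sub>R u (idx i)) =
    (\<Sum>r\<in>R. if idx j = p r then a r *\<^sub>R u (p r + 1)
       else if idx j = p r + 1 then - a r *\<^sub>R u (p r) else 0)"
proof -
  define E where "E = (\<lambda>r (i::'n). if idx i = p r \<and> idx j = p r + 1 then a r
     else if idx i = p r + 1 \<and> idx j = p r then - a r else 0)"
  have "(\<Sum>i\<in>UNIV. (- J_blocks R p a) $ i $ j *\<^sub>R u (idx i)) =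
      (\<Sum>i\<in>UNIV. \<Sum>r\<in>R. - E r i *\<^sub>R u (idx i))"
    by (simp add: J_blocks_def E_def scaleR_sum_left sum_negf)
  also have "\<dots> = (\<Sum>r\<in>R. \<Sum>i\<in>UNIV. - E r i *\<^sub>R u (idx i))"
    by (rule sum.swap)
  also have "\<dots> = (\<Sum>r\<in>R. if idx j = p r then a r *\<^sub>R u (p r + 1)
       else if idx j = p r + 1 then - a r *\<^sub>R u (p r) else 0)"
  proof (rule sum.cong)
    fix r assume "r \<in> R"
    then have r: "p r \<in> {1..CARD('n)}" "p r + 1 \<in> {1..CARD('n)}"
      using assms by (auto simp: disjoint_blocks_def)
    have distinct: "coord (p r) \<noteq> (coord (p r + 1) :: 'n)"
      using idx_coord[OF r(1)] idx_coord[OF r(2)] by (metis n_not_Suc_n Suc_eq_plus1)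
    have "- E r i *\<^sub>R u (idx i) =
      (if i = coord (p r) then if idx j = p r + 1 then - a r *\<^sub>R u (p r) else 0
       else if i = coord (p r + 1) then if idx j = p r then a r *\<^sub>R u (p r + 1) else 0
       else 0)" for i
      unfolding E_def eq_coord_iff[OF r(1)] eq_coord_iff[OF r(2)]
      using idx_coord[OF r(1)] idx_coord[OF r(2)] distinct
      by auto
    with distinct show "(\<Sum>i\<in>UNIV. - E r i *\<^sub>R u (idx i)) =
        (if idx j = p r then a r *\<^sub>R u (p r + 1)
       else if idx j = p r + 1 then - a r *\<^sub>R u (p r) else 0)"
      by (subst sum.cong[OF refl, of UNIV _
            "\<lambda>i. (if i = coord (p r) then if idx j = p r + 1 then - a r *\<^sub>R u (p r) else 0 else 0)
              + (if i = coord (p r + 1) then if idx j = p r then a r *\<^sub>R u (p r + 1) else 0 else 0)"])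
        (auto simp: sum.distrib)
  qed simp
  finally show ?thesis .
qed

lemma J_blocks_column:
  fixes u :: "nat \<Rightarrow> 'a::real_vector" and j :: "'n::{finite,linorder}"
  assumes blocks: "disjoint_blocks R p CARD('n)"
  shows "r \<in> R \<Longrightarrow> idx j = p r \<Longrightarrow>
      (\<Sum>i\<in>UNIV. (- J_blocks R p a) $ i $ j *\<^sub>R u (idx i)) = a r *\<^sub>R u (p r + 1)"
    and "r \<in> R \<Longrightarrow> idx j = p r + 1 \<Longrightarrow>
      (\<Sum>i\<in>UNIV. (- J_blocks R p a) $ i $ j *\<^sub>R u (idx i)) = - a r *\<^sub>R u (p r)"
    and "(\<And>r. r \<in> R \<Longrightarrow> idx j \<noteq> p r \<and> idx j \<noteq> p r + 1) \<Longrightarrow>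
      (\<Sum>i\<in>UNIV. (- J_blocks R p a) $ i $ j *\<^sub>R u (idx i)) = 0"
proof -
  have fin: "finite R" using blocks by (simp add: disjoint_blocks_def)
  let ?F = "\<lambda>s. if idx j = p s then a s *\<^sub>R u (p s + 1)
       else if idx j = p s + 1 then - a s *\<^sub>R u (p s) else 0"
  have single: "(\<Sum>s\<in>R. ?F s) = ?F r"
    if "r \<in> R" "idx j = p r \<or> idx j = p r + 1" for r
  proof -
    have "?F s = 0" if "s \<in> R - {r}" for s
    proof -
      have "s \<in> R" "s \<noteq> r" using that by auto
      then have "p r \<noteq> p s" "p r \<noteq> p s + 1" "p s \<noteq> p r + 1"
        using disjoint_blocksD[OF blocks \<open>r \<in> R\<close> \<open>s \<in> R\<close>] by auto
      then show ?thesis using \<open>idx j = p r \<or> idx j = p r + 1\<close> by auto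
    qed
    then have "(\<Sum>s\<in>R - {r}. ?F s) = 0" by (intro sum.neutral) blast
    then show ?thesis using sum.remove[OF fin \<open>r \<in> R\<close>, of ?F] by simp
  qed
  show "r \<in> R \<Longrightarrow> idx j = p r \<Longrightarrow>
      (\<Sum>i\<in>UNIV. (- J_blocks R p a) $ i $ j *\<^sub>R u (idx i)) = a r *\<^sub>R u (p r + 1)"
    unfolding J_blocks_column_sum[OF blocks] using single by simp
  show "r \<in> R \<Longrightarrow> idx j = p r + 1 \<Longrightarrow>
      (\<Sum>i\<in>UNIV. (- J_blocks R p a) $ i $ j *\<^sub>R u (idx i)) = - a r *\<^sub>R u (p r)"
    unfolding J_blocks_column_sum[OF blocks] using single by simp
  show "(\<And>r. r \<in> R \<Longrightarrow> idx j \<noteq> p r \<and> idx j \<noteq> p r + 1) \<Longrightarrow>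
      (\<Sum>i\<in>UNIV. (- J_blocks R p a) $ i $ j *\<^sub>R u (idx i)) = 0"
    unfolding J_blocks_column_sum[OF blocks] by (intro sum.neutral) auto
qed

lemma transpose_J_blocks: "transpose (- J_blocks R p a) = - (- J_blocks R p a)"
  unfolding vec_eq_iff transpose_def J_blocks_def
  by (auto simp flip: sum_negf intro!: sum.cong)

definition unit_vec :: "nat \<Rightarrow> real ^ 'n::{finite,linorder}" where
  "unit_vec k = axis (coord k) 1"

lemma mult_axis_eq_sum:
  "(Q :: (real ^ 'n::{finite,linorder}) ^ 'n::{finite,linorder}) *v axis j 1 = (\<Sum>i\<in>UNIV. Q $ i $ j *\<^sub>R unit_vec (idx i))"
proof -
  have "(Q *v axis j 1) $ k = Q $ k $ j" for k
    by (simp add: matrix_vector_mult_basis column_def)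
  then show ?thesis
    by (simp add: vec_eq_iff unit_vec_def axis_def if_distrib cong: if_cong)
qed

lemma J_blocks_unit_vec:
  fixes Q :: "(real ^ 'n::{finite,linorder}) ^ 'n::{finite,linorder}"
  assumes blocks: "disjoint_blocks R p CARD('n)" and Q: "Q = - J_blocks R p a"
  shows "r \<in> R \<Longrightarrow> Q *v unit_vec (p r) = a r *\<^sub>R unit_vec (p r + 1)"
    and "r \<in> R \<Longrightarrow> Q *v unit_vec (p r + 1) = - a r *\<^sub>R unit_vec (p r)"
    and "k \<in> {1..CARD('n)} \<Longrightarrow> (\<And>r. r \<in> R \<Longrightarrow> k \<noteq> p r \<and> k \<noteq> p r + 1) \<Longrightarrow> Q *v unit_vec k = 0"
proof -
  have "p r \<in> {1..CARD('n)}" "p r + 1 \<in> {1..CARD('n)}" if "r \<in> R" for r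
    using blocks that by (auto simp: disjoint_blocks_def)
  note idx = this[THEN idx_coord[where 'n = 'n]]
  show "Q *v unit_vec (p r) = a r *\<^sub>R unit_vec (p r + 1)" if "r \<in> R"
    using J_blocks_column(1)[OF blocks that idx(1)[OF that]] unfolding Q
    by (subst (1) unit_vec_def) (simp only: mult_axis_eq_sum)
  show "Q *v unit_vec (p r + 1) = - a r *\<^sub>R unit_vec (p r)" if "r \<in> R"
    using J_blocks_column(2)[OF blocks that idx(2)[OF that]] unfolding Q
    by (subst (1) unit_vec_def) (simp only: mult_axis_eq_sum)
  show "Q *v unit_vec k = 0"
    if "k \<in> {1..CARD('n)}" "\<And>r. r \<in> R \<Longrightarrow> k \<noteq> p r \<and> k \<noteq> p r + 1"
  proof -
    have "idx (coord k :: 'n) = k" using that(1) by (rule idx_coord)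
    then show ?thesis
      using J_blocks_column(3)[OF blocks, of "coord k" a unit_vec] that(2) unfolding Q
      by (subst (1) unit_vec_def) (simp add: mult_axis_eq_sum)
  qed
qed

lemma linear_eq_frame:
  fixes f :: "real ^ 'n::finite \<Rightarrow> 'a::real_vector"
  assumes "linear f" "linear g" "\<And>i. f (axis i 1) = g (axis i 1)"
  shows "f = g"
proof -
  interpret f: linear f by fact
  interpret g: linear g by fact
  have *: "x = (\<Sum>i\<in>UNIV. (x $ i) *\<^sub>R axis i 1)" for x :: "real ^ 'n"
    using basis_expansion[of x] by (simp add: scalar_mult_eq_scaleR)
  have "f x = g x" for x
    by (subst (1 2) *) (simp only: f.sum g.sum f.scale g.scale assms(3))
  then show ?thesis by blast
qed

lemma linear_diagonal:
  fixes f :: "real ^ 'n::finite \<Rightarrow> real ^ 'n"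
  assumes "linear f" "\<And>j. f (axis j 1) = d j *\<^sub>R axis j 1"
  shows "f x $ j = d j * x $ j"
proof -
  have "f = (\<lambda>x. \<chi> j. d j * x $ j)"
    using assms by (intro linear_eq_frame) (auto intro!: linearI simp: vec_eq_iff axis_def algebra_simps)
  then show ?thesis by simp
qed

lemma dim_eigenspace_diagonal:
  fixes f :: "real ^ 'n::finite \<Rightarrow> real ^ 'n"
  assumes "linear f" "\<And>j. f (axis j 1) = d j *\<^sub>R axis j 1"
  shows "dim {x. f x = c *\<^sub>R x} = card {j. d j = c}"
proof -
  have "{x. f x = c *\<^sub>R x} = {x. \<forall>j. j \<notin> {j. d j = c} \<longrightarrow> x $ j = 0}"
    by (auto simp: vec_eq_iff linear_diagonal[OF assms])
  then show ?thesis
    using dim_substandard_cart[of "{j. d j = c}", where 'a = real] by (simp add: dim_vec_eq)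
qed

text \<open>
  The diagonal entries of the square of \<open>- J_blocks R p a\<close>.
\<close>

definition block_square :: "nat set \<Rightarrow> (nat \<Rightarrow> nat) \<Rightarrow> (nat \<Rightarrow> real) \<Rightarrow> nat \<Rightarrow> real" where
  "block_square R p a k =
     (\<Sum>r\<in>R. if k = p r \<or> k = p r + 1 then - (a r)\<^sup>2 else 0)"

lemma block_square_eq:
  assumes "disjoint_blocks R p n" "r \<in> R" "k = p r \<or> k = p r + 1"
  shows "block_square R p a k = - (a r)\<^sup>2"
proof -
  have "(if k = p s \<or> k = p s + 1 then - (a s)\<^sup>2 else 0) = 0" if "s \<in> R - {r}" for s
  proof -
    have "s \<in> R" "s \<noteq> r" using that by auto
    then have "p r \<noteq> p s" "p r \<noteq> p s + 1" "p s \<noteq> p r + 1"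
      using disjoint_blocksD[OF assms(1,2) \<open>s \<in> R\<close>] by auto
    then show ?thesis using assms(3) by auto
  qed
  then have "(\<Sum>s\<in>R - {r}. if k = p s \<or> k = p s + 1 then - (a s)\<^sup>2 else 0) = 0"
    by (intro sum.neutral) blast
  moreover have "finite R" using assms by (simp add: disjoint_blocks_def)
  ultimately show ?thesis
    using sum.remove[of R r "\<lambda>s. if k = p s \<or> k = p s + 1 then - (a s)\<^sup>2 else 0"] assms(2,3)
    by (simp add: block_square_def)
qed

lemma block_square_eq_0:
  "(\<And>r. r \<in> R \<Longrightarrow> k \<noteq> p r \<and> k \<noteq> p r + 1) \<Longrightarrow> block_square R p a k = 0"
  by (simp add: block_square_def)

lemma J_blocks_square:
  fixes Q :: "(real ^ 'n::{finite,linorder}) ^ 'n::{finite,linorder}"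
  assumes blocks: "disjoint_blocks R p CARD('n)" and Q: "Q = - J_blocks R p a"
  shows "Q *v (Q *v axis j 1) = block_square R p a (idx j) *\<^sub>R axis j 1"
proof -
  have j: "axis j 1 = unit_vec (idx j)" by (simp add: unit_vec_def)
  note Q_simps = J_blocks_unit_vec[OF blocks Q]
  consider r where "r \<in> R" "idx j = p r" | r where "r \<in> R" "idx j = p r + 1"
    | "\<And>r. r \<in> R \<Longrightarrow> idx j \<noteq> p r \<and> idx j \<noteq> p r + 1" by blast
  then show ?thesis
  proof cases
    case 1
    then show ?thesis
      using Q_simps(1,2)[OF 1(1)] block_square_eq[OF blocks 1(1), of "p r"]
      by (simp add: j matrix_vector_mult_scaleR power2_eq_square)
  next
    case 2
    then show ?thesis
      using Q_simps(1,2)[OF 2(1)] block_square_eq[OF blocks 2(1), of "p r + 1"]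
      by (simp add: j matrix_vector_mult_scaleR power2_eq_square vec.neg)
  next
    case 3
    then show ?thesis
      using Q_simps(3)[OF idx_range 3] block_square_eq_0[of R "idx j" p a]
      by (simp add: j)
  qed
qed

text \<open>
  Each block contributes its two coordinates to the eigenvalue \<open>- (a r)\<^sup>2\<close>.  The eigenvalue 0 is left out, as
  coordinates outside all blocks contribute to it too.
\<close>

lemma card_block_square:
  assumes blocks: "disjoint_blocks R p CARD('n::{finite,linorder})" and "c < 0"
  shows "card {j::'n. block_square R p a (idx j) = c} = 2 * card {r \<in> R. (a r)\<^sup>2 = - c}"
proof -
  let ?B = "\<lambda>r. {p r, p r + 1}"
  have fin: "finite R" using blocks by (simp add: disjoint_blocks_def)
  have sub: "?B r \<subseteq> {1..CARD('n)}" if "r \<in> R" for r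
    using blocks that by (auto simp: disjoint_blocks_def)
  have "idx ` {j::'n. block_square R p a (idx j) = c} = (\<Union>r\<in>{r \<in> R. (a r)\<^sup>2 = - c}. ?B r)" (is "?L = ?U")
  proof
    show "?L \<subseteq> ?U"
    proof
      fix k assume "k \<in> ?L"
      then have k: "block_square R p a k = c" by auto
      then obtain r where r: "r \<in> R" "k = p r \<or> k = p r + 1"
        using \<open>c < 0\<close> block_square_eq_0[of R k p a] by force
      then have "(a r)\<^sup>2 = - c" using block_square_eq[OF blocks r] k by simp
      then show "k \<in> ?U" using r by auto
    qed
    show "?U \<subseteq> ?L"
    proof
      fix k assume "k \<in> ?U"
      then obtain r where r: "r \<in> R" "(a r)\<^sup>2 = - c" "k \<in> ?B r" by blast
      then have "block_square R p a k = c" using block_square_eq[OF blocks r(1), of k a] by auto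
      moreover have "idx (coord k :: 'n) = k" using sub r by (intro idx_coord) blast
      ultimately show "k \<in> ?L" by (intro image_eqI[of _ _ "coord k"]) auto
    qed
  qed
  moreover have "card ?U = (\<Sum>r\<in>{r \<in> R. (a r)\<^sup>2 = - c}. card (?B r))"
  proof (rule card_UN_disjoint)
    show "\<forall>r\<in>{r \<in> R. (a r)\<^sup>2 = - c}. \<forall>s\<in>{r \<in> R. (a r)\<^sup>2 = - c}. r \<noteq> s \<longrightarrow> ?B r \<inter> ?B s = {}"
      using disjoint_blocksD[OF blocks] by auto
  qed (use fin in auto)
  moreover have "card (idx ` {j::'n. block_square R p a (idx j) = c}) =
      card {j::'n. block_square R p a (idx j) = c}"
    by (intro card_image inj_onI) simp
  ultimately show ?thesis by simp
qed

text \<open>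
  The multiplicity of 0 is the total length minus the other multiplicities, so the hypothesis fixes the
  multiset of values, and a decreasing sequence is determined by its multiset of values.
\<close>

lemma chain_determined:
  assumes "chain l m a" "chain l m b"
    and "\<And>c. c > 0 \<Longrightarrow> card {r \<in> {l..m}. (a r)\<^sup>2 = c} = card {r \<in> {l..m}. (b r)\<^sup>2 = c}"
    and "r \<in> {l..m}"
  shows "a r = b r"
proof -
  define M where "M = (\<lambda>a::nat \<Rightarrow> real. image_mset a (mset_set {l..m}))"
  have count: "count (M a) c = card {r \<in> {l..m}. a r = c}" for a c
    by (simp add: M_def count_image_mset_eq_card_vimage Collect_conj_eq Int_commute)
  have pos: "count (M a) c = card {r \<in> {l..m}. (a r)\<^sup>2 = c\<^sup>2}" if "chain l m a" "c > 0" for a c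
  proof -
    have "a r = c \<longleftrightarrow> (a r)\<^sup>2 = c\<^sup>2" if "r \<in> {l..m}" for r
      using that \<open>chain l m a\<close> \<open>c > 0\<close> by (auto simp: chain_def power2_eq_iff_nonneg)
    then have "{r \<in> {l..m}. a r = c} = {r \<in> {l..m}. (a r)\<^sup>2 = c\<^sup>2}" by blast
    then show ?thesis by (simp add: count)
  qed
  have neg: "count (M a) c = 0" if "chain l m a" "c < 0" for a c
  proof -
    have "{r \<in> {l..m}. a r = c} = {}" using that by (force simp: chain_def)
    then show ?thesis by (simp add: count)
  qed
  have nz: "count (M a) c = count (M b) c" if "c \<noteq> 0" for c
    using that pos[OF assms(1)] pos[OF assms(2)] neg[OF assms(1)] neg[OF assms(2)] assms(3)[of "c\<^sup>2"]
    by (cases "c > 0") auto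
  have "filter_mset (\<lambda>c. c \<noteq> 0) (M a) = filter_mset (\<lambda>c. c \<noteq> 0) (M b)"
    using nz by (intro multiset_eqI) auto
  moreover have split: "M a = filter_mset (\<lambda>c. c \<noteq> 0) (M a) + replicate_mset (count (M a) 0) 0" for a
    by (intro multiset_eqI) auto
  moreover have "size (M a) = size (M b)" by (simp add: M_def)
  ultimately have "M a = M b"
    by (metis add_left_cancel size_replicate_mset size_union)
  have mset: "mset (rev (map a [l..<Suc m])) = M a" for a :: "nat \<Rightarrow> real"
  proof -
    have "mset [l..<Suc m] = mset_set {l..m}"
      by (simp only: mset_upt atLeastLessThanSuc_atLeastAtMost)
    then show ?thesis by (simp add: M_def del: upt_Suc)
  qed
  have sorted: "sorted (rev (map a [l..<Suc m]))" if "chain l m a" for a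
  proof -
    have "a i \<ge> a j" if "l \<le> i" "i \<le> j" "j \<le> m" for i j
      using that(2,3)
    proof (induction j rule: dec_induct)
      case (step k)
      have "a (Suc k) \<le> a k"
        using step \<open>chain l m a\<close> \<open>l \<le> i\<close> unfolding chain_def by auto
      then show ?case using step by simp
    qed simp
    then have "sorted_wrt (\<ge>) (map a [l..<Suc m])"
      by (auto simp: sorted_wrt_iff_nth_less simp del: upt_Suc)
    then show ?thesis by (simp add: sorted_wrt_rev del: upt_Suc)
  qed
  have "rev (map a [l..<Suc m]) = rev (map b [l..<Suc m])"
    using properties_for_sort[OF _ sorted[OF assms(1)]] properties_for_sort[OF _ sorted[OF assms(2)]]
      mset \<open>M a = M b\<close> by metis
  then have "map a [l..<Suc m] = map b [l..<Suc m]" by simp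
  then show ?thesis using assms(4) by (simp add: map_eq_conv del: upt_Suc)
qed

section \<open>Orthonormal frames and matrices of skew maps\<close>

type_synonym 'n point = "real ^ 'n"
type_synonym 'n spacetime = "real \<times> (real ^ 'n)"
type_synonym 'n square_matrix = "real ^ 'n ^ 'n"

lemma (in symmetric_form) independent_if_orthogonal:
  assumes "finite B" "\<And>x. x \<in> B \<Longrightarrow> g x x \<noteq> 0"
    and "\<And>x y. x \<in> B \<Longrightarrow> y \<in> B \<Longrightarrow> x \<noteq> y \<Longrightarrow> g x y = 0"
  shows "independent B"
proof
  assume "dependent B"
  then obtain c v where v: "v \<in> B" "c v \<noteq> 0" and sum: "(\<Sum>w\<in>B. c w *\<^sub>R w) = 0"
    using dependent_finite[OF assms(1)] by blast
  have "0 = g (\<Sum>w\<in>B. c w *\<^sub>R w) v" by (simp add: sum)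
  also have "\<dots> = (\<Sum>w\<in>B. c w * g w v)" by (simp add: form_sum_left)
  also have "\<dots> = (\<Sum>w\<in>{v}. c w * g w v)"
    using assms v by (intro sum.mono_neutral_right) auto
  finally show False using v assms(2) by simp
qed

lemma (in symmetric_form) orthonormal_length:
  assumes "orthonormal es"
  shows "length es = dim (span (set es))"
proof -
  have "independent (set es)"
    using assms
    by (intro independent_if_orthogonal) (auto simp: orthonormal_def in_set_conv_nth)
  then show ?thesis
    using orthonormal_distinct[OF assms] by (simp add: dim_eq_card_independent distinct_card)
qed

lemma chain_cong: "(\<And>i. i \<in> {l..m} \<Longrightarrow> a i = b i) \<Longrightarrow> chain l m a \<longleftrightarrow> chain l m b"
  unfolding chain_def by auto

text \<open>
  Translation from a rotation frame to numbered parameters: \<open>ss\<close> holds the vectors of the frame that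
  precede the rotation planes, the \<open>r\<close>-th parameter (\<open>l \<le> r \<le> N\<close>) belongs to the plane starting at the
  vector number \<open>p r\<close>, and parameters beyond \<open>N\<close> are set to 0.
\<close>

lemma rotation_frame_parameters:
  fixes u :: "nat \<Rightarrow> 'a::real_vector"
  assumes rot: "rotation_frame f es \<alpha>" and u: "\<And>k. u k = (ss @ es) ! (k - 1)"
    and n: "length ss + length es = n"
    and N: "\<And>r. l \<le> r \<Longrightarrow> r \<le> N \<longleftrightarrow> length ss + 2 * (r - l) + 2 \<le> n"
    and p: "\<And>r. r \<in> {l..N} \<Longrightarrow> p r = length ss + 2 * (r - l) + 1"
  obtains b where "chain l m b" "\<And>r. N < r \<Longrightarrow> b r = 0"
    "\<And>r. r \<in> {l..N} \<Longrightarrow>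
      f (u (p r)) = b r *\<^sub>R u (p r + 1) \<and> f (u (p r + 1)) = - b r *\<^sub>R u (p r)"
    "odd (length es) \<Longrightarrow> f (u n) = 0"
proof -
  define b where "b = (\<lambda>r. if r \<le> N then \<alpha> (r - l) else 0)"
  have pair: "0 \<le> \<alpha> (r - l) \<and> f (es ! (2 * (r - l))) = \<alpha> (r - l) *\<^sub>R es ! (2 * (r - l) + 1)
      \<and> f (es ! (2 * (r - l) + 1)) = - \<alpha> (r - l) *\<^sub>R es ! (2 * (r - l))" if "r \<in> {l..N}" for r
  proof -
    have "2 * (r - l) + 1 < length es" using N[of r] n that by auto
    then show ?thesis using rot unfolding rotation_frame_def by blast
  qed
  have nonneg: "0 \<le> b r" if "l \<le> r" for r
    using pair[of r] that by (simp add: b_def)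
  show thesis
  proof (rule that)
    show "chain l m b"
      unfolding chain_def
    proof (intro conjI ballI)
      fix i assume i: "i \<in> {l..<m}"
      show "b (Suc i) \<le> b i"
      proof (cases "Suc i \<le> N")
        case True
        then have "2 * (i - l) + 3 < length es" using N[of "Suc i"] n i by auto
        then have "\<alpha> (Suc (i - l)) \<le> \<alpha> (i - l)" using rot unfolding rotation_frame_def by blast
        then show ?thesis using True i by (simp add: b_def Suc_diff_le)
      next
        case False
        then show ?thesis using nonneg[of i] i by (simp add: b_def)
      qed
    qed (use nonneg in auto)
    show "b r = 0" if "N < r" for r using that by (simp add: b_def)
    show "f (u (p r)) = b r *\<^sub>R u (p r + 1) \<and> f (u (p r + 1)) = - b r *\<^sub>R u (p r)" if "r \<in> {l..N}" for r
    proof -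
      have "u (p r) = es ! (2 * (r - l))" "u (p r + 1) = es ! (2 * (r - l) + 1)"
        unfolding u p[OF that] by (simp_all add: nth_append)
      then show ?thesis using pair[OF that] that by (simp add: b_def)
    qed
    show "f (u n) = 0" if "odd (length es)"
    proof -
      obtain k where k: "length es = 2 * k + 1" using \<open>odd (length es)\<close> by (rule oddE)
      then have "u n = es ! (2 * k)" using n by (auto simp: u nth_append)
      then show ?thesis using rot k unfolding rotation_frame_def by simp
    qed
  qed
qed

text \<open>
  If \<open>F k\<close> is the image of the frame vector \<open>u k\<close> under a map, this says that \<open>- J_blocks R p a\<close> is the
  matrix of the map in the frame.
\<close>

lemma J_blocks_frame:
  fixes u :: "nat \<Rightarrow> 'a::real_vector" and j :: "'n::{finite,linorder}"
  assumes "disjoint_blocks R p CARD('n)"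
    and "\<And>r. r \<in> R \<Longrightarrow> F (p r) = a r *\<^sub>R u (p r + 1)"
    and "\<And>r. r \<in> R \<Longrightarrow> F (p r + 1) = - a r *\<^sub>R u (p r)"
    and "\<And>k. k \<in> {1..CARD('n)} \<Longrightarrow> (\<And>r. r \<in> R \<Longrightarrow> k \<noteq> p r \<and> k \<noteq> p r + 1) \<Longrightarrow> F k = 0"
  shows "(\<Sum>i\<in>UNIV. (- J_blocks R p a) $ i $ j *\<^sub>R u (idx i)) = F (idx j)"
proof -
  consider r where "r \<in> R" "idx j = p r" | r where "r \<in> R" "idx j = p r + 1"
    | "\<And>r. r \<in> R \<Longrightarrow> idx j \<noteq> p r \<and> idx j \<noteq> p r + 1" by blast
  then show ?thesis
  proof cases
    case 1
    then show ?thesis using J_blocks_column(1)[OF assms(1) 1, of a u] assms(2) by simp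
  next
    case 2
    then show ?thesis using J_blocks_column(2)[OF assms(1) 2, of a u] assms(3) by simp
  next
    case 3
    then show ?thesis using J_blocks_column(3)[OF assms(1) 3, of a u] assms(4)[OF idx_range 3] by simp
  qed
qed

lemma skew_matrix_inner:
  fixes Q :: "'n::finite square_matrix"
  assumes "transpose Q = - Q"
  shows "(Q *v x) \<bullet> y = - (x \<bullet> (Q *v y))"
proof -
  have "x \<bullet> (Q *v y) = (transpose Q *v x) \<bullet> y"
    by (simp add: dot_lmul_matrix)
  moreover have "(- Q) *v x = - (Q *v x)"
    by (simp add: matrix_vector_mult_def vec_eq_iff sum_negf)
  ultimately show ?thesis by (simp only: assms inner_minus_left)
qed

lemma skew_matrix_inner_self:
  fixes Q :: "'n::finite square_matrix"
  assumes "transpose Q = - Q"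
  shows "x \<bullet> (Q *v x) = 0"
  using skew_matrix_inner[OF assms, of x x] by (simp add: inner_commute)

definition frame_map :: "(nat \<Rightarrow> 'a::real_vector) \<Rightarrow> 'n::{finite,linorder} point \<Rightarrow> 'a" where
  "frame_map u x = (\<Sum>i\<in>UNIV. x $ i *\<^sub>R u (idx i))"

lemma linear_frame_map: "linear (frame_map u)"
  unfolding frame_map_def
  by (intro linearI) (auto simp: scaleR_add_left sum.distrib scaleR_sum_right)

lemma frame_map_axis: "frame_map u (axis i 1) = u (idx i)"
proof -
  have "frame_map u (axis i 1) = (\<Sum>j\<in>UNIV. if j = i then u (idx i) else 0)"
    unfolding frame_map_def by (intro sum.cong) (auto simp: axis_def)
  then show ?thesis by simp
qed

lemma (in symmetric_form) form_frame_map: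
  fixes x y :: "'n::{finite,linorder} point"
  assumes "\<And>j k. j \<in> {1..CARD('n)} \<Longrightarrow> k \<in> {1..CARD('n)} \<Longrightarrow> g (u j) (u k) = (if j = k then 1 else 0)"
  shows "g (frame_map u x) (frame_map u y) = x \<bullet> y"
proof -
  have "g (u (idx i)) (frame_map u y) = y $ i" for i :: 'n
  proof -
    have "g (u (idx i)) (frame_map u y) = (\<Sum>j\<in>UNIV. y $ j * g (u (idx i)) (u (idx j)))"
      unfolding frame_map_def by (simp add: commute[of "u (idx i)"] form_sum_left)
    also have "\<dots> = (\<Sum>j\<in>UNIV. if j = i then y $ i else 0)"
      by (intro sum.cong) (auto simp: assms[OF idx_range idx_range])
    finally show ?thesis by simp
  qed
  then show ?thesis
    by (subst frame_map_def) (simp add: form_sum_left inner_vec_def)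
qed

lemma frame_map_matrix:
  assumes "linear f"
    and "\<And>j::'n. (\<Sum>i\<in>UNIV. Q $ i $ j *\<^sub>R u (idx i)) = f (u (idx j))"
  shows "f (frame_map u x) = frame_map u ((Q :: 'n::{finite,linorder} square_matrix) *v x)"
proof -
  have "(\<lambda>x. f (frame_map u x)) = (\<lambda>x. frame_map u (Q *v x))"
  proof (rule linear_eq_frame)
    show "linear (\<lambda>x. f (frame_map u x))"
      using linear_compose[OF linear_frame_map assms(1)] by (simp add: o_def)
    show "linear (\<lambda>x. frame_map u (Q *v x))"
      using linear_compose[OF matrix_vector_mul_linear linear_frame_map] by (simp add: o_def)
    show "f (frame_map u (axis j 1)) = frame_map u (Q *v axis j 1)" for j
      unfolding frame_map_axis
      by (subst frame_map_def) (simp add: assms(2) matrix_vector_mult_basis column_def)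
  qed
  then show ?thesis by meson
qed

section \<open>The Euclidean case\<close>

text \<open>
  The derivative of the isometry is constant, which turns the push-forward into an intertwining relation;
  in this form composition and inversion of isometries are immediate.
\<close>

lemma push_forward_affine_iff:
  fixes A :: "'n::finite square_matrix"
  assumes "orthogonal_matrix A"
  shows "push_forward UNIV (\<lambda>x. A *v x + b) W = W' \<longleftrightarrow> (\<forall>x. A *v W x = W' (A *v x + b))"
proof -
  let ?\<phi> = "\<lambda>x. A *v x + b"
  have A: "A ** transpose A = mat 1" "transpose A ** A = mat 1"
    using assms by (auto simp: orthogonal_matrix_def)
  have inv: "?\<phi> (transpose A *v (y - b)) = y" "transpose A *v (?\<phi> x - b) = x" for x y
    by (simp_all add: matrix_vector_mul_assoc A del: transpose_matrix_vector)
  have "inj ?\<phi>" 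
    by (rule inj_on_inverseI[where g = "\<lambda>y. transpose A *v (y - b)"]) (rule inv(2))
  then have "inv ?\<phi> (?\<phi> x) = x" for x by (rule inv_f_f)
  moreover have "frechet_derivative ?\<phi> (at x) = (*v) A" for x
  proof -
    have "(?\<phi> has_derivative (*v) A) (at x)"
      by (intro has_derivative_add_const linear_imp_has_derivative) simp
    then show ?thesis by (rule frechet_derivative_at[symmetric])
  qed
  ultimately have "push_forward UNIV ?\<phi> W (?\<phi> x) = A *v W x" for x
    by (simp add: push_forward_def Let_def)
  moreover have "f = W' \<longleftrightarrow> (\<forall>x. f (?\<phi> x) = W' (?\<phi> x))" for f
    using inv(1) by (metis ext)
  ultimately show ?thesis by simp
qed

lemma orbit_e_eq:
  "orbit_e W = {W'. \<exists>A b. orthogonal_matrix A \<and> (\<forall>x. A *v W x = W' (A *v x + b))}"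
proof -
  have "W' \<in> orbit_e W \<longleftrightarrow>
      (\<exists>A b. orthogonal_matrix A \<and> push_forward UNIV (\<lambda>x. A *v x + b) W = W')" for W'
    unfolding orbit_e_def euclidean_group_def by blast
  then show ?thesis using push_forward_affine_iff by blast
qed

lemma orbit_e_refl: "W \<in> orbit_e W"
  unfolding orbit_e_eq
  by (intro CollectI exI[of _ "mat 1"] exI[of _ 0]) (simp add: orthogonal_matrix_id)

lemma orbit_e_trans:
  assumes "W' \<in> orbit_e W" "W'' \<in> orbit_e W'"
  shows "W'' \<in> orbit_e W"
proof -
  obtain A b A' b' where A: "orthogonal_matrix A" "\<And>x. A *v W x = W' (A *v x + b)"
    and A': "orthogonal_matrix A'" "\<And>x. A' *v W' x = W'' (A' *v x + b')"
    using assms unfolding orbit_e_eq by blast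
  have "(A' ** A) *v W x = W'' ((A' ** A) *v x + (A' *v b + b'))" for x
    using A(2)[of x] A'(2)[of "A *v x + b"]
    by (simp add: matrix_vector_right_distrib add.assoc flip: matrix_vector_mul_assoc)
  then show ?thesis
    unfolding orbit_e_eq using orthogonal_matrix_mul[OF A'(1) A(1)] by blast
qed

lemma orbit_e_sym:
  assumes "W' \<in> orbit_e W"
  shows "W \<in> orbit_e W'"
proof -
  obtain A b where A: "orthogonal_matrix A" "\<And>x. A *v W x = W' (A *v x + b)"
    using assms unfolding orbit_e_eq by blast
  have AA: "A ** transpose A = mat 1" "transpose A ** A = mat 1"
    using A(1) by (auto simp: orthogonal_matrix_def)
  have "transpose A *v W' y = W (transpose A *v y + (- (transpose A *v b)))" for y
  proof -
    have "W' y = A *v W (transpose A *v (y - b))"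
      unfolding A(2)
      by (simp add: matrix_vector_mul_assoc AA del: transpose_matrix_vector)
    then show ?thesis
      by (simp add: matrix_vector_mul_assoc AA matrix_vector_mult_diff_distrib
          del: transpose_matrix_vector)
  qed
  moreover have "orthogonal_matrix (transpose A)" using A(1) by simp
  ultimately show ?thesis unfolding orbit_e_eq by blast
qed

lemma orbit_e_eq_iff: "orbit_e W = orbit_e W' \<longleftrightarrow> W' \<in> orbit_e W"
  using orbit_e_refl orbit_e_sym orbit_e_trans by blast

lemma m_e_eq: "m_e n = n div 2"
  by (auto simp: m_e_def elim!: oddE)

lemma disjoint_blocks_e: "disjoint_blocks {1..m_e n} (\<lambda>r. 2 * r - 1) n"
  unfolding disjoint_blocks_def m_e_def by (auto; presburger)

lemma not_in_blocks_JT: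
  fixes k n :: nat
  assumes "k \<in> {1..n}" "\<And>r. r \<in> {1..n div 2} \<Longrightarrow> k \<noteq> 2 * r - 1 \<and> k \<noteq> 2 * r - 1 + 1"
  shows "k = n \<and> odd n"
proof -
  have "\<not> (k + 1) div 2 \<in> {1..n div 2}"
    using assms(2)[of "(k + 1) div 2"] assms(1) by (auto; presburger)
  then show ?thesis using assms(1) by (auto; presburger)
qed

lemma nf_e_eq:
  "nf_e \<sigma> a x = (- (1/2) * \<sigma>) *\<^sub>R x
    + (- J_blocks {1..m_e CARD('n)} (\<lambda>r. 2 * r - 1) a) *v (x :: 'n::{finite,linorder} point)"
  by (simp add: nf_e_def field_e_def)

lemma field_e_admissible:
  assumes "x \<in> UNIV" "norm (field_e \<sigma> Q C x) < 1"
  shows "admissible euclid_metric UNIV (field_e \<sigma> Q C)"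
proof -
  have "continuous_on UNIV (field_e \<sigma> Q C)"
    unfolding field_e_def
    by (intro continuous_intros linear_continuous_on)
      (simp add: linear_conv_bounded_linear[symmetric])
  then have "open {x. norm (field_e \<sigma> Q C x) < 1}"
    by (intro open_Collect_less continuous_intros)
  then show ?thesis
    using assms unfolding admissible_def
    by (intro exI[of _ "{x. norm (field_e \<sigma> Q C x) < 1}"])
      (auto simp: nav_norm_def euclid_metric_def norm_eq_sqrt_inner)
qed

lemma nf_e_in_fields_e:
  assumes "\<sigma> \<in> sigmas K"
  shows "(nf_e \<sigma> a :: 'n::{finite,linorder} vfield) \<in> fields_e K"
proof -
  let ?Q = "- J_blocks {1..m_e CARD('n)} (\<lambda>r. 2 * r - 1) a :: 'n square_matrix"
  have "admissible euclid_metric UNIV (field_e \<sigma> ?Q 0)"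
    by (rule field_e_admissible[of 0]) (simp_all add: field_e_def)
  then show ?thesis
    using assms transpose_J_blocks unfolding fields_e_def nf_e_def by blast
qed

text \<open>
  Since \<open>\<sigma> \<noteq> 0\<close>, the linear part of the field is injective: its inner product with \<open>x\<close> is
  \<open>- \<sigma> / 2 * (x \<bullet> x)\<close>.  So the field has a zero, which a translation moves to the origin; a rotation frame
  of \<open>Q\<close> then gives the orthogonal map.
\<close>

lemma field_e_normal_form:
  fixes Q :: "'n::{finite,linorder} square_matrix"
  assumes "\<sigma> \<noteq> 0" "transpose Q = - Q"
  obtains a where "a \<in> params_e CARD('n)" "field_e \<sigma> Q C \<in> orbit_e (nf_e \<sigma> a)"
proof -
  interpret symmetric_form "(\<bullet>) :: 'n point \<Rightarrow> _" by (rule symmetric_form_inner)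
  let ?n = "CARD('n)"
  obtain es \<alpha> where es: "orthonormal es" "span (set es) = UNIV" "rotation_frame ((*v) Q) es \<alpha>"
    using exists_rotation_frame[of "(*v) Q" UNIV] skew_matrix_inner[OF assms(2)] by auto
  have len: "length es = ?n" using orthonormal_length[OF es(1)] es(2) by simp
  define u where "u = (\<lambda>k. ([] @ es) ! (k - 1))"
  have len': "length ([] :: 'n point list) + length es = ?n" using len by simp
  obtain b where b: "chain 1 (m_e ?n) b" "\<And>r. m_e ?n < r \<Longrightarrow> b r = 0"
    and pair: "\<And>r. r \<in> {1..m_e ?n} \<Longrightarrow> Q *v u (2 * r - 1) = b r *\<^sub>R u (2 * r - 1 + 1) \<and>
      Q *v u (2 * r - 1 + 1) = - b r *\<^sub>R u (2 * r - 1)"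
    and last: "odd (length es) \<Longrightarrow> Q *v u ?n = 0"
  proof (rule rotation_frame_parameters[OF es(3) fun_cong[OF u_def] len', where m = "m_e ?n"])
    show "r \<le> m_e ?n \<longleftrightarrow> length ([] :: 'n point list) + 2 * (r - 1) + 2 \<le> ?n" if "1 \<le> r" for r
      using that by (auto simp: m_e_eq)
    show "2 * r - 1 = length ([] :: 'n point list) + 2 * (r - 1) + 1" if "r \<in> {1..m_e ?n}" for r
      using that by auto
  qed (rule that; assumption)
  define a where "a = restrict b {1..m_e ?n}"
  have "a \<in> params_e ?n"
    using b(1) chain_cong[of 1 "m_e ?n" a b] by (simp add: params_e_def rvec_def a_def)
  define J :: "'n square_matrix" where "J = - J_blocks {1..m_e ?n} (\<lambda>r. 2 * r - 1) a"
  have "(\<Sum>i\<in>UNIV. J $ i $ j *\<^sub>R u (idx i)) = Q *v u (idx j)" for j :: 'n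
    unfolding J_def
  proof (rule J_blocks_frame[OF disjoint_blocks_e])
    fix r assume r: "r \<in> {1..m_e ?n}"
    then have "a r = b r" by (simp add: a_def)
    then show "Q *v u (2 * r - 1) = a r *\<^sub>R u (2 * r - 1 + 1)"
      "Q *v u (2 * r - 1 + 1) = - a r *\<^sub>R u (2 * r - 1)"
      using pair[OF r] by metis+
  next
    fix k assume k: "k \<in> {1..?n}" "\<And>r. r \<in> {1..m_e ?n} \<Longrightarrow> k \<noteq> 2 * r - 1 \<and> k \<noteq> 2 * r - 1 + 1"
    then have "k = ?n \<and> odd ?n" unfolding m_e_eq by (intro not_in_blocks_JT) blast+
    then show "Q *v u k = 0" using last len by simp
  qed
  then have QJ: "Q *v frame_map u x = frame_map u (J *v x)" for x :: "'n point"
    by (intro frame_map_matrix) auto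
  have "(frame_map u x :: 'n point) \<bullet> frame_map u y = x \<bullet> y" for x y :: "'n point"
    using es(1) by (intro form_frame_map) (auto simp: orthonormal_def u_def len)
  then have "orthogonal_transformation (frame_map u :: 'n point \<Rightarrow> 'n point)"
    by (simp add: orthogonal_transformation_def linear_frame_map)
  then have orth: "orthogonal_matrix (matrix (frame_map u :: 'n point \<Rightarrow> 'n point))"
    by (simp add: orthogonal_transformation_matrix)
  interpret fm: linear "frame_map u :: 'n point \<Rightarrow> 'n point" by (rule linear_frame_map)
  have matrix_of_frame_map: "matrix (frame_map u) *v x = frame_map u x" for x :: "'n point"
    using matrix_vector_mul(2)[OF fm.linear_axioms] by metis
  \<comment> \<open>The zero \<open>x0\<close> of the field becomes the image of the origin.\<close>
  define f where "f = (\<lambda>x. (- (1/2) * \<sigma>) *\<^sub>R x + Q *v x)"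
  have "linear f"
    unfolding f_def
    by (intro linearI) (auto simp: algebra_simps matrix_vector_right_distrib matrix_vector_mult_scaleR)
  moreover have "inj f"
  proof -
    have "x = 0" if "f x = 0" for x
    proof -
      have "f x \<bullet> x = - (1/2) * \<sigma> * (x \<bullet> x)"
        using skew_matrix_inner_self[OF assms(2), of x]
        by (simp add: f_def inner_add_left inner_commute)
      then show ?thesis using that assms(1) by simp
    qed
    then show ?thesis using \<open>linear f\<close> by (simp add: linear_injective_0)
  qed
  ultimately have "surj f" using linear_injective_imp_surjective by blast
  then obtain x0 where "- C = f x0" by (metis surjD)
  then have x0: "f x0 = - C" by simp
  have "frame_map u (nf_e \<sigma> a x) = field_e \<sigma> Q C (frame_map u x + x0)" for x :: "'n point"
  proof -
    have "field_e \<sigma> Q C (frame_map u x + x0) = (- (1/2) * \<sigma>) *\<^sub>R frame_map u x + Q *v frame_map u x + (f x0 + C)"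
      by (simp add: field_e_def f_def matrix_vector_right_distrib algebra_simps)
    also have "\<dots> = (- (1/2) * \<sigma>) *\<^sub>R frame_map u x + frame_map u (J *v x)"
      by (simp add: x0 QJ)
    also have "\<dots> = frame_map u (nf_e \<sigma> a x)"
      by (simp only: nf_e_eq J_def fm.add fm.scale)
    finally show ?thesis by simp
  qed
  then have "field_e \<sigma> Q C \<in> orbit_e (nf_e \<sigma> a)"
    unfolding orbit_e_eq using orth matrix_of_frame_map
    by (intro CollectI exI[of _ "matrix (frame_map u)"] exI[of _ x0]) simp
  with \<open>a \<in> params_e ?n\<close> show thesis by (rule that)
qed

lemma dim_eigenspace_J_blocks:
  fixes Q :: "'n::{finite,linorder} square_matrix"
  assumes "disjoint_blocks R p CARD('n)" "Q = - J_blocks R p a" "c < 0"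
  shows "dim {x. Q *v (Q *v x) = c *\<^sub>R x} = 2 * card {r \<in> R. (a r)\<^sup>2 = - c}"
proof -
  have "linear (\<lambda>x. Q *v (Q *v x))"
    using linear_compose[OF matrix_vector_mul_linear matrix_vector_mul_linear, of Q Q]
    by (simp add: o_def)
  then have "dim {x. Q *v (Q *v x) = c *\<^sub>R x} = card {j::'n. block_square R p a (idx j) = c}"
    using J_blocks_square[OF assms(1,2)] by (rule dim_eigenspace_diagonal)
  then show ?thesis using card_block_square[OF assms(1,3)] by simp
qed

text \<open>
  An isometry between two normal forms fixes the origin, the only zero of either field.  Then \<open>\<sigma>\<close> can be
  read off from inner products with \<open>x\<close>, and the isometry conjugates the skew parts, so that the
  eigenspaces of their squares have equal dimensions.
\<close>

lemma nf_e_determined: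
  fixes a b :: "nat \<Rightarrow> real"
  assumes "\<sigma> \<noteq> 0" "\<tau> \<noteq> 0" "a \<in> params_e CARD('n::{finite,linorder})" "b \<in> params_e CARD('n)"
    and "(nf_e \<tau> b :: 'n vfield) \<in> orbit_e (nf_e \<sigma> a)"
  shows "\<sigma> = \<tau> \<and> a = b"
proof -
  let ?m = "m_e CARD('n)"
  define Q where "Q = (\<lambda>a. - J_blocks {1..?m} (\<lambda>r. 2 * r - 1) a :: 'n square_matrix)"
  have nf: "nf_e \<sigma> a x = (- (1/2) * \<sigma>) *\<^sub>R x + Q a *v x" for \<sigma> a x
    by (simp add: nf_e_eq Q_def)
  have skew: "x \<bullet> (Q a *v x) = 0" for a x
    unfolding Q_def by (intro skew_matrix_inner_self transpose_J_blocks)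
  obtain A d where A: "orthogonal_matrix A" and eq: "\<And>x. A *v nf_e \<sigma> a x = nf_e \<tau> b (A *v x + d :: 'n point)"
    using assms(5) unfolding orbit_e_eq by blast
  have "nf_e \<tau> b d = 0" using eq[of 0] by (simp add: nf)
  then have "d \<bullet> nf_e \<tau> b d = 0" by simp
  then have "d = 0" using assms(2) by (simp add: nf inner_add_right inner_diff_right skew)
  have iso: "orthogonal_transformation ((*v) A)"
    using A by (simp add: orthogonal_transformation_matrix)
  have AA: "(A *v x) \<bullet> (A *v y) = x \<bullet> y" for x y
    using iso by (simp add: orthogonal_transformation_def)
  have eq': "A *v ((- (1/2) * \<sigma>) *\<^sub>R x + Q a *v x) = (- (1/2) * \<tau>) *\<^sub>R (A *v x) + Q b *v (A *v x)" for x
    using eq[of x] by (simp add: nf \<open>d = 0\<close>)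
  have "\<sigma> = \<tau>"
  proof -
    obtain x :: "'n point" where "x \<noteq> 0" using UNIV_not_singleton[of 0] by blast
    have "(A *v x) \<bullet> (A *v ((- (1/2) * \<sigma>) *\<^sub>R x + Q a *v x)) = - (1/2) * \<sigma> * (x \<bullet> x)"
      unfolding AA by (simp add: inner_add_right inner_diff_right skew)
    moreover have "(A *v x) \<bullet> ((- (1/2) * \<tau>) *\<^sub>R (A *v x) + Q b *v (A *v x)) = - (1/2) * \<tau> * (x \<bullet> x)"
      by (simp add: inner_add_right inner_diff_right skew AA)
    ultimately show ?thesis using \<open>x \<noteq> 0\<close> unfolding eq' by simp
  qed
  have AQ: "A *v (Q a *v x) = Q b *v (A *v x)" for x
    using eq'[of x] \<open>\<sigma> = \<tau>\<close> 
    by (simp add: matrix_vector_right_distrib matrix_vector_mult_diff_distrib matrix_vector_mult_scaleR)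
  have inj: "inj ((*v) A)" using iso by (rule orthogonal_transformation_inj)
  have "dim {x. Q a *v (Q a *v x) = c *\<^sub>R x} = dim {x. Q b *v (Q b *v x) = c *\<^sub>R x}" for c
  proof -
    have "A *v (Q a *v (Q a *v x)) = Q b *v (Q b *v (A *v x))" for x by (simp add: AQ)
    then have iff: "Q b *v (Q b *v (A *v x)) = c *\<^sub>R (A *v x) \<longleftrightarrow> Q a *v (Q a *v x) = c *\<^sub>R x" for x
      by (metis matrix_vector_mult_scaleR inj injD)
    have "(*v) A ` {x. Q a *v (Q a *v x) = c *\<^sub>R x} = {x. Q b *v (Q b *v x) = c *\<^sub>R x}"
    proof (intro equalityI subsetI)
      fix y assume y: "y \<in> {x. Q b *v (Q b *v x) = c *\<^sub>R x}"
      obtain x where "y = A *v x"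
        using orthogonal_transformation_surj[OF iso] by (metis surjD)
      then show "y \<in> (*v) A ` {x. Q a *v (Q a *v x) = c *\<^sub>R x}" using y iff by auto
    qed (use iff in auto)
    moreover have "dim ((*v) A ` {x. Q a *v (Q a *v x) = c *\<^sub>R x}) = dim {x. Q a *v (Q a *v x) = c *\<^sub>R x}"
      using inj by (intro dim_image_eq) (auto intro: inj_on_subset)
    ultimately show ?thesis by simp
  qed
  note dims = this
  have *: "2 * card {r \<in> {1..?m}. (a r)\<^sup>2 = c} = dim {x. Q a *v (Q a *v x) = (- c) *\<^sub>R x}" if "c > 0" for a c
    using dim_eigenspace_J_blocks[OF disjoint_blocks_e, of "Q a" a "- c"] that
    by (simp add: Q_def)
  have card: "card {r \<in> {1..?m}. (a r)\<^sup>2 = c} = card {r \<in> {1..?m}. (b r)\<^sup>2 = c}"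
    if "c > 0" for c
    using *[OF that, of a] *[OF that, of b] dims[of "- c"] by linarith
  have "a r = b r" if "r \<in> {1..?m}" for r
    using chain_determined[OF _ _ card that] assms(3,4) by (auto simp: params_e_def)
  then have "a = b"
    using assms(3,4) by (intro PiE_ext[of a "{1..?m}" "\<lambda>_. UNIV" b]) (auto simp: params_e_def rvec_def)
  with \<open>\<sigma> = \<tau>\<close> show ?thesis by simp
qed

lemma bij_betw_moduli_e:
  assumes "K < 0"
  shows "bij_betw (\<lambda>(\<sigma>, a). orbit_e (nf_e \<sigma> a :: 'n::{finite,linorder} vfield))
      (sigmas K \<times> params_e CARD('n)) (moduli_e K)"
  unfolding bij_betw_def
proof
  have nz: "\<sigma> \<noteq> 0" if "\<sigma> \<in> sigmas K" for \<sigma>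
    using that assms by (auto simp: sigmas_def)
  show "inj_on (\<lambda>(\<sigma>, a). orbit_e (nf_e \<sigma> a :: 'n vfield)) (sigmas K \<times> params_e CARD('n))"
  proof (rule inj_onI, clarify)
    fix \<sigma> a \<tau> b
    assume "\<sigma> \<in> sigmas K" "\<tau> \<in> sigmas K" "a \<in> params_e CARD('n)" "b \<in> params_e CARD('n)"
      and "orbit_e (nf_e \<sigma> a :: 'n vfield) = orbit_e (nf_e \<tau> b)"
    then show "\<sigma> = \<tau> \<and> a = b"
      using nf_e_determined[of \<sigma> \<tau> a b, where 'n = 'n] nz by (simp add: orbit_e_eq_iff)
  qed
  show "(\<lambda>(\<sigma>, a). orbit_e (nf_e \<sigma> a :: 'n vfield)) ` (sigmas K \<times> params_e CARD('n)) = moduli_e K"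
  proof (intro equalityI subsetI)
    fix X assume "X \<in> (moduli_e K :: 'n vfield set set)"
    then obtain \<sigma> Q and C :: "'n point"
      where X: "X = orbit_e (field_e \<sigma> Q C)" "\<sigma> \<in> sigmas K" "transpose Q = - Q"
      by (auto simp: moduli_e_def fields_e_def)
    obtain a where a: "a \<in> params_e CARD('n)" "field_e \<sigma> Q C \<in> orbit_e (nf_e \<sigma> a)"
      using field_e_normal_form[OF nz[OF X(2)] X(3)] by blast
    then have "orbit_e (nf_e \<sigma> a) = X" by (simp add: X(1) orbit_e_eq_iff)
    then show "X \<in> (\<lambda>(\<sigma>, a). orbit_e (nf_e \<sigma> a :: 'n vfield)) ` (sigmas K \<times> params_e CARD('n))"
      using a(1) X(2) by force
  qed (use nf_e_in_fields_e[where 'n = 'n] in \<open>auto simp: moduli_e_def\<close>)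
qed

text \<open>
  Along a ray the radial component of the field grows linearly, because \<open>\<sigma> \<noteq> 0\<close>.
\<close>

lemma fields_e_not_global:
  fixes V :: "'n::finite vfield"
  assumes "V \<in> fields_e K" "K < 0" "CARD('n) \<ge> 2"
  shows "\<exists>x. \<not> strongly_convex euclid_metric V x"
proof (rule ccontr)
  assume "\<not> ?thesis"
  then have small: "V x \<bullet> V x < 1" for x
    using strongly_convex_euclid_iff[OF assms(3), of V] by blast
  obtain \<sigma> Q and C :: "'n point" where V: "V = field_e \<sigma> Q C" "\<sigma> \<in> sigmas K" "transpose Q = - Q"
    using assms(1) by (auto simp: fields_e_def)
  have "\<sigma> \<noteq> 0" using V(2) assms(2) by (auto simp: sigmas_def)
  obtain e :: "'n point" where e: "norm e = 1"
    using vector_choose_size[of 1] by auto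
  define t where "t = 2 * (2 + norm C) / \<bar>\<sigma>\<bar>"
  have "0 < 2 * (2 + norm C)" 
    by (intro mult_pos_pos add_pos_nonneg norm_ge_zero) simp_all
  then have "t > 0" using \<open>\<sigma> \<noteq> 0\<close> unfolding t_def by (intro divide_pos_pos) auto
  have "V (t *\<^sub>R e) \<bullet> e = - (1/2) * \<sigma> * t + C \<bullet> e"
    using skew_matrix_inner_self[OF V(3), of e] e
    by (simp add: V(1) field_e_def inner_add_left inner_add_right inner_diff_right matrix_vector_mult_scaleR inner_commute norm_eq_1)
  moreover have "\<bar>V (t *\<^sub>R e) \<bullet> e\<bar> \<le> 1"
    using Cauchy_Schwarz_ineq2[of "V (t *\<^sub>R e)" e] small[of "t *\<^sub>R e"] e
    by (simp add: norm_eq_sqrt_inner) (smt (verit) real_sqrt_le_1_iff)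
  moreover have "\<bar>C \<bullet> e\<bar> \<le> norm C" using Cauchy_Schwarz_ineq2[of C e] e by simp
  moreover have "\<bar>(1/2) * \<sigma> * t\<bar> = 2 + norm C"
    using \<open>t > 0\<close> \<open>\<sigma> \<noteq> 0\<close> norm_ge_zero[of C] by (simp add: abs_mult t_def)
  ultimately show False by linarith
qed

section \<open>Generators of the Lorentz group\<close>

interpretation lorentz: symmetric_form "lorentz_form :: 'n::finite spacetime \<Rightarrow> 'n spacetime \<Rightarrow> real"
  by unfold_locales
    (auto simp: bilinear_def lorentz_form_def inner_add inner_commute algebra_simps intro!: linearI)

lemma lorentz_form_Pair [simp]: "lorentz_form (s, x) (t, y) = x \<bullet> y - s * t"
  by (simp add: lorentz_form_def)

lemma lorentz_nondegenerate:
  assumes "\<And>v. lorentz_form u v = 0"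
  shows "u = (0 :: 'n::finite spacetime)"
proof -
  have "lorentz_form u (- fst u, snd u) = fst u * fst u + snd u \<bullet> snd u"
    by (simp add: lorentz_form_def)
  then have "fst u * fst u + snd u \<bullet> snd u = 0" using assms by simp
  then have "fst u = 0 \<and> snd u \<bullet> snd u = 0"
    by (smt (verit) inner_ge_zero mult_eq_0_iff zero_le_square)
  then show ?thesis by (simp add: prod_eq_iff)
qed

text \<open>
  The matrix with rows \<open>(0, C\<^sup>T)\<close> and \<open>(C, Q)\<close>; for skew \<open>Q\<close> this is the general element of the Lie
  algebra of the Lorentz group.
\<close>

definition lorentz_gen :: "'n::finite square_matrix \<Rightarrow> 'n point \<Rightarrow> 'n spacetime \<Rightarrow> 'n spacetime" where
  "lorentz_gen Q C p = (snd p \<bullet> C, fst p *\<^sub>R C + Q *v snd p)"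

lemma linear_lorentz_gen: "linear (lorentz_gen Q C)"
  by (intro linearI)
    (auto simp: lorentz_gen_def inner_add_left algebra_simps matrix_vector_right_distrib
      matrix_vector_mult_scaleR)

lemma lorentz_gen_skew:
  assumes "transpose Q = - Q"
  shows "lorentz_form (lorentz_gen Q C u) v = - lorentz_form u (lorentz_gen Q C v)"
  using skew_matrix_inner[OF assms, of "snd u" "snd v"]
  by (simp add: lorentz_form_def lorentz_gen_def inner_add inner_commute)

lemma lorentz_gen_orthogonal:
  assumes "transpose Q = - Q"
  shows "lorentz_form p (lorentz_gen Q C p) = 0"
  using lorentz_gen_skew[OF assms, of C p p] lorentz.commute[of p "lorentz_gen Q C p"] by simp

lemma skew_matrixI:
  fixes Q :: "'n::finite square_matrix"
  assumes "\<And>x y. (Q *v x) \<bullet> y = - (x \<bullet> (Q *v y))"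
  shows "transpose Q = - Q"
proof -
  have entry: "Q $ i $ j = (Q *v axis j 1) \<bullet> axis i 1" for i j
    by (simp add: matrix_vector_mult_basis column_def inner_axis)
  have "\<forall>i j. Q $ j $ i = - Q $ i $ j"
  proof (intro allI)
    fix i j
    show "Q $ j $ i = - Q $ i $ j"
      using assms[of "axis i 1" "axis j 1"] inner_commute[of "axis i 1" "Q *v axis j 1"]
      unfolding entry by simp
  qed
  then show ?thesis
    unfolding vec_eq_iff transpose_def vec_lambda_beta vector_uminus_component .
qed

lemma skew_is_lorentz_gen:
  fixes M :: "'n::finite spacetime \<Rightarrow> 'n spacetime"
  assumes "linear M" and skew: "\<And>u v. lorentz_form (M u) v = - lorentz_form u (M v)"
  obtains Q C where "transpose Q = - Q" "M = lorentz_gen Q C"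
proof -
  interpret M: linear M by fact
  define C where "C = snd (M (1, 0))"
  define f where "f = (\<lambda>x. snd (M (0, x)))"
  have "linear f"
  proof -
    have "linear (\<lambda>x :: 'n point. (0 :: real, x))" by (intro linearI) auto
    from linear_compose[OF linear_compose[OF this assms(1)] bounded_linear.linear[OF bounded_linear_snd]]
    show ?thesis by (simp add: o_def f_def)
  qed
  define Q where "Q = matrix f"
  have Q: "Q *v x = f x" for x
    using fun_cong[OF matrix_vector_mul(2)[OF \<open>linear f\<close>], of x] by (simp add: Q_def)
  have "fst (M (1, 0)) = 0"
    using skew[of "(1, 0)" "(1, 0)"] by (simp add: lorentz_form_def)
  then have M1: "M (1, 0) = (0, C)" by (simp add: C_def prod_eq_iff)
  have M0: "M (0, x) = (x \<bullet> C, Q *v x)" for x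
    using skew[of "(0, x)" "(1, 0)"] by (simp add: M1 Q f_def prod_eq_iff lorentz_form_def)
  have "M p = lorentz_gen Q C p" for p
  proof -
    have "p = fst p *\<^sub>R (1, 0) + (0, snd p)" by (simp add: prod_eq_iff)
    then have "M p = fst p *\<^sub>R M (1, 0) + M (0, snd p)" by (metis M.add M.scale)
    then show ?thesis by (simp add: M1 M0 lorentz_gen_def)
  qed
  moreover have "transpose Q = - Q"
    using skew[of "(0, x)" "(0, y)" for x y] by (intro skew_matrixI) (simp add: M0)
  ultimately show thesis by (intro that) auto
qed

section \<open>The Lorentz group and conjugacy of generators\<close>

lemma lorentz_group_linear: "L \<in> lorentz_group \<Longrightarrow> linear L"
  and lorentz_group_form: "L \<in> lorentz_group \<Longrightarrow> lorentz_form (L u) (L v) = lorentz_form u v"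
  unfolding lorentz_group_def by blast+

lemma timelike_fst_nonzero:
  assumes "lorentz_form p p < 0"
  shows "fst p \<noteq> 0"
proof
  assume "fst p = 0"
  then have "lorentz_form p p = snd p \<bullet> snd p" by (simp add: lorentz_form_def)
  then show False using assms inner_ge_zero[of "snd p"] by linarith
qed

text \<open>
  For timelike vectors the product of the time coordinates dominates the inner product of the space
  parts, so it has the sign of \<open>- lorentz_form p q\<close>.
\<close>

lemma timelike_same_direction:
  fixes p q :: "'a::finite spacetime"
  assumes "lorentz_form p p < 0" "lorentz_form q q < 0" "lorentz_form p q < 0" "fst q > 0"
  shows "fst p > 0"
proof (rule ccontr)
  assume "\<not> fst p > 0"
  have "norm (snd v) < \<bar>fst v\<bar>" if "lorentz_form v v < 0" for v :: "'a spacetime"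
  proof (rule power_less_imp_less_base)
    show "(norm (snd v))\<^sup>2 < \<bar>fst v\<bar>\<^sup>2"
      using that unfolding power2_norm_eq_inner by (simp add: lorentz_form_def power2_eq_square)
  qed simp
  from this[OF assms(1)] this[OF assms(2)]
  have "norm (snd p) * norm (snd q) \<le> \<bar>fst p\<bar> * \<bar>fst q\<bar>"
    by (intro mult_mono) auto
  moreover have "\<bar>snd p \<bullet> snd q\<bar> \<le> norm (snd p) * norm (snd q)" by (rule Cauchy_Schwarz_ineq2)
  moreover have "\<bar>fst p\<bar> * \<bar>fst q\<bar> = - (fst p * fst q)"
    using \<open>\<not> fst p > 0\<close> assms(4) by (simp add: abs_if)
  ultimately show False using assms(3) by (simp add: lorentz_form_def)
qed

lemma lorentz_group_future:
  assumes "L \<in> lorentz_group" "lorentz_form p p < 0" "fst p > 0"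
  shows "fst (L p) > 0"
proof (rule timelike_same_direction[of _ "L (1, 0)"])
  show "lorentz_form (L p) (L (1, 0)) < 0"
    using assms unfolding lorentz_group_form[OF assms(1)] by (simp add: lorentz_form_def)
qed (use assms lorentz_group_form[OF assms(1)] in \<open>simp_all add: lorentz_group_def\<close>)

lemma lorentz_group_id: "id \<in> lorentz_group"
  by (simp add: lorentz_group_def linear_id)

lemma lorentz_group_comp:
  assumes "L \<in> lorentz_group" "L' \<in> lorentz_group"
  shows "L' \<circ> L \<in> lorentz_group"
proof -
  have "lorentz_form (L (1, 0)) (L (1, 0)) < 0"
    unfolding lorentz_group_form[OF assms(1)] by simp
  moreover have "fst (L (1, 0)) > 0" using assms(1) unfolding lorentz_group_def by blast
  ultimately have "fst ((L' \<circ> L) (1, 0)) > 0"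
    using lorentz_group_future[OF assms(2)] by simp
  moreover have "linear (L' \<circ> L)"
    using assms by (intro linear_compose lorentz_group_linear)
  moreover have "lorentz_form ((L' \<circ> L) u) ((L' \<circ> L) v) = lorentz_form u v" for u v
    by (simp only: o_apply lorentz_group_form[OF assms(1)] lorentz_group_form[OF assms(2)])
  ultimately show ?thesis unfolding lorentz_group_def by blast
qed

lemma lorentz_group_inverse:
  assumes "L \<in> lorentz_group"
  obtains L' where "L' \<in> lorentz_group" "\<And>p. L' (L p) = p" "\<And>p. L (L' p) = p"
proof -
  have lin: "linear L" using assms by (rule lorentz_group_linear)
  have "inj L"
    unfolding linear_injective_0[OF lin]
  proof (intro allI impI)
    fix p assume "L p = 0"
    then have "lorentz_form p v = 0" for v
      using lorentz_group_form[OF assms, of p v] by simp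
    then show "p = 0" by (rule lorentz_nondegenerate)
  qed
  then obtain L' where "linear L'" and inv: "\<And>p. L' (L p) = p" "\<And>p. L (L' p) = p"
    using linear_injective_isomorphism[OF lin] by blast
  have form: "lorentz_form (L' u) (L' v) = lorentz_form u v" for u v
    using lorentz_group_form[OF assms, of "L' u" "L' v"] inv by simp
  have "lorentz_form (L' (1, 0)) (1, 0) = lorentz_form (1, 0) (L (1, 0))"
    using lorentz_group_form[OF assms, of "L' (1, 0)" "(1, 0)"] inv by simp
  then have "fst (L' (1, 0)) > 0"
    using assms by (simp add: lorentz_form_def lorentz_group_def)
  then have "L' \<in> lorentz_group"
    using \<open>linear L'\<close> form by (simp add: lorentz_group_def)
  then show thesis using inv by (rule that)
qed

definition lorentz_conjugate ::
    "('n spacetime \<Rightarrow> 'n spacetime) \<Rightarrow> ('n spacetime \<Rightarrow> 'n::finite spacetime) \<Rightarrow> bool" where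
  "lorentz_conjugate M M' \<longleftrightarrow> (\<exists>L\<in>lorentz_group. \<forall>p. L (M p) = M' (L p))"

lemma lorentz_conjugate_refl: "lorentz_conjugate M M"
  unfolding lorentz_conjugate_def using lorentz_group_id by (intro bexI[of _ id]) auto

lemma lorentz_conjugate_sym:
  assumes "lorentz_conjugate M M'"
  shows "lorentz_conjugate M' M"
proof -
  obtain L where L: "L \<in> lorentz_group" "\<And>p. L (M p) = M' (L p)"
    using assms by (auto simp: lorentz_conjugate_def)
  obtain L' where L': "L' \<in> lorentz_group" "\<And>p. L' (L p) = p" "\<And>p. L (L' p) = p"
    using lorentz_group_inverse[OF L(1)] by metis
  have "L' (M' p) = M (L' p)" for p
    using L(2)[of "L' p"] L' by metis
  then show ?thesis using L'(1) by (auto simp: lorentz_conjugate_def)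
qed

lemma lorentz_conjugate_trans:
  assumes "lorentz_conjugate M M'" "lorentz_conjugate M' M''"
  shows "lorentz_conjugate M M''"
proof -
  obtain L L' where "L \<in> lorentz_group" "\<And>p. L (M p) = M' (L p)"
    and "L' \<in> lorentz_group" "\<And>p. L' (M' p) = M'' (L' p)"
    using assms by (auto simp: lorentz_conjugate_def)
  then show ?thesis
    unfolding lorentz_conjugate_def by (intro bexI[of _ "L' \<circ> L"] lorentz_group_comp) auto
qed

section \<open>The action on the ball\<close>

lemma ball_timelike: "x \<in> ball 0 1 \<longleftrightarrow> lorentz_form (1, x) (1, x) < 0" for x :: "'n::finite point"
  unfolding ball_inner_less_one lorentz_form_Pair by simp

lemma klein_action_projective:
  assumes "L \<in> lorentz_group" "x \<in> ball 0 1"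
  shows "fst (L (1, x)) > 0" "L (1, x) = fst (L (1, x)) *\<^sub>R (1, klein_action L x)"
    "klein_action L x \<in> ball 0 1"
proof -
  have t: "lorentz_form (1, x) (1, x) < 0" using assms(2) unfolding ball_timelike .
  define s where "s = fst (L (1, x))"
  define q where "q = (1 :: real, klein_action L x)"
  have pos: "s > 0" using lorentz_group_future[OF assms(1) t] by (simp add: s_def)
  then have eq: "L (1, x) = s *\<^sub>R q"
    by (simp add: klein_action_def prod_eq_iff s_def q_def)
  have "lorentz_form (L (1, x)) (L (1, x)) < 0"
    using t unfolding lorentz_group_form[OF assms(1)] .
  then have "lorentz_form q q < 0" using pos by (simp add: eq mult_less_0_iff)
  then show "klein_action L x \<in> ball 0 1" unfolding ball_timelike q_def .
  show "fst (L (1, x)) > 0" using pos unfolding s_def .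
  show "L (1, x) = fst (L (1, x)) *\<^sub>R (1, klein_action L x)" using eq unfolding s_def q_def .
qed

lemma klein_action_inverse:
  assumes "L \<in> lorentz_group" "L' \<in> lorentz_group" "\<And>p. L' (L p) = p" "x \<in> ball 0 1"
  shows "klein_action L' (klein_action L x) = x"
proof -
  note kl = klein_action_projective[OF assms(1,4)]
  interpret L': linear L' using assms(2) by (rule lorentz_group_linear)
  define s where "s = fst (L (1, x))"
  have "s > 0" "L (1, x) = s *\<^sub>R (1, klein_action L x)" using kl(1,2) unfolding s_def .
  then have "(1, x) = s *\<^sub>R L' (1, klein_action L x)"
    using assms(3)[of "(1, x)"] by (simp add: L'.scale del: scaleR_Pair)
  then have "inverse s *\<^sub>R (1, x) = L' (1, klein_action L x)"
    using \<open>s > 0\<close> by simp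
  then have "L' (1, klein_action L x) = (inverse s, inverse s *\<^sub>R x)"
    by simp
  then show ?thesis using \<open>s > 0\<close> by (simp add: klein_action_def)
qed

text \<open>
  A field of the Klein case is the generator seen in the affine chart \<open>fst = 1\<close>: the component along the
  line through \<open>(1, x)\<close> is removed.
\<close>

lemma field_k_eq:
  "x \<in> ball 0 1 \<Longrightarrow>
   field_k Q C x = snd (lorentz_gen Q C (1, x)) - fst (lorentz_gen Q C (1, x)) *\<^sub>R x"
  by (simp add: field_k_def lorentz_gen_def add.commute)

lemma klein_action_has_derivative:
  assumes "L \<in> lorentz_group" "x \<in> ball 0 1"
  shows "(klein_action L has_derivative
      (\<lambda>v. (snd (L (0, v)) - fst (L (0, v)) *\<^sub>R klein_action L x) /\<^sub>R fst (L (1, x)))) (at x)"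
proof -
  interpret L: bounded_linear L
    using lorentz_group_linear[OF assms(1)] by (simp add: linear_conv_bounded_linear)
  have L: "((\<lambda>x. L (1, x)) has_derivative (\<lambda>v. L (0, v))) (at x)"
    by (intro L.has_derivative) (auto intro!: derivative_eq_intros)
  have t: "fst (L (1, x)) \<noteq> 0" using klein_action_projective(1)[OF assms] by simp
  have "((\<lambda>x. inverse (fst (L (1, x))) *\<^sub>R snd (L (1, x))) has_derivative
     (\<lambda>v. (snd (L (0, v)) - fst (L (0, v)) *\<^sub>R klein_action L x) /\<^sub>R fst (L (1, x)))) (at x)"
    by (rule has_derivative_eq_rhs[OF has_derivative_scaleR[OF
          Deriv.has_derivative_inverse[OF t has_derivative_fst[OF L]] has_derivative_snd[OF L]]])
      (simp add: klein_action_def fun_eq_iff algebra_simps)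
  then show ?thesis unfolding klein_action_def[abs_def] by simp
qed

text \<open>
  The derivative of the projection onto the chart kills the line itself, so only \<open>L\<close> applied to the
  generator survives.
\<close>

lemma push_forward_klein_action:
  fixes Q Q' :: "'n::finite square_matrix"
  assumes "L \<in> lorentz_group" "\<And>p. L (lorentz_gen Q C p) = lorentz_gen Q' C' (L p)"
  shows "push_forward (ball 0 1) (klein_action L) (field_k Q C) = field_k Q' C'"
proof
  fix y :: "'n point"
  obtain L' where L': "L' \<in> lorentz_group" "\<And>p. L' (L p) = p" "\<And>p. L (L' p) = p"
    using lorentz_group_inverse[OF assms(1)] by metis
  show "push_forward (ball 0 1) (klein_action L) (field_k Q C) y = field_k Q' C' y"
  proof (cases "y \<in> ball 0 1")
    case False
    then show ?thesis by (simp add: push_forward_def field_k_def)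
  next
    case True
    define x where "x = klein_action L' y"
    have x: "x \<in> ball 0 1" "klein_action L x = y"
      using klein_action_projective(3)[OF L'(1) True] klein_action_inverse[OF L'(1) assms(1) L'(3) True]
      by (simp_all add: x_def)
    have "inj_on (klein_action L) (ball 0 1)"
      by (rule inj_on_inverseI[where g = "klein_action L'"])
        (rule klein_action_inverse[OF assms(1) L'(1,2)])
    then have inv: "inv_into (ball 0 1) (klein_action L) y = x"
      using x by (rule inv_into_f_eq)
    define t where "t = fst (L (1, x))"
    have "t > 0" using klein_action_projective(1)[OF assms(1) x(1)] unfolding t_def .
    moreover have "L (1, x) = t *\<^sub>R (1, y)"
      using klein_action_projective(2)[OF assms(1) x(1)] unfolding t_def x(2) .
    ultimately have t: "t \<noteq> 0" "L (1, x) = t *\<^sub>R (1, y)" by simp_all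
    define s where "s = fst (lorentz_gen Q C (1, x))"
    interpret L: linear L using assms(1) by (rule lorentz_group_linear)
    interpret M': linear "lorentz_gen Q' C'" by (rule linear_lorentz_gen)
    have "(0, field_k Q C x) = lorentz_gen Q C (1, x) - s *\<^sub>R (1, x)"
      by (simp add: field_k_eq[OF x(1)] s_def prod_eq_iff)
    then have LW: "L (0, field_k Q C x) = t *\<^sub>R lorentz_gen Q' C' (1, y) - s *\<^sub>R t *\<^sub>R (1, y)"
      using assms(2)[of "(1, x)"] by (simp only: L.diff L.scale t(2) M'.scale)
    have "frechet_derivative (klein_action L) (at x) (field_k Q C x) =
        (snd (L (0, field_k Q C x)) - fst (L (0, field_k Q C x)) *\<^sub>R y) /\<^sub>R t"
      using frechet_derivative_at[OF klein_action_has_derivative[OF assms(1) x(1)], symmetric]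
      by (simp add: x(2) t_def)
    also have "\<dots> = field_k Q' C' y"
      using t(1) unfolding LW by (simp add: field_k_eq[OF True] algebra_simps)
    finally show ?thesis
      using True by (simp add: push_forward_def inv Let_def)
  qed
qed

text \<open>
  Conjugates of a generator by Lorentz maps are again skew, hence again generators, so orbits of fields
  are conjugacy classes of generators.
\<close>

lemma orbit_k_iff:
  assumes "transpose Q = - Q"
  shows "W' \<in> orbit_k (field_k Q C) \<longleftrightarrow>
    (\<exists>Q' C'. transpose Q' = - Q' \<and> W' = field_k Q' C' \<and>
       lorentz_conjugate (lorentz_gen Q C) (lorentz_gen Q' C'))" (is "_ \<longleftrightarrow> ?R")
proof
  assume "W' \<in> orbit_k (field_k Q C)"
  then obtain L where L: "L \<in> lorentz_group" and W': "W' = push_forward (ball 0 1) (klein_action L) (field_k Q C)"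
    by (auto simp: orbit_k_def)
  obtain L' where L': "L' \<in> lorentz_group" "\<And>p. L' (L p) = p" "\<And>p. L (L' p) = p"
    using lorentz_group_inverse[OF L] by metis
  define M where "M = (\<lambda>p. L (lorentz_gen Q C (L' p)))"
  have lin: "linear M"
    using linear_compose[OF linear_compose[OF lorentz_group_linear[OF L'(1)] linear_lorentz_gen[of Q C]]
        lorentz_group_linear[OF L]] by (simp add: M_def o_def)
  have skew: "lorentz_form (M u) v = - lorentz_form u (M v)" for u v
  proof -
    have "lorentz_form (M u) v = lorentz_form (lorentz_gen Q C (L' u)) (L' v)"
      unfolding M_def using lorentz_group_form[OF L, of _ "L' v"] by (simp add: L'(3))
    also have "\<dots> = - lorentz_form (L' u) (lorentz_gen Q C (L' v))"
      by (rule lorentz_gen_skew[OF assms])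
    also have "lorentz_form (L' u) (lorentz_gen Q C (L' v)) = lorentz_form u (M v)"
      unfolding M_def using lorentz_group_form[OF L, of "L' u"] by (simp add: L'(3))
    finally show ?thesis .
  qed
  obtain Q' C' where QC: "transpose Q' = - Q'" "M = lorentz_gen Q' C'"
    using skew_is_lorentz_gen[OF lin skew] by blast
  have "L (lorentz_gen Q C p) = lorentz_gen Q' C' (L p)" for p
    unfolding QC(2)[symmetric] by (simp add: M_def L'(2))
  then show ?R
    using push_forward_klein_action[OF L, of Q C Q' C'] W' QC(1) L
    by (auto simp: lorentz_conjugate_def)
next
  assume ?R
  then obtain Q' C' L where "W' = field_k Q' C'" and L: "L \<in> lorentz_group"
    and "\<And>p. L (lorentz_gen Q C p) = lorentz_gen Q' C' (L p)"
    by (auto simp: lorentz_conjugate_def)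
  then have "W' = push_forward (ball 0 1) (klein_action L) (field_k Q C)"
    using push_forward_klein_action[OF L, of Q C Q' C'] by simp
  then show "W' \<in> orbit_k (field_k Q C)"
    unfolding orbit_k_def using L by (rule image_eqI)
qed

lemma field_k_inject:
  fixes Q Q' :: "'n::finite square_matrix"
  assumes "field_k Q C = field_k Q' C'"
  shows "Q = Q' \<and> C = C'"
proof
  have eq: "Q *v x + C - (x \<bullet> C) *\<^sub>R x = Q' *v x + C' - (x \<bullet> C') *\<^sub>R x" if "x \<in> ball 0 1" for x
    using fun_cong[OF assms, of x] that by (simp add: field_k_def)
  show C: "C = C'" using eq[of 0] by simp
  have "Q *v axis j 1 = Q' *v axis j 1" for j
  proof -
    have "(1/2) *\<^sub>R axis j 1 \<in> ball (0 :: 'n point) 1" by simp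
    from eq[OF this] have "Q *v ((1/2) *\<^sub>R axis j 1) = Q' *v ((1/2) *\<^sub>R axis j 1)"
      by (simp add: C)
    then show ?thesis by (simp add: matrix_vector_mult_scaleR)
  qed
  then show "Q = Q'"
    by (simp add: vec_eq_iff matrix_vector_mult_basis column_def)
qed

lemma orbit_k_eq_iff:
  assumes "transpose Q = - Q" "transpose Q' = - Q'"
  shows "orbit_k (field_k Q C) = orbit_k (field_k Q' C') \<longleftrightarrow>
    lorentz_conjugate (lorentz_gen Q C) (lorentz_gen Q' C')"
proof
  assume "orbit_k (field_k Q C) = orbit_k (field_k Q' C')"
  moreover have "field_k Q' C' \<in> orbit_k (field_k Q' C')"
    unfolding orbit_k_iff[OF assms(2)] using assms(2) lorentz_conjugate_refl by blast
  ultimately show "lorentz_conjugate (lorentz_gen Q C) (lorentz_gen Q' C')"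
    using orbit_k_iff[OF assms(1)] field_k_inject by metis
next
  assume "lorentz_conjugate (lorentz_gen Q C) (lorentz_gen Q' C')"
  then have "lorentz_conjugate (lorentz_gen Q C) M \<longleftrightarrow> lorentz_conjugate (lorentz_gen Q' C') M" for M
    using lorentz_conjugate_sym lorentz_conjugate_trans by blast
  then show "orbit_k (field_k Q C) = orbit_k (field_k Q' C')"
    by (intro set_eqI) (simp only: orbit_k_iff[OF assms(1)] orbit_k_iff[OF assms(2)])
qed

section \<open>The length of a field in the Klein metric\<close>

text \<open>
  The Lorentz-orthogonal complement of \<open>(1, x)\<close>, to which the generator sends \<open>(1, x)\<close>, is the tangent
  space of the ball at \<open>x\<close>, with the Lorentz form divided by \<open>\<bar>K\<bar> * (1 - x \<bullet> x)\<close> as the Klein metric.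
\<close>

lemma klein_metric_field_k:
  fixes Q :: "'n::finite square_matrix"
  assumes "transpose Q = - Q" "x \<in> ball 0 1"
  shows "klein_metric K x (field_k Q C x) (field_k Q C x) =
    lorentz_form (lorentz_gen Q C (1, x)) (lorentz_gen Q C (1, x)) / (\<bar>K\<bar> * (1 - x \<bullet> x))"
proof -
  define b where "b = C + Q *v x"
  define s where "s = x \<bullet> C"
  define r where "r = 1 - x \<bullet> x"
  have r: "r > 0" using assms(2) unfolding ball_inner_less_one r_def by simp
  have xb: "x \<bullet> b = s"
    using skew_matrix_inner_self[OF assms(1), of x] by (simp add: b_def s_def inner_add_right)
  have W: "field_k Q C x = b - s *\<^sub>R x"
    using assms(2) by (simp add: field_k_def b_def s_def add.commute)
  have WW: "(b - s *\<^sub>R x) \<bullet> (b - s *\<^sub>R x) = b \<bullet> b - 2 * s\<^sup>2 + s\<^sup>2 * (1 - r)"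
    by (simp add: inner_diff inner_commute[of b x] xb r_def power2_eq_square algebra_simps)
  have xW: "x \<bullet> (b - s *\<^sub>R x) = s * r"
    by (simp add: inner_diff_right xb r_def algebra_simps)
  have "klein_metric K x (field_k Q C x) (field_k Q C x) =
      ((b \<bullet> b - 2 * s\<^sup>2 + s\<^sup>2 * (1 - r)) * r + (s * r) * (s * r)) / (\<bar>K\<bar> * r\<^sup>2)"
    unfolding klein_metric_def W WW xW r_def[symmetric] ..
  also have "\<dots> = ((b \<bullet> b - s * s) * r) / ((\<bar>K\<bar> * r) * r)"
    by (simp add: power2_eq_square algebra_simps)
  also have "\<dots> = (b \<bullet> b - s * s) / (\<bar>K\<bar> * r)" using r by simp
  also have "b \<bullet> b - s * s = lorentz_form (lorentz_gen Q C (1, x)) (lorentz_gen Q C (1, x))"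
    by (simp add: lorentz_gen_def b_def s_def)
  finally show ?thesis by (simp add: r_def)
qed

lemma klein_metric_field_k_less_one:
  fixes Q :: "'n::finite square_matrix"
  assumes "transpose Q = - Q" "x \<in> ball 0 1" "K < 0"
  shows "klein_metric K x (field_k Q C x) (field_k Q C x) < 1 \<longleftrightarrow>
    lorentz_form (lorentz_gen Q C (1, x)) (lorentz_gen Q C (1, x)) < \<bar>K\<bar> * (1 - x \<bullet> x)"
proof -
  have "\<bar>K\<bar> * (1 - x \<bullet> x) > 0"
    using assms(2,3) unfolding ball_inner_less_one by (intro mult_pos_pos) auto
  then show ?thesis
    unfolding klein_metric_field_k[OF assms(1,2)] by (rule divide_less_eq_1_pos)
qed

text \<open>
  The condition at one point spreads to a neighbourhood by continuity, and by homogeneity from \<open>(1, x)\<close>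
  to all timelike vectors.  In this form it is visibly Lorentz invariant.
\<close>

lemma admissible_field_k_iff:
  fixes Q :: "'n::finite square_matrix"
  assumes "transpose Q = - Q" "K < 0"
  shows "admissible (klein_metric K) (ball 0 1) (field_k Q C) \<longleftrightarrow>
    (\<exists>p. lorentz_form p p < 0 \<and>
      lorentz_form (lorentz_gen Q C p) (lorentz_gen Q C p) < \<bar>K\<bar> * - lorentz_form p p)"
proof -
  let ?M = "lorentz_gen Q C"
  define U where "U = {x \<in> ball 0 1. lorentz_form (?M (1, x)) (?M (1, x)) < \<bar>K\<bar> * (1 - x \<bullet> x)}"
  have U: "nav_norm (klein_metric K) (field_k Q C) x < 1 \<longleftrightarrow> x \<in> U" if "x \<in> ball 0 1" for x
    using klein_metric_field_k_less_one[OF assms(1) that assms(2)] that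
    by (simp add: nav_norm_def U_def)
  have "open U"
  proof -
    have "continuous_on UNIV (\<lambda>x. lorentz_form (?M (1, x)) (?M (1, x)))"
      by (intro lorentz.continuous_on_form linear_continuous_on_compose[OF _ linear_lorentz_gen]
          continuous_on_Pair continuous_on_const continuous_on_id)
    then have "open {x. lorentz_form (?M (1, x)) (?M (1, x)) < \<bar>K\<bar> * (1 - x \<bullet> x)}"
      by (intro open_Collect_less continuous_intros) auto
    moreover have "U = ball 0 1 \<inter> {x. lorentz_form (?M (1, x)) (?M (1, x)) < \<bar>K\<bar> * (1 - x \<bullet> x)}"
      by (auto simp: U_def)
    ultimately show ?thesis by (simp add: open_Int)
  qed
  moreover have "U \<subseteq> ball 0 1" by (auto simp: U_def)
  ultimately have "admissible (klein_metric K) (ball 0 1) (field_k Q C) \<longleftrightarrow> U \<noteq> {}"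
    unfolding admissible_def using U by blast
  also have "\<dots> \<longleftrightarrow> (\<exists>p. lorentz_form p p < 0 \<and> lorentz_form (?M p) (?M p) < \<bar>K\<bar> * - lorentz_form p p)"
  proof
    assume "U \<noteq> {}"
    then obtain x where x: "x \<in> ball 0 1" "lorentz_form (?M (1, x)) (?M (1, x)) < \<bar>K\<bar> * (1 - x \<bullet> x)"
      by (auto simp: U_def)
    then show "\<exists>p. lorentz_form p p < 0 \<and> lorentz_form (?M p) (?M p) < \<bar>K\<bar> * - lorentz_form p p"
      unfolding ball_timelike by (intro exI[of _ "(1, x)"]) auto
  next
    assume "\<exists>p. lorentz_form p p < 0 \<and> lorentz_form (?M p) (?M p) < \<bar>K\<bar> * - lorentz_form p p"
    then obtain p where p: "lorentz_form p p < 0" "lorentz_form (?M p) (?M p) < \<bar>K\<bar> * - lorentz_form p p"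
      by blast
    define t where "t = fst p"
    define x where "x = snd p /\<^sub>R t"
    have t: "t \<noteq> 0" using timelike_fst_nonzero[OF p(1)] by (simp add: t_def)
    then have px: "p = t *\<^sub>R (1, x)" by (simp add: x_def t_def prod_eq_iff)
    have form: "lorentz_form p p = t\<^sup>2 * lorentz_form (1, x) (1, x)"
      unfolding px by (simp add: power2_eq_square algebra_simps)
    have M: "?M p = t *\<^sub>R ?M (1, x)" unfolding px by (rule linear_scale[OF linear_lorentz_gen])
    have formM: "lorentz_form (?M p) (?M p) = t\<^sup>2 * lorentz_form (?M (1, x)) (?M (1, x))"
      unfolding M by (simp add: power2_eq_square)
    have t2: "t\<^sup>2 > 0" using t by simp
    have "x \<in> ball 0 1"
      unfolding ball_timelike using p(1) t2 by (simp add: form mult_less_0_iff del: lorentz_form_Pair)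
    moreover have "t\<^sup>2 * lorentz_form (?M (1, x)) (?M (1, x)) < t\<^sup>2 * (\<bar>K\<bar> * (1 - x \<bullet> x))"
      using p(2) unfolding formM form by (simp add: algebra_simps)
    ultimately have "x \<in> U" using t2 by (simp add: U_def)
    then show "U \<noteq> {}" by blast
  qed
  finally show ?thesis .
qed

lemma admissible_conjugate:
  fixes Q Q' :: "'n::finite square_matrix"
  assumes "transpose Q = - Q" "transpose Q' = - Q'" "K < 0"
    and "lorentz_conjugate (lorentz_gen Q C) (lorentz_gen Q' C')"
    and "admissible (klein_metric K) (ball 0 1) (field_k Q C)"
  shows "admissible (klein_metric K) (ball 0 1) (field_k Q' C')"
proof -
  obtain L where L: "L \<in> lorentz_group" "\<And>p. L (lorentz_gen Q C p) = lorentz_gen Q' C' (L p)"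
    using assms(4) by (auto simp: lorentz_conjugate_def)
  obtain p where "lorentz_form p p < 0"
    "lorentz_form (lorentz_gen Q C p) (lorentz_gen Q C p) < \<bar>K\<bar> * - lorentz_form p p"
    using assms(5) unfolding admissible_field_k_iff[OF assms(1,3)] by blast
  then show ?thesis
    unfolding admissible_field_k_iff[OF assms(2,3)]
    using lorentz_group_form[OF L(1)] by (intro exI[of _ "L p"]) (simp flip: L(2))
qed

section \<open>Generators in an adapted frame\<close>

definition lorentz_frame :: "nat \<Rightarrow> 'n::finite spacetime \<Rightarrow> (nat \<Rightarrow> 'n spacetime) \<Rightarrow> bool" where
  "lorentz_frame n f0 u \<longleftrightarrow> lorentz_form f0 f0 = -1 \<and> (\<forall>k\<in>{1..n}. lorentz_form f0 (u k) = 0) \<and>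
     (\<forall>j\<in>{1..n}. \<forall>k\<in>{1..n}. lorentz_form (u j) (u k) = (if j = k then 1 else 0))"

text \<open>
  The Lorentz map that sends the standard basis to the frame conjugates one to the other.  If \<open>f0\<close>
  points to the past, its negative is taken, which is orthochronous and intertwines as well.
\<close>

lemma lorentz_frame_conjugate:
  fixes Q :: "'n::{finite,linorder} square_matrix"
  assumes "linear M" and frame: "lorentz_frame CARD('n) f0 u" and f0: "M f0 = frame_map u C"
    and u: "\<And>j::'n. M (u (idx j)) = C $ j *\<^sub>R f0 + (\<Sum>i\<in>UNIV. Q $ i $ j *\<^sub>R u (idx i))"
  shows "lorentz_conjugate (lorentz_gen Q C) M"
proof -
  interpret M: linear M by fact
  interpret u: linear "frame_map u :: 'n point \<Rightarrow> _" by (rule linear_frame_map)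
  define L where "L = (\<lambda>p :: 'n spacetime. fst p *\<^sub>R f0 + frame_map u (snd p))"
  have lin: "linear L"
    unfolding L_def by (intro linearI) (auto simp: u.add u.scale algebra_simps)
  have orth: "lorentz_form f0 (frame_map u x) = 0" for x :: "'n point"
  proof -
    have "lorentz_form (u (idx i)) f0 = 0" for i :: 'n
      using frame idx_range[of i] unfolding lorentz_frame_def by (simp only: lorentz.commute)
    then have "lorentz_form (frame_map u x) f0 = 0"
      by (simp add: frame_map_def lorentz.form_sum_left)
    then show ?thesis by (simp only: lorentz.commute)
  qed
  have f0f0: "lorentz_form f0 f0 = - 1" using frame by (simp add: lorentz_frame_def)
  have "lorentz_form (u j) (u k) = (if j = k then 1 else 0)"
    if "j \<in> {1..CARD('n)}" "k \<in> {1..CARD('n)}" for j k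
    using frame that unfolding lorentz_frame_def by blast
  from lorentz.form_frame_map[OF this]
  have form: "lorentz_form (L p) (L q) = lorentz_form p q" for p q
    using orth lorentz.commute[of "frame_map u (snd p)" f0] f0f0
    by (simp add: L_def lorentz_form_def[of p q])
  have comm: "M (L p) = L (lorentz_gen Q C p)" for p
  proof -
    have "(\<lambda>x. M (frame_map u x)) = (\<lambda>x. (x \<bullet> C) *\<^sub>R f0 + frame_map u (Q *v x))"
    proof (rule linear_eq_frame)
      show "linear (\<lambda>x. M (frame_map u x))"
        using linear_compose[OF linear_frame_map assms(1)] by (simp add: o_def)
      show "linear (\<lambda>x. (x \<bullet> C) *\<^sub>R f0 + frame_map u (Q *v x))"
        by (intro linearI) (auto simp: u.add u.scale inner_add_left algebra_simps
            matrix_vector_right_distrib matrix_vector_mult_scaleR)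
      show "M (frame_map u (axis j 1)) = (axis j 1 \<bullet> C) *\<^sub>R f0 + frame_map u (Q *v axis j 1)" for j
        unfolding frame_map_axis u
        by (subst frame_map_def) (simp add: matrix_vector_mult_basis column_def inner_axis')
    qed
    then have "M (frame_map u x) = (x \<bullet> C) *\<^sub>R f0 + frame_map u (Q *v x)" for x :: "'n point"
      by meson
    then show ?thesis
      by (simp add: L_def M.add M.scale f0 lorentz_gen_def u.add u.scale)
  qed
  have L10: "L (1, 0) = f0" by (simp add: L_def u.zero)
  have "fst f0 \<noteq> 0" using timelike_fst_nonzero[of f0] f0f0 by simp
  then consider "fst f0 > 0" | "fst f0 < 0" by linarith
  then show ?thesis
  proof cases
    case 1
    then have "L \<in> lorentz_group" using lin form L10 by (simp add: lorentz_group_def)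
    then show ?thesis
      unfolding lorentz_conjugate_def using comm by (intro bexI[of _ L]) simp_all
  next
    case 2
    have "linear (\<lambda>p. - L p)" using lin by (rule linear_compose_neg)
    then have "(\<lambda>p. - L p) \<in> lorentz_group"
      using form L10 2 by (simp add: lorentz_group_def)
    then show ?thesis
      unfolding lorentz_conjugate_def using comm M.neg by (intro bexI[of _ "\<lambda>p. - L p"]) simp_all
  qed
qed

lemma m_k_eq: "m_k n = (n + 1) div 2"
  by (auto simp: m_k_def elim!: evenE)

lemma Q_JT_eq: "(Q_JT a :: 'n::{finite,linorder} square_matrix) =
    - J_blocks {1..CARD('n) div 2} (\<lambda>r. 2 * r - 1) a"
proof -
  have "(if even CARD('n) then m_k CARD('n) else m_k CARD('n) - 1) = CARD('n) div 2"
    by (auto simp: m_k_eq elim!: evenE oddE)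
  then show ?thesis unfolding Q_JT_def by simp
qed

lemma disjoint_blocks_JT: "disjoint_blocks {1..n div 2} (\<lambda>r. 2 * r - 1) n"
  using disjoint_blocks_e[of n] by (simp only: m_e_eq)

lemma disjoint_blocks_S: "disjoint_blocks {2..m_k n} (\<lambda>r. 2 * r - 2) n"
  unfolding disjoint_blocks_def m_k_eq by (auto; presburger)

lemma frame_map_first_coord:
  "frame_map u (first_coord c :: 'n::{finite,linorder} point) = c *\<^sub>R u 1"
proof -
  have 1: "1 \<in> {1..CARD('n)}" by (simp add: Suc_leI)
  have "(first_coord c :: 'n point) $ i *\<^sub>R u (idx i) = (if i = coord 1 then c *\<^sub>R u 1 else 0)" for i
    unfolding first_coord_def vec_lambda_beta eq_coord_iff[OF 1, symmetric] by (cases "idx i = 1") simp_all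
  then show ?thesis unfolding frame_map_def by simp
qed

text \<open>
  The common shape of the three types: \<open>M\<close> rotates the blocks, and in addition exchanges \<open>f0\<close> with the
  first frame vector at the rate \<open>c\<close>.
\<close>

lemma conjugate_block_form:
  fixes M :: "'n::{finite,linorder} spacetime \<Rightarrow> 'n spacetime"
  assumes "linear M" "lorentz_frame CARD('n) f0 u" and blocks: "disjoint_blocks R p CARD('n)"
    and f0: "M f0 = c *\<^sub>R u 1"
    and pair: "\<And>r. r \<in> R \<Longrightarrow> M (u (p r)) = (if p r = 1 then c else 0) *\<^sub>R f0 + a r *\<^sub>R u (p r + 1)"
      "\<And>r. r \<in> R \<Longrightarrow> M (u (p r + 1)) = - a r *\<^sub>R u (p r)"
    and other: "\<And>k. k \<in> {1..CARD('n)} \<Longrightarrow> (\<And>r. r \<in> R \<Longrightarrow> k \<noteq> p r \<and> k \<noteq> p r + 1) \<Longrightarrow>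
      M (u k) = (if k = 1 then c else 0) *\<^sub>R f0"
  shows "lorentz_conjugate (lorentz_gen (- J_blocks R p a :: 'n square_matrix) (first_coord c)) M"
proof (rule lorentz_frame_conjugate[OF assms(1,2)])
  show "M f0 = frame_map u (first_coord c :: 'n point)"
    by (simp only: frame_map_first_coord f0)
  fix j :: 'n
  \<comment> \<open>The images of the frame vectors without their \<open>f0\<close> components.\<close>
  define F where "F = (\<lambda>k. M (u k) - (if k = 1 then c else 0) *\<^sub>R f0)"
  have "(\<Sum>i\<in>UNIV. (- J_blocks R p a) $ i $ j *\<^sub>R u (idx i)) = F (idx j)"
  proof (rule J_blocks_frame[OF blocks])
    fix r assume r: "r \<in> R"
    then have "p r + 1 \<noteq> 1" using blocks by (auto simp: disjoint_blocks_def)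
    then show "F (p r) = a r *\<^sub>R u (p r + 1)" "F (p r + 1) = - a r *\<^sub>R u (p r)"
      unfolding F_def pair[OF r] by simp_all
  qed (simp add: F_def other)
  then show "M (u (idx j)) = first_coord c $ j *\<^sub>R f0
      + (\<Sum>i\<in>UNIV. (- J_blocks R p a) $ i $ j *\<^sub>R u (idx i))"
    by (simp add: F_def first_coord_def)
qed

text \<open>
  Here \<open>f0 + u 2\<close> is a null vector in the kernel, and \<open>M\<close> is nilpotent on the span of \<open>f0\<close>, \<open>u 1\<close> and \<open>u 2\<close>.
  Apart from the \<open>f0\<close> component of \<open>M (u 1)\<close>, the first two frame vectors look like a rotation
  plane of speed \<open>a 1\<close>, which is why the first block of \<open>Q_JT\<close> reappears here.
\<close>

lemma conjugate_type_T:
  fixes M :: "'n::{finite,linorder} spacetime \<Rightarrow> 'n spacetime"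
  assumes "linear M" "lorentz_frame CARD('n) f0 u"
    and M: "M f0 = a 1 *\<^sub>R u 1" "M (u 1) = a 1 *\<^sub>R (f0 + u 2)" "M (u 2) = - a 1 *\<^sub>R u 1"
    and pair: "\<And>r. r \<in> {2..CARD('n) div 2} \<Longrightarrow>
      M (u (2 * r - 1)) = a r *\<^sub>R u (2 * r - 1 + 1) \<and> M (u (2 * r - 1 + 1)) = - a r *\<^sub>R u (2 * r - 1)"
    and last: "odd CARD('n) \<Longrightarrow> M (u CARD('n)) = 0" and "CARD('n) \<ge> 2"
  shows "lorentz_conjugate (lorentz_gen (Q_JT a :: 'n square_matrix) (first_coord (a 1))) M"
  unfolding Q_JT_eq
proof (rule conjugate_block_form[OF assms(1,2) disjoint_blocks_JT M(1)])
  fix r assume r: "r \<in> {1..CARD('n) div 2}"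
  have "M (u (2 * r - 1)) = (if 2 * r - 1 = 1 then a 1 else 0) *\<^sub>R f0 + a r *\<^sub>R u (2 * r - 1 + 1)
    \<and> M (u (2 * r - 1 + 1)) = - a r *\<^sub>R u (2 * r - 1)"
  proof (cases "r = 1")
    case True
    then have p: "2 * r - 1 = 1" "1 + 1 = (2::nat)" by simp_all
    show ?thesis unfolding p unfolding True M by (simp add: scaleR_add_right)
  next
    case False
    then have "2 * r - 1 \<noteq> 1" "r \<in> {2..CARD('n) div 2}" using r by auto
    then show ?thesis using pair[of r] by simp
  qed
  then show "M (u (2 * r - 1)) = (if 2 * r - 1 = 1 then a 1 else 0) *\<^sub>R f0 + a r *\<^sub>R u (2 * r - 1 + 1)"
    "M (u (2 * r - 1 + 1)) = - a r *\<^sub>R u (2 * r - 1)" by blast+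
next
  fix k assume k: "k \<in> {1..CARD('n)}"
    "\<And>r. r \<in> {1..CARD('n) div 2} \<Longrightarrow> k \<noteq> 2 * r - 1 \<and> k \<noteq> 2 * r - 1 + 1"
  then have "k = CARD('n) \<and> odd CARD('n)" by (rule not_in_blocks_JT)
  then show "M (u k) = (if k = 1 then a 1 else 0) *\<^sub>R f0"
    using last \<open>CARD('n) \<ge> 2\<close> by auto
qed

section \<open>Completing a frame\<close>

text \<open>
  Reversed Cauchy-Schwarz inequality; it makes the orthogonal complement of a timelike vector a
  positive definite space, to which \<open>exists_rotation_frame\<close> applies.
\<close>

lemma spacelike_if_orthogonal_to_timelike:
  fixes f v :: "'n::finite spacetime"
  assumes "lorentz_form f f < 0" "lorentz_form v f = 0" "v \<noteq> 0"
  shows "lorentz_form v v > 0"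
proof (rule ccontr)
  assume "\<not> lorentz_form v v > 0"
  obtain s a where f: "f = (s, a)" by (cases f)
  obtain t x where v: "v = (t, x)" by (cases v)
  have as: "a \<bullet> a < s\<^sup>2" and xt: "x \<bullet> x \<le> t\<^sup>2" and xa: "x \<bullet> a = t * s"
    using assms \<open>\<not> lorentz_form v v > 0\<close> by (simp_all add: f v power2_eq_square)
  have "t \<noteq> 0"
  proof
    assume "t = 0"
    then have "x \<bullet> x \<le> 0" using xt by simp
    then have "x = 0" using inner_ge_zero[of x] inner_eq_zero_iff[of x] by linarith
    then show False using assms(3) \<open>t = 0\<close> by (simp add: v zero_prod_def)
  qed
  have "(x \<bullet> a)\<^sup>2 \<le> (x \<bullet> x) * (a \<bullet> a)" by (rule Cauchy_Schwarz_ineq)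
  also have "\<dots> \<le> t\<^sup>2 * (a \<bullet> a)" using xt by (intro mult_right_mono) auto
  also have "\<dots> < t\<^sup>2 * s\<^sup>2" using as \<open>t \<noteq> 0\<close> by (intro mult_strict_left_mono) auto
  finally show False by (simp add: xa power_mult_distrib)
qed

lemma (in symmetric_form) orthonormal_append:
  assumes "orthonormal xs" "orthonormal ys" "\<And>x y. x \<in> set xs \<Longrightarrow> y \<in> set ys \<Longrightarrow> g x y = 0"
  shows "orthonormal (xs @ ys)"
  unfolding orthonormal_def
proof (intro allI impI)
  fix i j
  assume ij: "i < length (xs @ ys)" "j < length (xs @ ys)"
  have 0: "g (xs ! k) (ys ! l) = 0" "g (ys ! l) (xs ! k) = 0" if "k < length xs" "l < length ys" for k l
    using assms(3)[of "xs ! k" "ys ! l"] commute[of "ys ! l" "xs ! k"] that by simp_all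
  show "g ((xs @ ys) ! i) ((xs @ ys) ! j) = (if i = j then 1 else 0)"
    using ij assms(1,2) 0 unfolding orthonormal_def nth_append by auto
qed

lemma (in symmetric_form) orthonormal_nth:
  assumes "orthonormal es" "e \<in> set es" "e' \<in> set es"
  shows "g e e' = (if e = e' then 1 else 0)"
proof -
  obtain i j where "i < length es" "e = es ! i" "j < length es" "e' = es ! j"
    using assms(2,3) by (metis in_set_conv_nth)
  then show ?thesis
    using assms(1) orthonormal_distinct[OF assms(1)] by (simp add: orthonormal_def nth_eq_iff_index_eq)
qed

text \<open>
  The orthogonal complement of \<open>f0\<close> and \<open>ss\<close> is positive definite and, by the last hypothesis, invariant,
  so that it has a rotation frame.  The number of new vectors comes from counting: \<open>f0\<close>, \<open>ss\<close> and \<open>es\<close>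
  together form a basis.
\<close>

lemma lorentz_frame_complete:
  fixes M :: "'n::finite spacetime \<Rightarrow> 'n spacetime"
  assumes "linear M" and skew: "\<And>u v. lorentz_form (M u) v = - lorentz_form u (M v)"
    and f0: "lorentz_form f0 f0 = -1" and ss: "lorentz.orthonormal ss" "\<And>e. e \<in> set ss \<Longrightarrow> lorentz_form f0 e = 0"
    and invariant: "\<And>v. lorentz_form v f0 = 0 \<Longrightarrow> (\<forall>e\<in>set ss. lorentz_form v e = 0) \<Longrightarrow>
      lorentz_form (M v) f0 = 0 \<and> (\<forall>e\<in>set ss. lorentz_form (M v) e = 0)"
  obtains es \<alpha> where "lorentz_frame CARD('n) f0 (\<lambda>k. (ss @ es) ! (k - 1))"
    "length ss + length es = CARD('n)" "rotation_frame M es \<alpha>"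
proof -
  define E where "E = {v. lorentz_form v f0 = 0 \<and> (\<forall>e\<in>set ss. lorentz_form v e = 0)}"
  have "subspace E" unfolding E_def subspace_def by auto
  moreover have "M v \<in> E" if "v \<in> E" for v using that invariant by (simp add: E_def)
  moreover have "lorentz_form v v > 0" if "v \<in> E" "v \<noteq> 0" for v
    using that f0 by (intro spacelike_if_orthogonal_to_timelike[of f0]) (auto simp: E_def)
  ultimately obtain es \<alpha> where es: "lorentz.orthonormal es" "span (set es) = E" "rotation_frame M es \<alpha>"
    using lorentz.exists_rotation_frame[OF assms(1) skew] by blast
  have mem: "e \<in> E" if "e \<in> set es" for e using es(2) that span_base by blast
  have orth: "lorentz.orthonormal (ss @ es)"
  proof (rule lorentz.orthonormal_append[OF ss(1) es(1)])
    fix x y assume "x \<in> set ss" "y \<in> set es"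
    then have "lorentz_form y x = 0" using mem by (simp add: E_def)
    then show "lorentz_form x y = 0" by (simp only: lorentz.commute)
  qed
  have f0_orth: "lorentz_form f0 e = 0" if "e \<in> set (ss @ es)" for e
  proof (cases "e \<in> set ss")
    case False
    then have "lorentz_form e f0 = 0" using mem that by (simp add: E_def)
    then show ?thesis by (simp only: lorentz.commute)
  qed (rule ss(2))
  define B where "B = insert f0 (set (ss @ es))"
  have "f0 \<notin> set (ss @ es)" using f0_orth[of f0] f0 by auto
  moreover have "independent B"
  proof (rule lorentz.independent_if_orthogonal)
    show "lorentz_form x x \<noteq> 0" if "x \<in> B" for x
      using that f0 lorentz.orthonormal_nth[OF orth, of x x] by (auto simp: B_def)
    show "lorentz_form x y = 0" if "x \<in> B" "y \<in> B" "x \<noteq> y" for x y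
      using that f0_orth[of x] f0_orth[of y] lorentz.commute[of x f0]
        lorentz.orthonormal_nth[OF orth, of x y] by (auto simp: B_def)
  qed (simp add: B_def)
  moreover have "span B = UNIV"
  proof -
    have "v \<in> span B" for v
    proof -
      define w where "w = v + lorentz_form v f0 *\<^sub>R f0 - (\<Sum>e\<in>set ss. lorentz_form v e *\<^sub>R e)"
      have "w \<in> E"
      proof -
        have "lorentz_form (\<Sum>e\<in>set ss. lorentz_form v e *\<^sub>R e) f0 = 0"
        proof -
          have "lorentz_form e f0 = 0" if "e \<in> set ss" for e
            using ss(2)[OF that] by (simp only: lorentz.commute)
          then show ?thesis by (simp add: lorentz.form_sum_left)
        qed
        moreover have "lorentz_form (\<Sum>e\<in>set ss. lorentz_form v e *\<^sub>R e) e' = lorentz_form v e'" if "e' \<in> set ss" for e'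
        proof -
          have "lorentz_form (\<Sum>e\<in>set ss. lorentz_form v e *\<^sub>R e) e'
              = (\<Sum>e\<in>set ss. if e = e' then lorentz_form v e' else 0)"
            unfolding lorentz.form_sum_left
          proof (rule sum.cong[OF refl])
            fix e assume "e \<in> set ss"
            from lorentz.orthonormal_nth[OF ss(1) this that]
            show "lorentz_form (lorentz_form v e *\<^sub>R e) e' = (if e = e' then lorentz_form v e' else 0)"
              by simp
          qed
          then show ?thesis using that by simp
        qed
        ultimately show ?thesis using f0 ss(2) by (simp add: E_def w_def)
      qed
      then have "w \<in> span B" using es(2) span_mono[of "set es" B] by (auto simp: B_def)
      moreover have "f0 \<in> span B" by (intro span_base) (simp add: B_def)
      moreover have "(\<Sum>e\<in>set ss. lorentz_form v e *\<^sub>R e) \<in> span B"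
        by (intro span_sum span_scale span_base) (simp add: B_def)
      ultimately have "w - lorentz_form v f0 *\<^sub>R f0 + (\<Sum>e\<in>set ss. lorentz_form v e *\<^sub>R e) \<in> span B"
        by (intro span_add span_diff span_scale)
      then show ?thesis by (simp add: w_def)
    qed
    then show ?thesis by blast
  qed
  ultimately have "card (set (ss @ es)) + 1 = DIM(real \<times> 'n point)"
    using dim_eq_card_independent[of B] dim_eq_full[of B] by (simp add: B_def)
  then have len: "length ss + length es = CARD('n)"
    using distinct_card[OF lorentz.orthonormal_distinct[OF orth]] by simp
  have "lorentz_frame CARD('n) f0 (\<lambda>k. (ss @ es) ! (k - 1))"
    unfolding lorentz_frame_def
  proof (intro conjI ballI)
    fix k assume k: "k \<in> {1..CARD('n)}"
    then have k1: "k - 1 < length (ss @ es)" using len by auto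
    then show "lorentz_form f0 ((ss @ es) ! (k - 1)) = 0" by (intro f0_orth nth_mem)
    fix j assume "j \<in> {1..CARD('n)}"
    then show "lorentz_form ((ss @ es) ! (j - 1)) ((ss @ es) ! (k - 1)) = (if j = k then 1 else 0)"
      using orth k k1 len unfolding lorentz.orthonormal_def by auto
  qed (rule f0)
  then show thesis using len es(3) by (rule that)
qed

lemma normal_form_J:
  fixes M :: "'n::{finite,linorder} spacetime \<Rightarrow> 'n spacetime"
  assumes "linear M" and skew: "\<And>u v. lorentz_form (M u) v = - lorentz_form u (M v)"
    and p: "lorentz_form p p < 0" "M p = 0"
  obtains a where "a \<in> params_k K CARD('n) Type_J"
    "lorentz_conjugate (lorentz_gen (Q_JT a :: 'n square_matrix) 0) M"
proof -
  let ?n = "CARD('n)" and ?m = "m_k CARD('n)"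
  interpret M: linear M by fact
  define f0 where "f0 = p /\<^sub>R sqrt (- lorentz_form p p)"
  have f0: "lorentz_form f0 f0 = -1" "M f0 = 0"
    using p by (simp_all add: f0_def M.scale field_simps)
  obtain es \<alpha> where frame: "lorentz_frame ?n f0 (\<lambda>k. ([] @ es) ! (k - 1))"
      and n: "length ([] :: ('n spacetime) list) + length es = ?n" and rot: "rotation_frame M es \<alpha>"
    by (rule lorentz_frame_complete[OF assms(1) skew f0(1), of "[]"])
      (auto simp: lorentz.orthonormal_def skew f0(2))
  define u where "u = (\<lambda>k. ([] @ es) ! (k - 1))"
  obtain b where b: "chain 1 ?m b" "\<And>r. ?n div 2 < r \<Longrightarrow> b r = 0"
    and pair: "\<And>r. r \<in> {1..?n div 2} \<Longrightarrow> M (u (2 * r - 1)) = b r *\<^sub>R u (2 * r - 1 + 1) \<and>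
      M (u (2 * r - 1 + 1)) = - b r *\<^sub>R u (2 * r - 1)"
    and last: "odd (length es) \<Longrightarrow> M (u ?n) = 0"
  proof (rule rotation_frame_parameters[OF rot fun_cong[OF u_def] n, where m = ?m])
    show "r \<le> ?n div 2 \<longleftrightarrow> length ([] :: 'n spacetime list) + 2 * (r - 1) + 2 \<le> ?n" if "1 \<le> r" for r
      using that by auto
    show "2 * r - 1 = length ([] :: 'n spacetime list) + 2 * (r - 1) + 1" if "r \<in> {1..?n div 2}" for r
      using that by auto
  qed (rule that; assumption)
  define a where "a = restrict b {1..?m}"
  have ab: "a r = b r" if "r \<in> {1..?n div 2}" for r
    using that by (auto simp: a_def m_k_eq)
  have "a ?m = 0" if "odd ?n"
    using b(2)[of ?m] that by (auto simp: a_def m_k_eq elim!: oddE)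
  then have "a \<in> params_k K ?n Type_J"
    using b(1) chain_cong[of 1 ?m a b] by (simp add: rvec_def a_def)
  moreover have "lorentz_conjugate (lorentz_gen (Q_JT a :: 'n square_matrix) 0) M"
  proof -
    have "lorentz_conjugate (lorentz_gen (- J_blocks {1..?n div 2} (\<lambda>r. 2 * r - 1) a :: 'n square_matrix)
        (first_coord 0)) M"
    proof (rule conjugate_block_form[OF assms(1) frame[folded u_def] disjoint_blocks_JT])
      show "M (u (2 * r - 1)) = (if 2 * r - 1 = 1 then 0 else 0) *\<^sub>R f0 + a r *\<^sub>R u (2 * r - 1 + 1)"
        "M (u (2 * r - 1 + 1)) = - a r *\<^sub>R u (2 * r - 1)" if "r \<in> {1..?n div 2}" for r
        unfolding ab[OF that] using pair[OF that] by simp_all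
    next
      fix k assume k: "k \<in> {1..?n}"
        "\<And>r. r \<in> {1..?n div 2} \<Longrightarrow> k \<noteq> 2 * r - 1 \<and> k \<noteq> 2 * r - 1 + 1"
      then have "k = ?n \<and> odd ?n" by (rule not_in_blocks_JT)
      then show "M (u k) = (if k = 1 then 0 else 0) *\<^sub>R f0" using last n by simp
    qed (simp add: f0)
    moreover have "first_coord 0 = (0 :: 'n point)" by (simp add: first_coord_def vec_eq_iff)
    ultimately show ?thesis unfolding Q_JT_eq by simp
  qed
  ultimately show thesis by (rule that)
qed

lemma normal_form_S:
  fixes M :: "'n::{finite,linorder} spacetime \<Rightarrow> 'n spacetime"
  assumes "linear M" and skew: "\<And>u v. lorentz_form (M u) v = - lorentz_form u (M v)"
    and f0: "lorentz_form f0 f0 = -1" and u1: "lorentz_form u1 u1 = 1" "lorentz_form f0 u1 = 0"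
    and M: "M f0 = c *\<^sub>R u1" "M u1 = c *\<^sub>R f0"
  obtains a where "a \<in> rvec (m_k CARD('n))" "a 1 = c" "chain 2 (m_k CARD('n)) a"
    "lorentz_conjugate (lorentz_gen (Q_S a :: 'n square_matrix) (first_coord (a 1))) M"
proof -
  let ?n = "CARD('n)" and ?m = "m_k CARD('n)"
  obtain es \<alpha> where frame: "lorentz_frame ?n f0 (\<lambda>k. ([u1] @ es) ! (k - 1))"
      and n: "length [u1] + length es = ?n" and rot: "rotation_frame M es \<alpha>"
    by (rule lorentz_frame_complete[OF assms(1) skew f0, of "[u1]"])
      (auto simp: lorentz.orthonormal_def skew M u1)
  define u where "u = (\<lambda>k. ([u1] @ es) ! (k - 1))"
  have u_1: "u 1 = u1" by (simp add: u_def)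
  obtain b where b: "chain 2 ?m b" "\<And>r. ?m < r \<Longrightarrow> b r = 0"
    and pair: "\<And>r. r \<in> {2..?m} \<Longrightarrow> M (u (2 * r - 2)) = b r *\<^sub>R u (2 * r - 2 + 1) \<and>
      M (u (2 * r - 2 + 1)) = - b r *\<^sub>R u (2 * r - 2)"
    and last: "odd (length es) \<Longrightarrow> M (u ?n) = 0"
  proof (rule rotation_frame_parameters[OF rot fun_cong[OF u_def] n, where m = ?m])
    show "r \<le> ?m \<longleftrightarrow> length [u1] + 2 * (r - 2) + 2 \<le> ?n" if "2 \<le> r" for r
      using that unfolding m_k_eq by auto
    show "2 * r - 2 = length [u1] + 2 * (r - 2) + 1" if "r \<in> {2..?m}" for r
      using that by auto
  qed (rule that; assumption)
  define a where "a = (\<lambda>i\<in>{1..?m}. if i = 1 then c else b i)"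
  have a1: "a 1 = c" by (simp add: a_def m_k_eq Suc_leI)
  have ab: "a r = b r" if "r \<in> {2..?m}" for r
    using that by (auto simp: a_def)
  have "chain 2 ?m a" using b(1) chain_cong[OF ab] by simp
  moreover have "lorentz_conjugate (lorentz_gen (Q_S a :: 'n square_matrix) (first_coord (a 1))) M"
    unfolding Q_S_def
  proof (rule conjugate_block_form[OF assms(1) frame[folded u_def] disjoint_blocks_S])
    show "M f0 = a 1 *\<^sub>R u 1" unfolding a1 u_1 by (rule M)
    fix r assume r: "r \<in> {2..?m}"
    then have "2 * r - 2 \<noteq> 1" by (auto; presburger)
    then show "M (u (2 * r - 2)) = (if 2 * r - 2 = 1 then a 1 else 0) *\<^sub>R f0 + a r *\<^sub>R u (2 * r - 2 + 1)"
      "M (u (2 * r - 2 + 1)) = - a r *\<^sub>R u (2 * r - 2)"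
      unfolding ab[OF r] using pair[OF r] by simp_all
  next
    fix k assume k: "k \<in> {1..?n}" "\<And>r. r \<in> {2..?m} \<Longrightarrow> k \<noteq> 2 * r - 2 \<and> k \<noteq> 2 * r - 2 + 1"
    show "M (u k) = (if k = 1 then a 1 else 0) *\<^sub>R f0"
    proof (cases "k = 1")
      case True
      then show ?thesis by (simp add: u_1 M a1 del: One_nat_def)
    next
      case False
      have "\<not> (k + 2) div 2 \<in> {2..?m}"
        using k(2)[of "(k + 2) div 2"] k(1) False by (auto; presburger)
      then have "k = ?n" "even ?n" using k(1) False unfolding m_k_eq by (auto; presburger)+
      moreover from \<open>even ?n\<close> have "odd (length es)" using n by simp presburger
      ultimately show ?thesis using last False by simp
    qed
  qed
  moreover have "a \<in> rvec ?m" by (simp add: rvec_def a_def)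
  ultimately show thesis using a1 by (intro that)
qed

lemma normal_form_T:
  fixes M :: "'n::{finite,linorder} spacetime \<Rightarrow> 'n spacetime"
  assumes "linear M" and skew: "\<And>u v. lorentz_form (M u) v = - lorentz_form u (M v)"
    and f0: "lorentz_form f0 f0 = -1" and u1: "lorentz_form u1 u1 = 1" "lorentz_form f0 u1 = 0"
    and u2: "lorentz_form u2 u2 = 1" "lorentz_form f0 u2 = 0" "lorentz_form u1 u2 = 0"
    and M: "M f0 = c *\<^sub>R u1" "M u1 = c *\<^sub>R (f0 + u2)" "M u2 = - c *\<^sub>R u1" and "c > 0"
  obtains a where "a \<in> params_k K CARD('n) Type_T"
    "lorentz_conjugate (lorentz_gen (Q_JT a :: 'n square_matrix) (first_coord (a 1))) M"
proof -
  let ?n = "CARD('n)" and ?m = "m_k CARD('n)"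
  have ss: "lorentz.orthonormal [u1, u2]"
    using u1 u2 by (intro lorentz.orthonormal_Cons) (auto simp: lorentz.orthonormal_def)
  have f0_ss: "lorentz_form f0 e = 0" if "e \<in> set [u1, u2]" for e
    using that u1(2) u2(2) unfolding list.set insert_iff empty_iff by metis
  obtain es \<alpha> where frame: "lorentz_frame ?n f0 (\<lambda>k. ([u1, u2] @ es) ! (k - 1))"
      and n: "length [u1, u2] + length es = ?n" and rot: "rotation_frame M es \<alpha>"
    by (rule lorentz_frame_complete[OF assms(1) skew f0 ss f0_ss]) (simp_all add: skew M)
  define u where "u = (\<lambda>k. ([u1, u2] @ es) ! (k - 1))"
  have u_12: "u 1 = u1" "u 2 = u2" by (simp_all add: u_def)
  have n2: "?n \<ge> 2" using n by simp
  obtain b where b: "chain 2 ?m b" "\<And>r. ?n div 2 < r \<Longrightarrow> b r = 0"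
    and pair: "\<And>r. r \<in> {2..?n div 2} \<Longrightarrow> M (u (2 * r - 1)) = b r *\<^sub>R u (2 * r - 1 + 1) \<and>
      M (u (2 * r - 1 + 1)) = - b r *\<^sub>R u (2 * r - 1)"
    and last: "odd (length es) \<Longrightarrow> M (u ?n) = 0"
  proof (rule rotation_frame_parameters[OF rot fun_cong[OF u_def] n, where m = ?m])
    show "r \<le> ?n div 2 \<longleftrightarrow> length [u1, u2] + 2 * (r - 2) + 2 \<le> ?n" if "2 \<le> r" for r
      using that by auto
    show "2 * r - 1 = length [u1, u2] + 2 * (r - 2) + 1" if "r \<in> {2..?n div 2}" for r
      using that by auto
  qed (rule that; assumption)
  define a where "a = (\<lambda>i\<in>{1..?m}. if i = 1 then c else b i)"
  have a1: "a 1 = c" by (simp add: a_def m_k_eq Suc_leI)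
  have ab: "a r = b r" if "r \<in> {2..?m}" for r
    using that by (auto simp: a_def)
  have ab': "a r = b r" if "r \<in> {2..?n div 2}" for r
    using that by (intro ab) (auto simp: m_k_eq)
  have "a ?m = 0" if "odd ?n"
  proof -
    have "?m \<in> {2..?m}" "?n div 2 < ?m" using that n2 by (auto simp: m_k_eq elim!: oddE)
    then show ?thesis using ab b(2) by simp
  qed
  moreover have "chain 2 ?m a" using b(1) chain_cong[OF ab] by simp
  moreover have "a \<in> rvec ?m" by (simp add: rvec_def a_def)
  ultimately have "a \<in> params_k K ?n Type_T" using a1 \<open>c > 0\<close> by simp
  moreover have "lorentz_conjugate (lorentz_gen (Q_JT a :: 'n square_matrix) (first_coord (a 1))) M"
  proof (rule conjugate_type_T[OF assms(1) frame[folded u_def]])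
    show "M f0 = a 1 *\<^sub>R u 1" "M (u 1) = a 1 *\<^sub>R (f0 + u 2)" "M (u 2) = - a 1 *\<^sub>R u 1"
      unfolding a1 u_12 by (rule M)+
    show "M (u (2 * r - 1)) = a r *\<^sub>R u (2 * r - 1 + 1) \<and> M (u (2 * r - 1 + 1)) = - a r *\<^sub>R u (2 * r - 1)"
      if "r \<in> {2..?n div 2}" for r
      unfolding ab'[OF that] by (rule pair[OF that])
    show "M (u ?n) = 0" if "odd ?n"
    proof (rule last)
      show "odd (length es)" using n that by simp presburger
    qed
  qed (rule n2)
  ultimately show thesis by (rule that)
qed

section \<open>Existence of normal forms\<close>

text \<open>
  Brouwer's theorem for \<open>x + W x\<close>, retracted radially to the ball.  At a fixed point \<open>W x\<close> is a nonnegative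
  multiple of \<open>x\<close>, and positive only if \<open>x\<close> lies on the sphere; but there \<open>W\<close> is tangent to the sphere.
  In terms of the generator, \<open>(1, x)\<close> is an eigenvector that is timelike or null.
\<close>

lemma field_k_has_zero_in_cball:
  fixes Q :: "'n::finite square_matrix"
  assumes "transpose Q = - Q"
  obtains x where "x \<in> cball 0 1" "Q *v x + C = (x \<bullet> C) *\<^sub>R x"
proof -
  define W where "W = (\<lambda>x. Q *v x + C - (x \<bullet> C) *\<^sub>R x)"
  define f where "f = (\<lambda>x. (x + W x) /\<^sub>R max 1 (norm (x + W x)))"
  have "continuous_on (cball 0 1) W"
    unfolding W_def by (intro continuous_intros)
  then have "continuous_on (cball 0 1) f"
    unfolding f_def by (intro continuous_intros) auto
  moreover have "f \<in> cball 0 1 \<rightarrow> cball 0 1"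
    unfolding f_def by (auto simp: divide_simps)
  ultimately obtain x where x: "x \<in> cball 0 1" "f x = x"
    using brouwer[of "cball 0 1" f] by auto
  define m where "m = max 1 (norm (x + W x))"
  have m: "m \<ge> 1" by (simp add: m_def)
  have "m *\<^sub>R ((x + W x) /\<^sub>R m) = m *\<^sub>R x" using x(2) by (simp only: f_def m_def[symmetric])
  then have "x + W x = m *\<^sub>R x" using m by simp
  then have W: "W x = (m - 1) *\<^sub>R x" by (simp add: algebra_simps)
  have "W x = 0"
  proof (cases "m = 1")
    case False
    then have "norm (m *\<^sub>R x) = m" using \<open>x + W x = m *\<^sub>R x\<close> unfolding m_def by (simp add: max_def split: if_splits)
    then have "x \<bullet> x = 1" using m by (simp add: norm_eq_1)
    have "W x \<bullet> x = 0"
      using skew_matrix_inner_self[OF assms, of x] \<open>x \<bullet> x = 1\<close>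
      by (simp add: W_def inner_add_left inner_add_right inner_diff_left inner_diff_right inner_commute)
    then show ?thesis using W \<open>x \<bullet> x = 1\<close> by simp
  qed (simp add: W)
  then show thesis using x(1) unfolding W_def by (intro that) simp_all
qed

lemma null_orthogonal:
  fixes x :: "'n::finite point"
  assumes "x \<bullet> x = 1" "lorentz_form v (1, x) = 0"
  shows "lorentz_form v v = (snd v - fst v *\<^sub>R x) \<bullet> (snd v - fst v *\<^sub>R x)"
proof -
  obtain t y where v: "v = (t, y)" by (cases v)
  have "y \<bullet> x = t" using assms(2) by (simp add: v)
  then show ?thesis
    using assms(1) by (simp add: v inner_diff_left inner_diff_right inner_commute)
qed

text \<open>
  The adjoint of \<open>M\<close> under the Lorentz form is \<open>- M\<close>, so \<open>- \<mu>\<close> is an eigenvalue along with \<open>\<mu>\<close>.  Its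
  eigenvector is also null and not orthogonal to \<open>(1, x)\<close>, and the two null lines span a plane on
  which \<open>M\<close> generates boosts.
\<close>

lemma hyperbolic_plane:
  fixes x :: "'n::finite point" and M :: "'n spacetime \<Rightarrow> 'n spacetime"
  assumes "linear M" and skew: "\<And>u v. lorentz_form (M u) v = - lorentz_form u (M v)"
    and x: "x \<bullet> x = 1" "M (1, x) = \<mu> *\<^sub>R (1, x)" "\<mu> \<noteq> 0"
  obtains f0 u1 c where "c > 0" "lorentz_form f0 f0 = -1" "lorentz_form u1 u1 = 1"
    "lorentz_form f0 u1 = 0" "M f0 = c *\<^sub>R u1" "M u1 = c *\<^sub>R f0"
proof -
  interpret M: linear M by fact
  define p where "p = (1 :: real, x)"
  have Mp: "M p = \<mu> *\<^sub>R p" using x(2) by (simp add: p_def)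
  have pp: "lorentz_form p p = 0" by (simp add: p_def x(1))
  have "p \<noteq> 0" by (simp add: p_def zero_prod_def)
  define N where "N = (\<lambda>v. M v + \<mu> *\<^sub>R v)"
  have "linear N" unfolding N_def by (intro linearI) (auto simp: M.add M.scale algebra_simps)
  have Np: "lorentz_form p (N w) = 0" for w
    using skew[of p w] by (simp add: N_def Mp)
  have "\<not> inj N"
  proof
    assume "inj N"
    then have "surj N" using \<open>linear N\<close> linear_injective_imp_surjective by blast
    then have "lorentz_form p v = 0" for v using Np by (metis surjD)
    then show False using lorentz_nondegenerate[of p] \<open>p \<noteq> 0\<close> by blast
  qed
  then obtain v where v: "v \<noteq> 0" "N v = 0" using linear_injective_0[OF \<open>linear N\<close>] by blast
  then have Mv: "M v = - \<mu> *\<^sub>R v" by (simp add: N_def eq_neg_iff_add_eq_0)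
  have vv: "lorentz_form v v = 0"
    using skew[of v v] x(3) by (simp add: Mv)
  have vp: "lorentz_form v p \<noteq> 0"
  proof
    assume "lorentz_form v p = 0"
    then have "v = fst v *\<^sub>R p"
      using null_orthogonal[OF x(1), of v] vv by (simp add: p_def prod_eq_iff)
    then have "M v = \<mu> *\<^sub>R v" by (metis M.scale Mp scaleR_left_commute)
    then have "\<mu> *\<^sub>R v = - (\<mu> *\<^sub>R v)" using Mv by simp
    then have "(\<mu> + \<mu>) *\<^sub>R v = 0" by (simp only: eq_neg_iff_add_eq_0 scaleR_add_left)
    then show False using v(1) x(3) by simp
  qed
  \<comment> \<open>Normalized so that half the sum of \<open>p\<close> and \<open>w\<close> is a timelike unit vector.\<close>
  define w where "w = (- 2 / lorentz_form v p) *\<^sub>R v"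
  have w: "lorentz_form w w = 0" "lorentz_form w p = - 2" "M w = - \<mu> *\<^sub>R w"
    using vv vp by (simp_all add: w_def M.scale M.neg Mv)
  then have pw: "lorentz_form p w = - 2" by (simp only: lorentz.commute)
  \<comment> \<open>The sign makes the boost speed positive.\<close>
  define s where "s = sgn \<mu>"
  have s: "s * s = 1" "\<mu> = \<bar>\<mu>\<bar> * s" "s * \<mu> = \<bar>\<mu>\<bar>"
    using x(3) by (auto simp: s_def sgn_if)
  show thesis
  proof (rule that)
    let ?f = "(1/2) *\<^sub>R (p + w)" and ?u = "(s/2) *\<^sub>R (p - w)"
    show "\<bar>\<mu>\<bar> > 0" using x(3) by simp
    show "lorentz_form ?f ?f = -1" by (simp add: pp w pw)
    show "lorentz_form ?u ?u = 1" using s(1) by (simp add: pp w pw)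
    show "lorentz_form ?f ?u = 0" by (simp add: pp w pw)
    have "M ?f = (\<mu>/2) *\<^sub>R (p - w)" by (simp add: M.scale M.add Mp w algebra_simps)
    also have "\<dots> = \<bar>\<mu>\<bar> *\<^sub>R ?u" using s(2) by simp
    finally show "M ?f = \<bar>\<mu>\<bar> *\<^sub>R ?u" .
    have "M ?u = (s * \<mu>/2) *\<^sub>R (p + w)" by (simp add: M.scale M.diff Mp w algebra_simps)
    also have "\<dots> = \<bar>\<mu>\<bar> *\<^sub>R ?f" using s(3) by simp
    finally show "M ?u = \<bar>\<mu>\<bar> *\<^sub>R ?f" .
  qed
qed

text \<open>
  The hypotheses say that the null vector \<open>(1, e)\<close> is in the kernel.  On the orthogonal complement of
  \<open>e\<close> the generator induces a skew map \<open>N\<close> modulo \<open>(1, e)\<close>.  Splitting \<open>C\<close> orthogonally into a part in the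
  range of \<open>N\<close> and a part \<open>k\<close>, a null rotation removes the former, and \<open>N k = 0\<close>.  If \<open>k = 0\<close>, a timelike
  vector is in the kernel; otherwise there is a Jordan chain from \<open>q1\<close> over \<open>w\<close> to a multiple of
  \<open>(1, e)\<close>.
\<close>

lemma parabolic_space:
  fixes Q :: "'n::finite square_matrix"
  defines "M \<equiv> \<lambda>C. lorentz_gen Q C"
  assumes skew: "transpose Q = - Q" and e: "e \<bullet> e = 1" "Q *v e = - C" "e \<bullet> C = 0"
  shows "(\<exists>p. lorentz_form p p < 0 \<and> M C p = 0) \<or>
    (\<exists>f0 u1 u2 c. c > 0 \<and> lorentz_form f0 f0 = -1 \<and> lorentz_form u1 u1 = 1 \<and> lorentz_form f0 u1 = 0
      \<and> lorentz_form u2 u2 = 1 \<and> lorentz_form f0 u2 = 0 \<and> lorentz_form u1 u2 = 0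
      \<and> M C f0 = c *\<^sub>R u1 \<and> M C u1 = c *\<^sub>R (f0 + u2) \<and> M C u2 = - c *\<^sub>R u1)"
proof -
  let ?M = "lorentz_gen Q C"
  interpret M: linear ?M by (rule linear_lorentz_gen)
  define N where "N = (\<lambda>z. Q *v z - (z \<bullet> C) *\<^sub>R e)"
  define H where "H = {z. z \<bullet> e = 0}"
  have "linear N"
    unfolding N_def by (intro linearI)
      (auto simp: matrix_vector_right_distrib matrix_vector_mult_scaleR inner_add_left algebra_simps)
  have "subspace H" unfolding H_def subspace_def by (auto simp: inner_add_left)
  have NH: "N z \<in> H" if "z \<in> H" for z
  proof -
    have "(Q *v z) \<bullet> e = z \<bullet> C" using skew_matrix_inner[OF skew, of z e] e(2) by simp
    then show ?thesis by (simp add: H_def N_def inner_diff_left e(1))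
  qed
  have Nskew: "N z \<bullet> w = - (z \<bullet> N w)" if "z \<in> H" "w \<in> H" for z w
    using skew_matrix_inner[OF skew, of z w] that
    by (simp add: N_def H_def inner_diff_left inner_diff_right inner_commute[of e])
  have sub: "subspace (N ` H)" using \<open>linear N\<close> \<open>subspace H\<close> by (rule linear_subspace_image)
  obtain y k where y: "y \<in> span (N ` H)" and k: "\<And>w. w \<in> span (N ` H) \<Longrightarrow> orthogonal k w"
    and C: "C = y + k"
    using orthogonal_subspace_decomp_exists[of "N ` H" C] by metis
  obtain z0 where z0: "z0 \<in> H" "y = N z0" using y sub by (auto simp: span_eq_iff[THEN iffD2])
  have kN: "k \<bullet> N z = 0" if "z \<in> H" for z
    using k[of "N z"] that by (simp add: span_base orthogonal_def)
  have "C \<in> H" using e(3) by (simp add: H_def inner_commute)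
  then have "k \<in> H" using C NH[OF z0(1)] z0(2) \<open>subspace H\<close> by (metis add_diff_cancel_left' subspace_diff)
  have "N k = 0"
  proof -
    have "N k \<bullet> N k = - (k \<bullet> N (N k))" using Nskew \<open>k \<in> H\<close> NH by blast
    then show ?thesis using kN[OF NH[OF \<open>k \<in> H\<close>]] by simp
  qed
  then have Qk: "Q *v k = (k \<bullet> C) *\<^sub>R e" by (simp add: N_def)
  have kC: "k \<bullet> C = k \<bullet> k" using kN[OF z0(1)] by (simp add: C z0(2) inner_add_right)
  define p where "p = (1 :: real, e)"
  define q1 where "q1 = (1 :: real, - z0)"
  define s where "s = z0 \<bullet> C"
  define w where "w = (0 :: real, k) - s *\<^sub>R p"
  have Mp: "?M p = 0" using e by (simp add: p_def lorentz_gen_def zero_prod_def)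
  have Mq1: "?M q1 = w"
  proof -
    have "Q *v z0 = y + s *\<^sub>R e" by (simp add: z0(2) N_def s_def)
    then show ?thesis by (simp add: q1_def w_def p_def lorentz_gen_def C s_def vec.neg)
  qed
  have Mw: "?M w = (k \<bullet> k) *\<^sub>R p"
  proof -
    have "?M (0, k) = (k \<bullet> k) *\<^sub>R p" by (simp add: lorentz_gen_def Qk kC p_def)
    then show ?thesis by (simp add: w_def M.diff M.scale Mp)
  qed
  have pp: "lorentz_form p p = 0" by (simp add: p_def e(1))
  have q1p: "lorentz_form q1 p = -1" using z0(1) by (simp add: q1_def p_def H_def)
  have pq1: "lorentz_form p q1 = -1" using q1p by (simp only: lorentz.commute)
  have q1w: "lorentz_form q1 w = 0" unfolding Mq1[symmetric] by (rule lorentz_gen_orthogonal[OF skew])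
  have pk: "lorentz_form p (0, k) = 0" using \<open>k \<in> H\<close> by (simp add: p_def H_def inner_commute)
  have pw: "lorentz_form p w = 0" by (simp add: w_def pk pp)
  have ww: "lorentz_form w w = k \<bullet> k"
    using pk lorentz.commute[of "(0, k)" p] by (simp add: w_def pp)
  define b where "b = lorentz_form q1 q1"
  show ?thesis
  proof (cases "k = 0")
    case True
    have "s = 0" using q1w True by (simp add: w_def q1p zero_prod_def[symmetric])
    then have "w = 0" using True by (simp add: w_def zero_prod_def)
    have "?M (q1 + ((b + 1) / 2) *\<^sub>R p) = 0"
      by (simp add: M.add M.scale Mp Mq1 \<open>w = 0\<close>)
    moreover have "lorentz_form (q1 + ((b + 1) / 2) *\<^sub>R p) (q1 + ((b + 1) / 2) *\<^sub>R p) = -1"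
      by (simp add: b_def[symmetric] q1p pq1 pp field_simps)
    ultimately show ?thesis unfolding M_def
      by (intro disjI1 exI[of _ "q1 + ((b + 1) / 2) *\<^sub>R p"]) simp
  next
    case False
    \<comment> \<open>Adding a multiple of \<open>p\<close> makes the start of the chain null without changing its image.\<close>
    define q where "q = q1 + (b / 2) *\<^sub>R p"
    have q: "lorentz_form q q = 0" "lorentz_form q p = -1" "lorentz_form p q = -1"
      "lorentz_form q w = 0" "?M q = w"
      by (simp_all add: q_def b_def[symmetric] q1p pq1 pp q1w pw M.add M.scale Mp Mq1)
    have wq: "lorentz_form w q = 0" "lorentz_form w p = 0"
      using q(4) pw by (simp_all only: lorentz.commute)
    define c where "c = sqrt (k \<bullet> k)"
    have c: "c > 0" "c * c = k \<bullet> k" using False by (simp_all add: c_def)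
    define u1 where "u1 = (1 / c) *\<^sub>R w"
    define f0 where "f0 = (1/2) *\<^sub>R p + q"
    define u2 where "u2 = (1/2) *\<^sub>R p - q"
    have "f0 + u2 = p" unfolding f0_def u2_def by (simp flip: scaleR_add_left)
    have "c > 0" by (rule c)
    moreover have "lorentz_form f0 f0 = -1" "lorentz_form u2 u2 = 1" "lorentz_form f0 u2 = 0"
      by (simp_all add: f0_def u2_def pp q)
    moreover have "lorentz_form f0 u1 = 0" "lorentz_form u1 u2 = 0"
      by (simp_all add: f0_def u2_def u1_def pw q wq)
    moreover have "lorentz_form u1 u1 = 1"
      using c False by (simp add: u1_def ww field_simps)
    moreover have "?M f0 = c *\<^sub>R u1" "?M u2 = - c *\<^sub>R u1"
      using c(1) by (simp_all add: f0_def u2_def u1_def M.add M.diff M.scale Mp q(5))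
    moreover have "?M u1 = c *\<^sub>R (f0 + u2)"
      using c False by (simp add: \<open>f0 + u2 = p\<close> u1_def M.scale Mw divide_simps flip: c(2))
    ultimately show ?thesis unfolding M_def by blast
  qed
qed

fun nf_matrix :: "ktype \<Rightarrow> (nat \<Rightarrow> real) \<Rightarrow> 'n::{finite,linorder} square_matrix" where
  "nf_matrix Type_J a = Q_JT a"
| "nf_matrix Type_S a = Q_S a"
| "nf_matrix Type_T a = Q_JT a"

fun nf_vector :: "ktype \<Rightarrow> (nat \<Rightarrow> real) \<Rightarrow> 'n::{finite,linorder} point" where
  "nf_vector Type_J a = 0"
| "nf_vector Type_S a = first_coord (a 1)"
| "nf_vector Type_T a = first_coord (a 1)"

abbreviation nf_gen :: "ktype \<Rightarrow> (nat \<Rightarrow> real) \<Rightarrow> 'n::{finite,linorder} spacetime \<Rightarrow> 'n spacetime" where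
  "nf_gen t a \<equiv> lorentz_gen (nf_matrix t a) (nf_vector t a)"

lemma nf_k_eq: "nf_k t a = field_k (nf_matrix t a) (nf_vector t a)"
  by (cases t) simp_all

lemma nf_matrix_skew: "transpose (nf_matrix t a) = - nf_matrix t a"
  by (cases t) (simp_all only: nf_matrix.simps Q_JT_def Q_S_def transpose_J_blocks)

text \<open>
  The eigenvector from \<open>field_k_has_zero_in_cball\<close> is timelike (type J), null with nonzero eigenvalue
  (type S), or null in the kernel (type T or again J).  The bound on \<open>a 1\<close> in type S is not a matter of
  conjugacy but of admissibility, hence the case distinction in the conclusion.
\<close>

lemma exists_normal_form:
  fixes Q :: "'n::{finite,linorder} square_matrix"
  assumes skew: "transpose Q = - Q"
  obtains t a where "if t = Type_S then a \<in> rvec (m_k CARD('n)) \<and> a 1 > 0 \<and> chain 2 (m_k CARD('n)) a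
      else a \<in> params_k K CARD('n) t"
    "lorentz_conjugate (nf_gen t a) (lorentz_gen Q C)"
proof -
  let ?M = "lorentz_gen Q C"
  note normal_form = that
  note M = linear_lorentz_gen[of Q C] lorentz_gen_skew[OF skew, of C]
  have J: thesis if p: "lorentz_form p p < 0" "?M p = 0" for p
  proof -
    obtain a where "a \<in> params_k K CARD('n) Type_J"
      "lorentz_conjugate (lorentz_gen (Q_JT a :: 'n square_matrix) 0) ?M"
      by (rule normal_form_J[OF M p])
    then show thesis by (intro normal_form[of Type_J a]) simp_all
  qed
  obtain x where x: "x \<in> cball 0 1" "Q *v x + C = (x \<bullet> C) *\<^sub>R x"
    by (rule field_k_has_zero_in_cball[OF skew, of C])
  then have Mx: "?M (1, x) = (x \<bullet> C) *\<^sub>R (1, x)"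
    by (simp add: lorentz_gen_def add.commute)
  show thesis
  proof (cases "x \<bullet> x = 1")
    case False
    have "x \<bullet> x \<le> 1" using x(1) by (simp add: norm_eq_sqrt_inner)
    then have "lorentz_form (1, x) (1, x) < 0" using False by simp
    moreover have "lorentz_form (1, x) (?M (1, x)) = 0" by (rule lorentz_gen_orthogonal[OF skew])
    then have "(x \<bullet> C) * lorentz_form (1, x) (1, x) = 0" unfolding Mx by simp
    ultimately have "x \<bullet> C = 0" by simp
    then have "?M (1, x) = 0" unfolding Mx by (simp add: zero_prod_def)
    with \<open>lorentz_form (1, x) (1, x) < 0\<close> show thesis by (rule J)
  next
    case True
    show thesis
    proof (cases "x \<bullet> C = 0")
      case False
      obtain f0 u1 c where c: "c > 0" and f: "lorentz_form f0 f0 = -1" "lorentz_form u1 u1 = 1"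
        "lorentz_form f0 u1 = 0" "?M f0 = c *\<^sub>R u1" "?M u1 = c *\<^sub>R f0"
        by (rule hyperbolic_plane[OF M True Mx False])
      obtain a where "a \<in> rvec (m_k CARD('n))" "a 1 = c" "chain 2 (m_k CARD('n)) a"
        "lorentz_conjugate (lorentz_gen (Q_S a :: 'n square_matrix) (first_coord (a 1))) ?M"
        by (rule normal_form_S[OF M f])
      then show thesis using c by (intro normal_form[of Type_S a]) simp_all
    next
      case x0: True
      have "Q *v x = - C" using x(2) x0 by (simp add: eq_neg_iff_add_eq_0)
      from parabolic_space[OF skew True this x0] show thesis
      proof (elim disjE exE conjE)
        fix p assume "lorentz_form p p < 0" "?M p = 0"
        then show thesis by (rule J)
      next
        fix f0 u1 u2 and c :: real
        assume c: "c > 0" and f: "lorentz_form f0 f0 = -1" "lorentz_form u1 u1 = 1" "lorentz_form f0 u1 = 0"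
          "lorentz_form u2 u2 = 1" "lorentz_form f0 u2 = 0" "lorentz_form u1 u2 = 0"
          "?M f0 = c *\<^sub>R u1" "?M u1 = c *\<^sub>R (f0 + u2)" "?M u2 = - c *\<^sub>R u1"
        obtain a where "a \<in> params_k K CARD('n) Type_T"
          "lorentz_conjugate (lorentz_gen (Q_JT a :: 'n square_matrix) (first_coord (a 1))) ?M"
          by (rule normal_form_T[OF M f c])
        then show thesis by (intro normal_form[of Type_T a]) simp_all
      qed
    qed
  qed
qed

section \<open>Invariants of the normal forms\<close>

lemma J_blocks_square_nth:
  fixes Q :: "'n::{finite,linorder} square_matrix"
  assumes "disjoint_blocks R p CARD('n)" "Q = - J_blocks R p a"
  shows "(Q *v (Q *v x)) $ j = block_square R p a (idx j) * x $ j"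
proof -
  have "linear (\<lambda>x. Q *v (Q *v x))"
    using linear_compose[OF matrix_vector_mul_linear matrix_vector_mul_linear, of Q Q]
    by (simp add: o_def)
  then show ?thesis using J_blocks_square[OF assms] by (rule linear_diagonal)
qed

lemma unit_vec_inner:
  "unit_vec k \<bullet> (x :: 'n::{finite,linorder} point) = x $ coord k"
  by (simp add: unit_vec_def inner_axis')

lemma unit_vec_orthonormal:
  assumes "j \<in> {1..CARD('n::{finite,linorder})}" "k \<in> {1..CARD('n)}"
  shows "(unit_vec j :: 'n point) \<bullet> unit_vec k = (if j = k then 1 else 0)"
proof -
  have "(coord j :: 'n) = coord k \<longleftrightarrow> j = k"
    using idx_coord[OF assms(1)] idx_coord[OF assms(2)] by metis
  then show ?thesis by (simp add: unit_vec_inner) (simp add: unit_vec_def axis_def)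
qed

lemma first_coord_eq: "(first_coord c :: 'n::{finite,linorder} point) = c *\<^sub>R unit_vec 1"
proof -
  have "1 \<in> {1..CARD('n)}" by (simp add: Suc_leI)
  note 1 = eq_coord_iff[OF this]
  have "(if idx i = 1 then c else 0) = c * (if i = coord 1 then 1 else 0)" for i :: 'n
    unfolding 1 by simp
  then show ?thesis
    by (simp add: vec_eq_iff first_coord_def unit_vec_def axis_def)
qed

text \<open>
  The squares of the generators in normal form are diagonal, apart from the nilpotent part in type T;
  the dimensions of their eigenspaces are the invariants that separate the normal forms.
\<close>

definition square_eigenspace :: "('n::finite spacetime \<Rightarrow> 'n spacetime) \<Rightarrow> real \<Rightarrow> ('n spacetime) set" where
  "square_eigenspace M c = {p. M (M p) = c *\<^sub>R p}"

lemma dim_square_eigenspace_conjugate: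
  assumes "lorentz_conjugate M M'"
  shows "dim (square_eigenspace M c) = dim (square_eigenspace M' c)"
proof -
  obtain L where L: "L \<in> lorentz_group" "\<And>p. L (M p) = M' (L p)"
    using assms by (auto simp: lorentz_conjugate_def)
  obtain L' where L': "L' \<in> lorentz_group" "\<And>p. L' (L p) = p" "\<And>p. L (L' p) = p"
    using lorentz_group_inverse[OF L(1)] by metis
  have lin: "linear L" by (rule lorentz_group_linear[OF L(1)])
  have inj: "inj L" by (rule inj_on_inverseI[of _ L']) (rule L'(2))
  have iff: "L p \<in> square_eigenspace M' c \<longleftrightarrow> p \<in> square_eigenspace M c" for p
  proof -
    have "M' (M' (L p)) = L (M (M p))" by (simp only: L(2))
    moreover have "c *\<^sub>R L p = L (c *\<^sub>R p)" by (simp only: linear_scale[OF lin])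
    ultimately show ?thesis by (simp add: square_eigenspace_def inj_eq[OF inj])
  qed
  have "square_eigenspace M' c = L ` square_eigenspace M c"
  proof (intro equalityI subsetI)
    fix q assume "q \<in> square_eigenspace M' c"
    then show "q \<in> L ` square_eigenspace M c"
      using iff[of "L' q"] L'(3)[of q] by (intro image_eqI[of _ _ "L' q"]) simp_all
  qed (use iff in blast)
  then show ?thesis
    using dim_image_eq[OF lin, of "square_eigenspace M c"] inj by (simp add: inj_on_subset)
qed

lemma skew_square_eigenvector:
  fixes Q :: "'n::finite square_matrix"
  assumes "transpose Q = - Q" "Q *v (Q *v x) = c *\<^sub>R x" "c > 0"
  shows "x = 0"
proof -
  have "c * (x \<bullet> x) = x \<bullet> (Q *v (Q *v x))" by (simp add: assms(2))
  also have "\<dots> = - ((Q *v x) \<bullet> (Q *v x))"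
    using skew_matrix_inner[OF assms(1), of x "Q *v x"] by simp
  also have "\<dots> \<le> 0" by simp
  finally have "x \<bullet> x \<le> 0" using assms(3) by (simp add: mult_le_0_iff)
  then show ?thesis using inner_ge_zero[of x] inner_eq_zero_iff[of x] by linarith
qed

text \<open>
  The part of a normal form that consists of genuine rotations.
\<close>

definition tail_matrix :: "ktype \<Rightarrow> (nat \<Rightarrow> real) \<Rightarrow> 'n::{finite,linorder} square_matrix" where
  "tail_matrix t a =
     (case t of Type_J \<Rightarrow> Q_JT a | Type_S \<Rightarrow> Q_S a
      | Type_T \<Rightarrow> - J_blocks {2..CARD('n) div 2} (\<lambda>r. 2 * r - 1) a)"

lemma tail_matrix_skew: "transpose (tail_matrix t a) = - tail_matrix t a"
  by (cases t) (simp_all only: tail_matrix_def ktype.case Q_JT_def Q_S_def transpose_J_blocks)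

lemma disjoint_blocks_tail: "disjoint_blocks {2..n div 2} (\<lambda>r. 2 * r - 1) n"
  using disjoint_blocks_JT[of n] unfolding disjoint_blocks_def by auto

text \<open>
  Dropping the first block moves its two coordinates to the eigenvalue 0.
\<close>

lemma tail_matrix_T_iff:
  fixes x :: "'n::{finite,linorder} point"
  assumes "c \<noteq> 0" "CARD('n) \<ge> 2"
  shows "tail_matrix Type_T a *v (tail_matrix Type_T a *v x) = c *\<^sub>R x \<longleftrightarrow>
    Q_JT a *v (Q_JT a *v x) = c *\<^sub>R x \<and> unit_vec 1 \<bullet> x = 0 \<and> unit_vec 2 \<bullet> x = 0"
proof -
  let ?p = "\<lambda>r. 2 * r - 1 :: nat"
  let ?b = "block_square {1..CARD('n) div 2} ?p a" and ?b' = "block_square {2..CARD('n) div 2} ?p a"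
  have Q: "Q_JT a *v (Q_JT a *v x) = c *\<^sub>R x \<longleftrightarrow> (\<forall>j. ?b (idx j) * x $ j = c * x $ j)"
    using J_blocks_square_nth[OF disjoint_blocks_JT Q_JT_eq, of a x] by (simp add: vec_eq_iff)
  have T: "tail_matrix Type_T a *v (tail_matrix Type_T a *v x) = c *\<^sub>R x \<longleftrightarrow>
      (\<forall>j. ?b' (idx j) * x $ j = c * x $ j)"
    using J_blocks_square_nth[OF disjoint_blocks_tail refl, of a x] by (simp add: vec_eq_iff tail_matrix_def)
  have b12: "?b' k = 0" if "k = 1 \<or> k = 2" for k
    using that by (intro block_square_eq_0) auto
  have b: "?b' k = ?b k" if "k \<noteq> 1" "k \<noteq> 2" for k
  proof -
    have "{1..CARD('n) div 2} = insert 1 {2..CARD('n) div 2}" using assms(2) by auto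
    then show ?thesis using that by (simp add: block_square_def)
  qed
  have 12: "1 \<in> {1..CARD('n)}" "2 \<in> {1..CARD('n)}" using assms(2) by auto
  note idx = idx_coord[OF 12(1)] idx_coord[OF 12(2)]
  have u: "unit_vec 1 \<bullet> x = 0 \<and> unit_vec 2 \<bullet> x = 0 \<longleftrightarrow> (\<forall>j. idx j = 1 \<or> idx j = 2 \<longrightarrow> x $ j = 0)"
    unfolding unit_vec_inner eq_coord_iff[OF 12(1)] eq_coord_iff[OF 12(2)] by blast
  show ?thesis
    unfolding Q T u
  proof (intro iffI conjI allI impI)
    fix j
    assume eq: "\<forall>j. ?b' (idx j) * x $ j = c * x $ j"
    show x0: "x $ j = 0" if "idx j = 1 \<or> idx j = 2" for j
      using eq[rule_format, of j] b12[OF that] assms(1) by simp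
    show "?b (idx j) * x $ j = c * x $ j"
      using eq[rule_format, of j] b[of "idx j"] x0[of j] by (cases "idx j = 1 \<or> idx j = 2") auto
  next
    fix j
    assume "(\<forall>j. ?b (idx j) * x $ j = c * x $ j) \<and> (\<forall>j. idx j = 1 \<or> idx j = 2 \<longrightarrow> x $ j = 0)"
    then show "?b' (idx j) * x $ j = c * x $ j"
      using b[of "idx j"] by (cases "idx j = 1 \<or> idx j = 2") auto
  qed
qed

lemma Q_JT_unit_vec:
  assumes "CARD('n::{finite,linorder}) \<ge> 2"
  shows "Q_JT a *v (unit_vec 1 :: 'n point) = a 1 *\<^sub>R unit_vec 2"
    "Q_JT a *v (unit_vec 2 :: 'n point) = - a 1 *\<^sub>R unit_vec 1"
proof -
  have 1: "1 \<in> {1..CARD('n) div 2}" using assms by auto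
  have Q: "(Q_JT a :: 'n square_matrix) = - J_blocks {1..CARD('n) div 2} (\<lambda>r. 2 * r - 1) a"
    by (rule Q_JT_eq)
  have p: "2 * 1 - 1 = (1 :: nat)" "1 + 1 = (2 :: nat)" by simp_all
  show "Q_JT a *v (unit_vec 1 :: 'n point) = a 1 *\<^sub>R unit_vec 2"
    "Q_JT a *v (unit_vec 2 :: 'n point) = - a 1 *\<^sub>R unit_vec 1"
    using J_blocks_unit_vec(1,2)[OF disjoint_blocks_JT Q 1] unfolding p .
qed

lemma Q_S_unit_vec: "Q_S a *v (unit_vec 1 :: 'n::{finite,linorder} point) = 0"
proof (rule J_blocks_unit_vec(3)[OF disjoint_blocks_S Q_S_def])
  show "1 \<in> {1..CARD('n)}" by (simp add: Suc_leI)
  show "1 \<noteq> 2 * r - 2 \<and> 1 \<noteq> 2 * r - 2 + 1" if "r \<in> {2..m_k CARD('n)}" for r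
    using that by (auto; presburger)
qed

lemma nf_square_J: "nf_gen Type_J a (nf_gen Type_J a (t, x)) = (0, Q_JT a *v (Q_JT a *v x))"
  by (simp add: lorentz_gen_def)

lemma skew_matrix_square_inner:
  fixes Q :: "'n::finite square_matrix"
  assumes "transpose Q = - Q"
  shows "(Q *v (Q *v x)) \<bullet> y = x \<bullet> (Q *v (Q *v y))"
  using skew_matrix_inner[OF assms, of "Q *v x" y] skew_matrix_inner[OF assms, of x "Q *v y"] by simp

lemma nf_square_S:
  fixes x :: "'n::{finite,linorder} point"
  shows "nf_gen Type_S a (nf_gen Type_S a (t, x)) =
    ((a 1)\<^sup>2 * t, ((a 1)\<^sup>2 * (unit_vec 1 \<bullet> x)) *\<^sub>R unit_vec 1 + Q_S a *v (Q_S a *v x))"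
proof -
  let ?e = "unit_vec 1 :: 'n point"
  have skew: "transpose (Q_S a) = - (Q_S a :: 'n square_matrix)"
    using nf_matrix_skew[of Type_S a] by simp
  have "(Q_S a *v x) \<bullet> ?e = 0"
    using skew_matrix_inner[OF skew, of x ?e] by (simp add: Q_S_unit_vec del: One_nat_def)
  moreover have "?e \<bullet> ?e = 1" using unit_vec_orthonormal[of 1 1, where 'n = 'n] by (simp add: Suc_leI)
  ultimately show ?thesis
    by (simp add: lorentz_gen_def first_coord_eq inner_add_left inner_commute[of x] power2_eq_square
        matrix_vector_right_distrib matrix_vector_mult_scaleR Q_S_unit_vec algebra_simps del: One_nat_def)
qed

lemma nf_square_T:
  fixes x :: "'n::{finite,linorder} point"
  assumes "CARD('n) \<ge> 2"
  shows "nf_gen Type_T a (nf_gen Type_T a (t, x)) =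
    ((a 1)\<^sup>2 * (t - unit_vec 2 \<bullet> x),
     ((a 1)\<^sup>2 * (unit_vec 1 \<bullet> x)) *\<^sub>R unit_vec 1 + ((a 1)\<^sup>2 * t) *\<^sub>R unit_vec 2
       + Q_JT a *v (Q_JT a *v x))"
proof -
  let ?e = "unit_vec 1 :: 'n point"
  have skew: "transpose (Q_JT a) = - (Q_JT a :: 'n square_matrix)"
    using nf_matrix_skew[of Type_J a] by simp
  have "(Q_JT a *v x) \<bullet> ?e = - a 1 * (unit_vec 2 \<bullet> x)"
    using skew_matrix_inner[OF skew, of x ?e]
    by (simp add: Q_JT_unit_vec[OF assms] inner_commute[of x] del: One_nat_def)
  moreover have "?e \<bullet> ?e = 1" using unit_vec_orthonormal[of 1 1, where 'n = 'n] by (simp add: Suc_leI)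
  ultimately show ?thesis
    by (simp add: lorentz_gen_def first_coord_eq inner_add_left inner_commute[of x] power2_eq_square
        matrix_vector_right_distrib matrix_vector_mult_scaleR Q_JT_unit_vec[OF assms] algebra_simps del: One_nat_def)
qed

text \<open>
  Away from the eigenvalues contributed by the first vectors of the frame (0, and \<open>(a 1)\<^sup>2\<close> in type S), only
  the rotations contribute.
\<close>

lemma square_eigenspace_normal_form:
  fixes M :: "'n::{finite,linorder} spacetime \<Rightarrow> 'n spacetime"
  assumes "CARD('n) \<ge> 2" "c \<noteq> 0" "t = Type_S \<Longrightarrow> c \<noteq> (a 1)\<^sup>2" and M: "M = nf_gen t a"
  shows "square_eigenspace M c =
    Pair 0 ` {x. tail_matrix t a *v (tail_matrix t a *v x) = c *\<^sub>R x}"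
proof -
  have "(\<tau>, x) \<in> square_eigenspace M c \<longleftrightarrow> \<tau> = 0 \<and> tail_matrix t a *v (tail_matrix t a *v x) = c *\<^sub>R x"
    for \<tau> x
  proof (cases t)
    case Type_J
    then show ?thesis
      using assms(2) by (auto simp: M square_eigenspace_def nf_square_J tail_matrix_def simp del: nf_matrix.simps nf_vector.simps)
  next
    case Type_S
    let ?e = "unit_vec 1 :: 'n point" and ?Q = "Q_S a :: 'n square_matrix"
    have ee: "?e \<bullet> ?e = 1" using unit_vec_orthonormal[of 1 1, where 'n = 'n] by (simp add: Suc_leI)
    have skew: "transpose ?Q = - ?Q" using nf_matrix_skew[of Type_S a] by simp
    have Qe: "?e \<bullet> (?Q *v (?Q *v x)) = 0"
      using skew_matrix_square_inner[OF skew, of ?e x] by (simp add: Q_S_unit_vec del: One_nat_def)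
    have iff: "(\<tau>, x) \<in> square_eigenspace M c \<longleftrightarrow> (a 1)\<^sup>2 * \<tau> = c * \<tau> \<and>
        ((a 1)\<^sup>2 * (?e \<bullet> x)) *\<^sub>R ?e + ?Q *v (?Q *v x) = c *\<^sub>R x"
      unfolding square_eigenspace_def M Type_S mem_Collect_eq nf_square_S by simp
    show ?thesis
      unfolding iff tail_matrix_def Type_S ktype.case
    proof (intro iffI conjI; elim conjE)
      assume \<tau>: "(a 1)\<^sup>2 * \<tau> = c * \<tau>" and x: "((a 1)\<^sup>2 * (?e \<bullet> x)) *\<^sub>R ?e + ?Q *v (?Q *v x) = c *\<^sub>R x"
      show "\<tau> = 0" using \<tau> assms(3) Type_S by simp
      have "?e \<bullet> (((a 1)\<^sup>2 * (?e \<bullet> x)) *\<^sub>R ?e + ?Q *v (?Q *v x)) = c * (?e \<bullet> x)"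
        unfolding x by simp
      then have "?e \<bullet> x = 0" using assms(3) Type_S by (simp add: inner_add_right ee Qe del: One_nat_def)
      then show "?Q *v (?Q *v x) = c *\<^sub>R x" using x by simp
    next
      assume \<tau>: "\<tau> = 0" and x: "?Q *v (?Q *v x) = c *\<^sub>R x"
      show "(a 1)\<^sup>2 * \<tau> = c * \<tau>" using \<tau> by simp
      have "c * (?e \<bullet> x) = 0" using Qe unfolding x by simp
      then show "((a 1)\<^sup>2 * (?e \<bullet> x)) *\<^sub>R ?e + ?Q *v (?Q *v x) = c *\<^sub>R x" using x assms(2) by simp
    qed
  next
    case Type_T
    let ?e = "unit_vec 1 :: 'n point" and ?f = "unit_vec 2 :: 'n point" and ?Q = "Q_JT a :: 'n square_matrix"
    have 12: "1 \<in> {1..CARD('n)}" "2 \<in> {1..CARD('n)}" using assms(1) by auto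
    have e: "?e \<bullet> ?e = 1" "?f \<bullet> ?f = 1" "?e \<bullet> ?f = 0" "?f \<bullet> ?e = 0"
      using unit_vec_orthonormal[OF 12(1,1)] unit_vec_orthonormal[OF 12(2,2)]
        unit_vec_orthonormal[OF 12] unit_vec_orthonormal[OF 12(2,1)] by simp_all
    have skew: "transpose ?Q = - ?Q" using nf_matrix_skew[of Type_J a] by simp
    have Qe: "?e \<bullet> (?Q *v (?Q *v x)) = - (a 1)\<^sup>2 * (?e \<bullet> x)" "?f \<bullet> (?Q *v (?Q *v x)) = - (a 1)\<^sup>2 * (?f \<bullet> x)"
      using skew_matrix_square_inner[OF skew, of ?e x] skew_matrix_square_inner[OF skew, of ?f x]
      by (simp_all add: Q_JT_unit_vec[OF assms(1)] matrix_vector_mult_scaleR vec.neg power2_eq_square del: One_nat_def)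
    have iff: "(\<tau>, x) \<in> square_eigenspace M c \<longleftrightarrow> (a 1)\<^sup>2 * (\<tau> - ?f \<bullet> x) = c * \<tau> \<and>
        ((a 1)\<^sup>2 * (?e \<bullet> x)) *\<^sub>R ?e + ((a 1)\<^sup>2 * \<tau>) *\<^sub>R ?f + ?Q *v (?Q *v x) = c *\<^sub>R x"
      unfolding square_eigenspace_def M Type_T mem_Collect_eq nf_square_T[OF assms(1)] by simp
    show ?thesis
      unfolding iff Type_T tail_matrix_T_iff[OF assms(2,1)]
    proof (intro iffI; elim conjE)
      assume \<tau>: "(a 1)\<^sup>2 * (\<tau> - ?f \<bullet> x) = c * \<tau>"
        and x: "((a 1)\<^sup>2 * (?e \<bullet> x)) *\<^sub>R ?e + ((a 1)\<^sup>2 * \<tau>) *\<^sub>R ?f + ?Q *v (?Q *v x) = c *\<^sub>R x"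
      have "v \<bullet> (((a 1)\<^sup>2 * (?e \<bullet> x)) *\<^sub>R ?e + ((a 1)\<^sup>2 * \<tau>) *\<^sub>R ?f + ?Q *v (?Q *v x)) = c * (v \<bullet> x)" for v
        unfolding x by simp
      from this[of ?e] this[of ?f] have ex: "c * (?e \<bullet> x) = 0" and "(a 1)\<^sup>2 * (\<tau> - ?f \<bullet> x) = c * (?f \<bullet> x)"
        by (simp_all add: inner_add_right e Qe algebra_simps del: One_nat_def)
      then have "?f \<bullet> x = \<tau>" using \<tau> assms(2) by simp
      then have "\<tau> = 0" using \<tau> assms(2) by simp
      then show "\<tau> = 0 \<and> ?Q *v (?Q *v x) = c *\<^sub>R x \<and> ?e \<bullet> x = 0 \<and> ?f \<bullet> x = 0"
        using ex x \<open>?f \<bullet> x = \<tau>\<close> assms(2) by simp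
    qed simp
  qed
  then show ?thesis by auto
qed

lemma first_coordinate_eigenvector:
  fixes M :: "'n::{finite,linorder} spacetime \<Rightarrow> 'n spacetime"
  assumes "M = nf_gen Type_S a"
  shows "(1, 0) \<in> square_eigenspace M ((a 1)\<^sup>2)"
  unfolding square_eigenspace_def assms mem_Collect_eq nf_square_S by simp

text \<open>
  A positive eigenvalue of the square is the mark of a boost.
\<close>

lemma dim_square_eigenspace_pos:
  fixes a :: "nat \<Rightarrow> real"
  assumes "CARD('n::{finite,linorder}) \<ge> 2" "c > 0"
  shows "dim (square_eigenspace (nf_gen t a :: 'n spacetime \<Rightarrow> _) c) \<noteq> 0 \<longleftrightarrow> t = Type_S \<and> c = (a 1)\<^sup>2"
proof (cases "t = Type_S \<and> c = (a 1)\<^sup>2")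
  case True
  then have "(1, 0) \<in> square_eigenspace (nf_gen t a :: 'n spacetime \<Rightarrow> _) c"
    using first_coordinate_eigenvector[OF refl] by blast
  then have "\<not> square_eigenspace (nf_gen t a :: 'n spacetime \<Rightarrow> _) c \<subseteq> {0}"
    by (auto simp: zero_prod_def)
  then show ?thesis using True by (simp add: dim_eq_0)
next
  case False
  have "square_eigenspace (nf_gen t a :: 'n spacetime \<Rightarrow> _) c =
      Pair 0 ` {x. tail_matrix t a *v (tail_matrix t a *v x) = c *\<^sub>R x}"
    using assms False by (intro square_eigenspace_normal_form) auto
  also have "\<dots> \<subseteq> {0}"
    using skew_square_eigenvector[OF tail_matrix_skew _ assms(2)] by (auto simp: zero_prod_def)
  finally show ?thesis using False by (simp add: dim_eq_0)
qed

text \<open>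
  The number of the first parameter that is the speed of a rotation plane.
\<close>

definition first_rotation :: "ktype \<Rightarrow> nat" where
  "first_rotation t = (if t = Type_J then 1 else 2)"

lemma dim_square_eigenspace_neg:
  fixes a :: "nat \<Rightarrow> real"
  assumes "CARD('n::{finite,linorder}) \<ge> 2" "c < 0" and a: "a \<in> params_k K CARD('n) t"
  shows "dim (square_eigenspace (nf_gen t a :: 'n spacetime \<Rightarrow> _) c) =
    2 * card {r \<in> {first_rotation t..m_k CARD('n)}. (a r)\<^sup>2 = - c}"
proof -
  let ?T = "tail_matrix t a :: 'n square_matrix" and ?n = "CARD('n)"
  have "linear (Pair 0 :: 'n point \<Rightarrow> 'n spacetime)" by (intro linearI) auto
  moreover have "square_eigenspace (nf_gen t a :: 'n spacetime \<Rightarrow> _) c =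
      Pair 0 ` {x. ?T *v (?T *v x) = c *\<^sub>R x}"
  proof (rule square_eigenspace_normal_form[OF assms(1) _ _ refl])
    show "c \<noteq> (a 1)\<^sup>2" using assms(2) zero_le_power2[of "a 1"] by linarith
  qed (use assms(2) in simp)
  ultimately have dim: "dim (square_eigenspace (nf_gen t a :: 'n spacetime \<Rightarrow> _) c) =
      dim {x. ?T *v (?T *v x) = c *\<^sub>R x}"
    by (simp add: dim_image_eq inj_on_def)
  \<comment> \<open>In types J and T with \<open>n\<close> odd the last parameter has no block, but it is 0.\<close>
  have drop_last: "{r \<in> {l..?n div 2}. (a r)\<^sup>2 = - c} = {r \<in> {l..m_k ?n}. (a r)\<^sup>2 = - c}"
    if "odd ?n \<Longrightarrow> a (m_k ?n) = 0" for l
  proof -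
    have "r \<le> ?n div 2" if "r \<le> m_k ?n" "(a r)\<^sup>2 = - c" for r
    proof (cases "even ?n")
      case True
      then show ?thesis using that by (auto simp: m_k_eq elim!: evenE)
    next
      case False
      then have "r \<noteq> m_k ?n" using \<open>odd ?n \<Longrightarrow> a (m_k ?n) = 0\<close> that(2) assms(2) by auto
      then show ?thesis using that(1) False by (auto simp: m_k_eq elim!: oddE)
    qed
    moreover have "r \<le> m_k ?n" if "r \<le> ?n div 2" for r using that by (simp add: m_k_eq)
    ultimately show ?thesis by auto
  qed
  show ?thesis
  proof (cases t)
    case Type_J
    have "?T = - J_blocks {1..?n div 2} (\<lambda>r. 2 * r - 1) a"
      unfolding tail_matrix_def Type_J ktype.case by (rule Q_JT_eq)
    note dim_eigenspace_J_blocks[OF disjoint_blocks_JT this assms(2)]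
    then show ?thesis
      unfolding dim using drop_last a Type_J by (simp add: first_rotation_def)
  next
    case Type_S
    have "?T = - J_blocks {2..m_k ?n} (\<lambda>r. 2 * r - 2) a"
      unfolding tail_matrix_def Type_S ktype.case by (rule Q_S_def)
    note dim_eigenspace_J_blocks[OF disjoint_blocks_S this assms(2)]
    then show ?thesis
      unfolding dim using Type_S by (simp add: first_rotation_def)
  next
    case Type_T
    have "?T = - J_blocks {2..?n div 2} (\<lambda>r. 2 * r - 1) a"
      unfolding tail_matrix_def Type_T ktype.case ..
    note dim_eigenspace_J_blocks[OF disjoint_blocks_tail this assms(2)]
    then show ?thesis
      unfolding dim using drop_last a Type_T by (simp add: first_rotation_def)
  qed
qed

text \<open>
  In types S and T the first component of the squared generator, which must vanish, confines the kernel
  to spacelike and null vectors.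
\<close>

lemma timelike_kernel_iff:
  fixes a :: "nat \<Rightarrow> real"
  assumes "CARD('n::{finite,linorder}) \<ge> 2" and a: "a \<in> params_k K CARD('n) t"
  shows "(\<exists>p. lorentz_form p p < 0 \<and> nf_gen t a (p :: 'n spacetime) = 0) \<longleftrightarrow> t = Type_J"
proof
  assume "t = Type_J"
  then show "\<exists>p. lorentz_form p p < 0 \<and> nf_gen t a (p :: 'n spacetime) = 0"
    by (intro exI[of _ "(1, 0)"]) (simp add: lorentz_gen_def zero_prod_def)
next
  assume "\<exists>p. lorentz_form p p < 0 \<and> nf_gen t a (p :: 'n spacetime) = 0"
  then obtain \<tau> and x :: "'n point" where x: "x \<bullet> x < \<tau> * \<tau>" "nf_gen t a (\<tau>, x) = 0" by auto
  show "t = Type_J"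
  proof (rule ccontr)
    assume "t \<noteq> Type_J"
    then have a1: "a 1 > 0" using a by (cases t) auto
    have sq: "nf_gen t a (nf_gen t a (\<tau>, x)) = 0"
      unfolding x(2) by (simp add: lorentz_gen_def zero_prod_def)
    have "\<tau> \<noteq> 0"
    proof
      assume "\<tau> = 0"
      then have "x \<bullet> x < 0" using x(1) by simp
      then show False using inner_ge_zero[of x] by linarith
    qed
    show False
    proof (cases t)
      case Type_S
      have "(a 1)\<^sup>2 * \<tau> = 0" using sq unfolding Type_S nf_square_S by (simp add: zero_prod_def)
      then show False using a1 \<open>\<tau> \<noteq> 0\<close> by simp
    next
      case Type_T
      have "(a 1)\<^sup>2 * (\<tau> - unit_vec 2 \<bullet> x) = 0"
        using sq unfolding Type_T nf_square_T[OF assms(1)] by (simp add: zero_prod_def)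
      then have "\<tau> = unit_vec 2 \<bullet> x" using a1 by simp
      moreover have "(unit_vec 2 \<bullet> x)\<^sup>2 \<le> ((unit_vec 2 :: 'n point) \<bullet> unit_vec 2) * (x \<bullet> x)"
        by (rule Cauchy_Schwarz_ineq)
      moreover have "(unit_vec 2 :: 'n point) \<bullet> unit_vec 2 = 1"
        using unit_vec_orthonormal[of 2 2, where 'n = 'n] assms(1) by simp
      ultimately show False using x(1) by (simp add: power2_eq_square)
    qed (use \<open>t \<noteq> Type_J\<close> in simp)
  qed
qed

lemma timelike_kernel_conjugate:
  assumes "lorentz_conjugate M M'" "\<exists>p. lorentz_form p p < 0 \<and> M p = 0"
  shows "\<exists>p. lorentz_form p p < 0 \<and> M' p = 0"
proof -
  obtain L where L: "L \<in> lorentz_group" "\<And>p. L (M p) = M' (L p)"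
    using assms(1) by (auto simp: lorentz_conjugate_def)
  obtain p where p: "lorentz_form p p < 0" "M p = 0" using assms(2) by blast
  have "M' (L p) = 0"
    unfolding L(2)[symmetric] p(2) by (rule linear_0[OF lorentz_group_linear[OF L(1)]])
  then show ?thesis using p(1) lorentz_group_form[OF L(1), of p p] by (intro exI[of _ "L p"]) simp
qed

text \<open>
  A timelike kernel vector singles out type J, a positive eigenvalue of the square type S, and its value
  gives \<open>a 1\<close>.  The negative eigenvalues count the rotation speeds.
\<close>

lemma normal_form_determined:
  fixes a a' :: "nat \<Rightarrow> real"
  assumes n: "CARD('n::{finite,linorder}) \<ge> 2"
    and a: "a \<in> params_k K CARD('n) t" and a': "a' \<in> params_k K CARD('n) t'"
    and conj: "lorentz_conjugate (nf_gen t a :: 'n spacetime \<Rightarrow> _) (nf_gen t' a')"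
  shows "t = t' \<and> (\<forall>i\<in>{1..m_k CARD('n)}. a i = a' i \<or> (t = Type_T \<and> i = 1))"
proof -
  have J: "t = Type_J \<longleftrightarrow> t' = Type_J"
    using timelike_kernel_conjugate[OF conj] timelike_kernel_conjugate[OF lorentz_conjugate_sym[OF conj]]
      timelike_kernel_iff[OF n a] timelike_kernel_iff[OF n a'] by blast
  have S: "t = Type_S \<and> c = (a 1)\<^sup>2 \<longleftrightarrow> t' = Type_S \<and> c = (a' 1)\<^sup>2" if "c > 0" for c
    using dim_square_eigenspace_pos[OF n that, of t a] dim_square_eigenspace_pos[OF n that, of t' a']
      dim_square_eigenspace_conjugate[OF conj, of c] by simp
  have pos: "a 1 > 0" if "t = Type_S" using a that by simp
  have pos': "a' 1 > 0" if "t' = Type_S" using a' that by simp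
  have "t = Type_S \<longleftrightarrow> t' = Type_S"
    using S[of "(a 1)\<^sup>2"] S[of "(a' 1)\<^sup>2"] pos pos' by fastforce
  with J have t: "t = t'" by (cases t; cases t') auto
  have S1: "a 1 = a' 1" if "t = Type_S"
  proof -
    have "(a 1)\<^sup>2 = (a' 1)\<^sup>2" using S[of "(a 1)\<^sup>2"] that t pos by simp
    then show ?thesis using pos pos' that t by (simp add: power2_eq_iff_nonneg)
  qed
  let ?l = "first_rotation t"
  have "card {r \<in> {?l..m_k CARD('n)}. (a r)\<^sup>2 = c} = card {r \<in> {?l..m_k CARD('n)}. (a' r)\<^sup>2 = c}"
    if "c > 0" for c
    using dim_square_eigenspace_neg[OF n _ a, of "- c"] dim_square_eigenspace_neg[OF n _ a', of "- c"]
      dim_square_eigenspace_conjugate[OF conj, of "- c"] that t by simp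
  moreover have "chain ?l (m_k CARD('n)) a" "chain ?l (m_k CARD('n)) a'"
    using a a' t by (cases t; simp add: first_rotation_def)+
  ultimately have eq: "a r = a' r" if "r \<in> {?l..m_k CARD('n)}" for r
    using chain_determined that by blast
  have "a i = a' i \<or> (t = Type_T \<and> i = 1)" if "i \<in> {1..m_k CARD('n)}" for i
  proof (cases "i = 1")
    case True
    then show ?thesis using S1 eq[of 1] that by (cases t) (simp_all add: first_rotation_def)
  next
    case False
    then show ?thesis using eq[of i] that by (simp add: first_rotation_def)
  qed
  then show ?thesis using t by blast
qed

section \<open>The moduli space of the Klein case\<close>

text \<open>
  A boost with axis \<open>unit_vec 2\<close> preserves the null line in the kernel and scales it by \<open>\<beta>\<close>; in the boosted
  frame \<open>a 1\<close> is replaced by \<open>a 1 / \<beta>\<close>.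
\<close>

lemma type_T_rescaled:
  fixes a :: "nat \<Rightarrow> real"
  assumes n: "CARD('n::{finite,linorder}) \<ge> 2" and "a 1 > 0" "b > 0"
  shows "lorentz_conjugate (nf_gen Type_T (a(1 := b)) :: 'n spacetime \<Rightarrow> _) (nf_gen Type_T a)"
proof -
  let ?Q = "Q_JT a :: 'n square_matrix" and ?n = "CARD('n)"
  define M where "M = (nf_gen Type_T a :: 'n spacetime \<Rightarrow> _)"
  define \<beta> where "\<beta> = a 1 / b"
  \<comment> \<open>Hyperbolic cosine and sine of \<open>ln \<beta>\<close>.\<close>
  define ch where "ch = (\<beta> + 1 / \<beta>) / 2"
  define sh where "sh = (\<beta> - 1 / \<beta>) / 2"
  have \<beta>: "\<beta> > 0" "b * \<beta> = a 1" using assms(2,3) by (simp_all add: \<beta>_def)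
  have hyp: "ch * ch - sh * sh = 1" "ch + sh = \<beta>" "a 1 * (ch - sh) = b"
    using \<beta> assms(2,3) by (simp_all add: ch_def sh_def \<beta>_def field_simps)
  define f0 where "f0 = (ch, sh *\<^sub>R (unit_vec 2 :: 'n point))"
  define u where "u = (\<lambda>k. if k = 2 then (sh, ch *\<^sub>R unit_vec 2) else (0, unit_vec k :: 'n point))"
  have 12: "1 \<in> {1..?n}" "2 \<in> {1..?n}" using n by auto
  have M: "M (t, x) = (a 1 * (unit_vec 1 \<bullet> x), (t * a 1) *\<^sub>R unit_vec 1 + ?Q *v x)" for t x
    by (simp add: M_def lorentz_gen_def first_coord_eq inner_commute[of x])
  note Q12 = Q_JT_unit_vec[OF n, of a]
  note unit = unit_vec_orthonormal[where 'n = 'n]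
  have e12: "(unit_vec 1 :: 'n point) \<bullet> unit_vec 1 = 1" "(unit_vec 1 :: 'n point) \<bullet> unit_vec 2 = 0"
    using unit[OF 12(1,1)] unit[OF 12] by simp_all
  have "lorentz_conjugate (lorentz_gen (Q_JT (a(1 := b))) (first_coord ((a(1 := b)) 1))) M"
  proof (rule conjugate_type_T)
    show "linear M" unfolding M_def by (rule linear_lorentz_gen)
    show "lorentz_frame ?n f0 u"
      unfolding lorentz_frame_def
    proof (intro conjI ballI)
      show "lorentz_form f0 f0 = - 1"
        using hyp(1) unit[OF 12(2,2)] by (simp add: f0_def)
      fix k assume k: "k \<in> {1..?n}"
      show "lorentz_form f0 (u k) = 0"
        using unit[OF 12(2) k] unit[OF 12(2,2)] by (simp add: f0_def u_def)
      fix j assume j: "j \<in> {1..?n}"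
      show "lorentz_form (u j) (u k) = (if j = k then 1 else 0)"
        using unit[OF j k] unit[OF 12(2,2)] hyp(1) by (auto simp: u_def)
    qed
    show "M f0 = (a(1 := b)) 1 *\<^sub>R u 1"
    proof -
      have "M f0 = (0, (a 1 * (ch - sh)) *\<^sub>R unit_vec 1)"
        by (simp add: M f0_def e12 Q12 matrix_vector_mult_scaleR algebra_simps del: One_nat_def)
      then show ?thesis by (simp only: hyp(3)) (simp add: u_def)
    qed
    show "M (u 1) = (a(1 := b)) 1 *\<^sub>R (f0 + u 2)"
    proof -
      have "M (u 1) = (a 1, a 1 *\<^sub>R unit_vec 2)"
        by (simp add: M u_def e12 Q12 del: One_nat_def)
      moreover have "b *\<^sub>R (f0 + u 2) = (b * (ch + sh), (b * (ch + sh)) *\<^sub>R unit_vec 2)"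
        by (simp add: f0_def u_def algebra_simps)
      ultimately show ?thesis using \<beta>(2) by (simp only: hyp(2)) simp
    qed
    show "M (u 2) = - (a(1 := b)) 1 *\<^sub>R u 1"
    proof -
      have "M (u 2) = (0, - (a 1 * (ch - sh)) *\<^sub>R unit_vec 1)"
        by (simp add: M u_def e12 Q12 matrix_vector_mult_scaleR algebra_simps del: One_nat_def)
      then show ?thesis by (simp only: hyp(3)) (simp add: u_def)
    qed
    fix r assume r: "r \<in> {2..?n div 2}"
    then have r1: "r \<in> {1..?n div 2}" and p: "2 * r - 1 + 1 = 2 * r" by auto
    have k: "2 * r - 1 \<in> {1..?n}" "2 * r \<in> {1..?n}" using r by auto
    have ne: "2 * r - 1 \<noteq> 2" "2 * r \<noteq> 2" "2 * r - 1 \<noteq> 1" "2 * r \<noteq> 1" "r \<noteq> 1" using r by (auto; presburger)+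
    have "?Q *v unit_vec (2 * r - 1) = a r *\<^sub>R unit_vec (2 * r)"
      "?Q *v unit_vec (2 * r) = - a r *\<^sub>R unit_vec (2 * r - 1)"
      using J_blocks_unit_vec(1,2)[OF disjoint_blocks_JT Q_JT_eq r1, of a] unfolding p by simp_all
    moreover have "(unit_vec 1 :: 'n point) \<bullet> unit_vec (2 * r - 1) = 0" "(unit_vec 1 :: 'n point) \<bullet> unit_vec (2 * r) = 0"
      using unit[OF 12(1) k(1)] unit[OF 12(1) k(2)] ne by simp_all
    ultimately show "M (u (2 * r - 1)) = (a(1 := b)) r *\<^sub>R u (2 * r - 1 + 1) \<and>
        M (u (2 * r - 1 + 1)) = - (a(1 := b)) r *\<^sub>R u (2 * r - 1)"
      unfolding p using ne by (simp add: M u_def del: One_nat_def)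
  next
    assume odd: "odd ?n"
    then have k: "?n \<in> {1..?n}" "?n \<noteq> 2" "?n \<noteq> 1" using n by auto
    have "?Q *v unit_vec ?n = 0"
    proof (rule J_blocks_unit_vec(3)[OF disjoint_blocks_JT Q_JT_eq k(1)])
      show "?n \<noteq> 2 * r - 1 \<and> ?n \<noteq> 2 * r - 1 + 1" if "r \<in> {1..?n div 2}" for r
        using that odd by (auto; presburger)
    qed
    moreover have "(unit_vec 1 :: 'n point) \<bullet> unit_vec ?n = 0"
      using unit[OF 12(1) k(1)] k(3) by simp
    ultimately show "M (u ?n) = 0" using k(2) by (simp add: M u_def zero_prod_def del: One_nat_def)
  qed (rule n)
  then show ?thesis by (simp add: M_def)
qed

lemma first_coord_inner: "(first_coord c :: 'n::{finite,linorder} point) \<bullet> first_coord c = c\<^sup>2"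
  using unit_vec_orthonormal[of 1 1, where 'n = 'n]
  by (simp add: first_coord_eq Suc_leI power2_eq_square)

text \<open>
  In type J the field vanishes at the centre, in type S its length there is \<open>a 1 / sqrt \<bar>K\<bar>\<close>, and in type T
  its length tends to 0 along the ray to the fixed boundary point \<open>unit_vec 2\<close>.
\<close>

lemma nf_k_in_fields_k:
  fixes a :: "nat \<Rightarrow> real"
  assumes n: "CARD('n::{finite,linorder}) \<ge> 2" and K: "K < 0" and a: "a \<in> params_k K CARD('n) t"
  shows "(nf_k t a :: 'n vfield) \<in> fields_k K"
proof -
  let ?M = "nf_gen t a :: 'n spacetime \<Rightarrow> _"
  have "\<exists>p. lorentz_form p p < 0 \<and> lorentz_form (?M p) (?M p) < \<bar>K\<bar> * - lorentz_form p p"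
  proof (cases t)
    case Type_J
    have "?M (1, 0) = 0" by (simp add: Type_J lorentz_gen_def zero_prod_def)
    then show ?thesis using K by (intro exI[of _ "(1, 0)"]) simp
  next
    case Type_S
    have "(a 1)\<^sup>2 < (sqrt \<bar>K\<bar>)\<^sup>2"
      using a Type_S by (intro power_strict_mono) auto
    then have "(a 1)\<^sup>2 < \<bar>K\<bar>" by simp
    moreover have "?M (1, 0) = (0, first_coord (a 1))" by (simp add: Type_S lorentz_gen_def)
    ultimately show ?thesis by (intro exI[of _ "(1, 0)"]) (simp add: first_coord_inner)
  next
    case Type_T
    let ?f = "unit_vec 2 :: 'n point" and ?e = "unit_vec 1 :: 'n point"
    have 12: "1 \<in> {1..CARD('n)}" "2 \<in> {1..CARD('n)}" using n by auto
    have e: "?e \<bullet> ?e = 1" "?f \<bullet> ?f = 1" "?f \<bullet> ?e = 0"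
      using unit_vec_orthonormal[OF 12(1,1)] unit_vec_orthonormal[OF 12(2,2)]
        unit_vec_orthonormal[OF 12(2,1)] by simp_all
    define A where "A = (a 1)\<^sup>2"
    have A: "A > 0" using a Type_T by (simp add: A_def)
    \<comment> \<open>At distance \<open>d\<close> from the boundary point the squared length is \<open>A * d / (\<bar>K\<bar> * (2 - d))\<close>.\<close>
    define d where "d = \<bar>K\<bar> / (A + \<bar>K\<bar>)"
    have K': "\<bar>K\<bar> > 0" using K by simp
    have "d > 0" unfolding d_def using A K' by (intro divide_pos_pos) auto
    moreover have "d < 1" unfolding d_def using A K' by (subst divide_less_eq_1_pos) auto
    moreover have "d * (A + \<bar>K\<bar>) = \<bar>K\<bar>" unfolding d_def using A K' by (intro nonzero_eq_divide_eq[THEN iffD1]) auto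
    then have "A * d + \<bar>K\<bar> * d = \<bar>K\<bar>" by (simp only: ring_distribs mult.commute)
    ultimately have d: "d > 0" "d < 1" "A * d + \<bar>K\<bar> * d = \<bar>K\<bar>" .
    let ?p = "(1, (1 - d) *\<^sub>R ?f)"
    have "?M ?p = (0, (a 1 * d) *\<^sub>R ?e)"
      by (simp add: Type_T lorentz_gen_def first_coord_eq e Q_JT_unit_vec[OF n]
          matrix_vector_mult_scaleR algebra_simps del: One_nat_def)
    then have M: "lorentz_form (?M ?p) (?M ?p) = A * d * d"
      by (simp add: e A_def power2_eq_square del: One_nat_def)
    have p: "lorentz_form ?p ?p = - (d * (2 - d))" by (simp add: e algebra_simps)
    have "A * d < \<bar>K\<bar> * (2 - d)" using d(3) K' unfolding right_diff_distrib by linarith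
    then have "d * (A * d) < d * (\<bar>K\<bar> * (2 - d))" using d(1) by (rule mult_strict_left_mono)
    then have "lorentz_form (?M ?p) (?M ?p) < \<bar>K\<bar> * - lorentz_form ?p ?p"
      unfolding M p by (simp add: algebra_simps)
    moreover have "lorentz_form ?p ?p < 0" unfolding p using d by simp
    ultimately show ?thesis by blast
  qed
  then have "admissible (klein_metric K) (ball 0 1) (field_k (nf_matrix t a) (nf_vector t a) :: 'n vfield)"
    using admissible_field_k_iff[OF nf_matrix_skew K] by blast
  then show ?thesis
    unfolding fields_k_def nf_k_eq using nf_matrix_skew by blast
qed

lemma orbit_nf_k_eq_iff:
  "orbit_k (nf_k t a :: 'n::{finite,linorder} vfield) = orbit_k (nf_k t' a') \<longleftrightarrow>
   lorentz_conjugate (nf_gen t a :: 'n spacetime \<Rightarrow> _) (nf_gen t' a')"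
  unfolding nf_k_eq by (rule orbit_k_eq_iff) (rule nf_matrix_skew)+

text \<open>
  That admissibility forces \<open>a 1 < sqrt \<bar>K\<bar>\<close> in type S holds because a boost of speed \<open>a 1\<close>, with or without
  rotations, moves no point of hyperbolic space slower than the points of its axis.
\<close>

lemma moduli_k_eq:
  assumes n: "CARD('n::{finite,linorder}) \<ge> 2" and K: "K < 0"
  shows "(\<lambda>(t, a). orbit_k (nf_k t a :: 'n vfield)) ` (SIGMA t:UNIV. params_k K CARD('n) t) = moduli_k K"
proof (intro equalityI subsetI)
  fix X assume "X \<in> (moduli_k K :: 'n vfield set set)"
  then obtain Q and C :: "'n point" where X: "X = orbit_k (field_k Q C)" "transpose Q = - Q"
    and adm: "admissible (klein_metric K) (ball 0 1) (field_k Q C)"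
    by (auto simp: moduli_k_def fields_k_def)
  obtain t a where a: "if t = Type_S then a \<in> rvec (m_k CARD('n)) \<and> a 1 > 0 \<and> chain 2 (m_k CARD('n)) a
      else a \<in> params_k K CARD('n) t"
    and conj: "lorentz_conjugate (nf_gen t a) (lorentz_gen Q C)"
    by (rule exists_normal_form[OF X(2), of K C])
  have "a \<in> params_k K CARD('n) t"
  proof (cases "t = Type_S")
    case True
    have "admissible (klein_metric K) (ball 0 1) (field_k (nf_matrix t a) (nf_vector t a) :: 'n vfield)"
      using admissible_conjugate[OF X(2) nf_matrix_skew K lorentz_conjugate_sym[OF conj] adm] .
    then obtain p where p: "lorentz_form p p < 0"
      "lorentz_form (nf_gen t a p) (nf_gen t a p) < \<bar>K\<bar> * - lorentz_form p (p :: 'n spacetime)"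
      unfolding admissible_field_k_iff[OF nf_matrix_skew K] by blast
    have "(a 1)\<^sup>2 * - lorentz_form p p \<le> lorentz_form (nf_gen t a p) (nf_gen t a p)"
    proof -
      obtain \<tau> x where p: "p = (\<tau>, x)" by (cases p)
      let ?Q = "Q_S a :: 'n square_matrix" and ?e = "unit_vec 1 :: 'n point"
      have skew: "transpose ?Q = - ?Q" using nf_matrix_skew[of Type_S a] by simp
      have ee: "?e \<bullet> ?e = 1" using unit_vec_orthonormal[of 1 1, where 'n = 'n] by (simp add: Suc_leI)
      have Qe: "?e \<bullet> (?Q *v x) = 0"
        using skew_matrix_inner[OF skew, of ?e x] by (simp add: Q_S_unit_vec del: One_nat_def)
      have "lorentz_form (nf_gen t a p) (nf_gen t a p) =
          (a 1)\<^sup>2 * \<tau>\<^sup>2 + (?Q *v x) \<bullet> (?Q *v x) - (a 1)\<^sup>2 * (?e \<bullet> x)\<^sup>2"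
        using Qe inner_commute[of "?Q *v x" ?e]
        by (simp add: True p lorentz_gen_def first_coord_eq inner_add_left inner_add_right ee
            inner_commute[of x] power2_eq_square algebra_simps del: One_nat_def)
      moreover have "(?e \<bullet> x)\<^sup>2 \<le> x \<bullet> x" using Cauchy_Schwarz_ineq[of ?e x] by (simp add: ee del: One_nat_def)
      then have "(a 1)\<^sup>2 * (?e \<bullet> x)\<^sup>2 \<le> (a 1)\<^sup>2 * (x \<bullet> x)" by (intro mult_left_mono) auto
      moreover have "(?Q *v x) \<bullet> (?Q *v x) \<ge> 0" by (rule inner_ge_zero)
      moreover have "(a 1)\<^sup>2 * - lorentz_form p p = (a 1)\<^sup>2 * \<tau>\<^sup>2 - (a 1)\<^sup>2 * (x \<bullet> x)"
        by (simp add: p power2_eq_square algebra_simps)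
      ultimately show ?thesis by linarith
    qed
    then have "(a 1)\<^sup>2 * - lorentz_form p p < \<bar>K\<bar> * - lorentz_form p p" using p(2) by linarith
    then have "(a 1)\<^sup>2 < \<bar>K\<bar>" using p(1) by (simp add: mult_less_cancel_right)
    then have "a 1 < sqrt \<bar>K\<bar>" by (rule real_less_rsqrt)
    then show ?thesis using a True by simp
  qed (use a in simp)
  moreover have "orbit_k (nf_k t a) = X"
    unfolding X(1) nf_k_eq orbit_k_eq_iff[OF nf_matrix_skew X(2)] by (rule conj)
  ultimately show "X \<in> (\<lambda>(t, a). orbit_k (nf_k t a :: 'n vfield)) ` (SIGMA t:UNIV. params_k K CARD('n) t)"
    by (intro image_eqI[of _ _ "(t, a)"]) auto
qed (use nf_k_in_fields_k[OF n K] in \<open>auto simp: moduli_k_def\<close>)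

lemma orbit_nf_k_eq_iff_params:
  assumes n: "CARD('n::{finite,linorder}) \<ge> 2"
    and a: "a \<in> params_k K CARD('n) t" and a': "a' \<in> params_k K CARD('n) t'"
  shows "orbit_k (nf_k t a :: 'n vfield) = orbit_k (nf_k t' a') \<longleftrightarrow>
    t = t' \<and> (\<forall>i\<in>{1..m_k CARD('n)}. a i = a' i \<or> (t = Type_T \<and> i = 1))"
  unfolding orbit_nf_k_eq_iff
proof
  assume "lorentz_conjugate (nf_gen t a :: 'n spacetime \<Rightarrow> _) (nf_gen t' a')"
  then show "t = t' \<and> (\<forall>i\<in>{1..m_k CARD('n)}. a i = a' i \<or> (t = Type_T \<and> i = 1))"
    by (rule normal_form_determined[OF n a a'])
next
  assume eq: "t = t' \<and> (\<forall>i\<in>{1..m_k CARD('n)}. a i = a' i \<or> (t = Type_T \<and> i = 1))"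
  have rvec: "a \<in> rvec (m_k CARD('n))" "a' \<in> rvec (m_k CARD('n))"
    using a a' by (cases t; cases t'; simp)+
  show "lorentz_conjugate (nf_gen t a :: 'n spacetime \<Rightarrow> _) (nf_gen t' a')"
  proof (cases "t = Type_T")
    case False
    have "a = a'"
      using rvec eq False by (intro PiE_ext[of a "{1..m_k CARD('n)}" "\<lambda>_. UNIV" a']) (auto simp: rvec_def)
    then show ?thesis using eq lorentz_conjugate_refl by simp
  next
    case True
    have 1: "1 \<in> {1..m_k CARD('n)}" by (simp add: m_k_eq Suc_leI)
    have "a = a'(1 := a 1)"
    proof (rule PiE_ext[of a "{1..m_k CARD('n)}" "\<lambda>_. UNIV"])
      show "a'(1 := a 1) \<in> {1..m_k CARD('n)} \<rightarrow>\<^sub>E UNIV"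
        using rvec(2) 1 by (auto simp: rvec_def PiE_def extensional_def)
    qed (use rvec(1) eq in \<open>auto simp: rvec_def\<close>)
    moreover have "lorentz_conjugate (nf_gen Type_T (a'(1 := a 1)) :: 'n spacetime \<Rightarrow> _) (nf_gen Type_T a')"
      using a a' eq True by (intro type_T_rescaled[OF n]) auto
    ultimately show ?thesis using eq True by simp
  qed
qed

section \<open>Fields that are strongly convex on the whole ball\<close>

text \<open>
  At the boundary the bound becomes 0 in the limit.  There the generator sends the null vector \<open>(1, x)\<close>
  to a vector orthogonal to it whose Lorentz square is not positive, hence to a multiple of \<open>(1, x)\<close>;
  thus the field vanishes on the whole sphere.  Comparing antipodal points gives \<open>Q = 0\<close>, and then a
  point orthogonal to \<open>C\<close> gives \<open>C = 0\<close>.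
\<close>

lemma bounded_field_k_is_zero:
  fixes Q :: "'n::finite square_matrix"
  assumes n: "CARD('n) \<ge> 2" and skew: "transpose Q = - Q"
    and bound: "\<And>x. x \<in> ball 0 1 \<Longrightarrow>
      lorentz_form (lorentz_gen Q C (1, x)) (lorentz_gen Q C (1, x)) \<le> \<kappa> * (1 - x \<bullet> x)"
  shows "Q = 0 \<and> C = 0"
proof -
  have zero: "Q *v x + C = (x \<bullet> C) *\<^sub>R x" if x: "x \<bullet> x = 1" for x
  proof -
    let ?g = "\<lambda>s::real. (C + s *\<^sub>R (Q *v x)) \<bullet> (C + s *\<^sub>R (Q *v x)) - (s * (x \<bullet> C)) * (s * (x \<bullet> C)) - \<kappa> * (1 - s\<^sup>2)"
    have "?g s \<le> 0" if "0 < s" "s < 1" for s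
    proof -
      have "s *\<^sub>R x \<in> ball 0 1" using x that by (simp add: norm_eq_sqrt_inner)
      from bound[OF this] show ?thesis
        using x by (simp add: lorentz_gen_def matrix_vector_mult_scaleR power2_eq_square)
    qed
    then have "eventually (\<lambda>s. ?g s \<le> 0) (at_left 1)"
      using eventually_at_left_real[of 0 1] by (auto elim!: eventually_mono)
    moreover have "isCont ?g 1" by (intro continuous_intros)
    then have "(?g \<longlongrightarrow> ?g 1) (at_left 1)"
      unfolding isCont_def by (rule tendsto_within_subset) simp
    ultimately have "?g 1 \<le> 0"
      by (intro tendsto_upperbound) auto
    then have le: "(C + Q *v x) \<bullet> (C + Q *v x) \<le> (x \<bullet> C) * (x \<bullet> C)" by simp
    define v where "v = C + Q *v x"
    have xv: "x \<bullet> v = x \<bullet> C" "v \<bullet> x = x \<bullet> C"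
      using skew_matrix_inner_self[OF skew, of x] inner_commute[of v x]
      by (simp_all add: v_def inner_add_right)
    have "(v - (x \<bullet> C) *\<^sub>R x) \<bullet> (v - (x \<bullet> C) *\<^sub>R x) = v \<bullet> v - (x \<bullet> C) * (x \<bullet> C)"
      using x by (simp add: inner_diff_left inner_diff_right xv)
    then have "(v - (x \<bullet> C) *\<^sub>R x) \<bullet> (v - (x \<bullet> C) *\<^sub>R x) \<le> 0" using le by (simp add: v_def)
    then have "v - (x \<bullet> C) *\<^sub>R x = 0"
      using inner_ge_zero[of "v - (x \<bullet> C) *\<^sub>R x"] inner_eq_zero_iff[of "v - (x \<bullet> C) *\<^sub>R x"] by linarith
    then have "C + Q *v x = (x \<bullet> C) *\<^sub>R x" by (simp add: v_def)
    then show ?thesis by (simp add: add.commute)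
  qed
  have Q0: "Q *v x = 0" and Cx: "C = (x \<bullet> C) *\<^sub>R x" if x: "x \<bullet> x = 1" for x
  proof -
    have 1: "Q *v x + C = (x \<bullet> C) *\<^sub>R x" and 2: "- (Q *v x) + C = (x \<bullet> C) *\<^sub>R x"
      using zero[OF x] zero[of "- x"] x by (simp_all add: vec.neg)
    have "2 *\<^sub>R (Q *v x) = (Q *v x + C) - (- (Q *v x) + C)" by (simp add: scaleR_2)
    also have "\<dots> = 0" unfolding 1 2 by simp
    finally show "Q *v x = 0" by simp
    then show "C = (x \<bullet> C) *\<^sub>R x" using 1 by simp
  qed
  obtain y where y: "y \<noteq> 0" "orthogonal C y"
    using orthogonal_to_vector_exists[of C] n by auto
  define x where "x = y /\<^sub>R norm y"
  have "x \<bullet> x = 1" "x \<bullet> C = 0"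
    using y by (simp_all add: x_def orthogonal_def inner_commute flip: power2_norm_eq_inner power2_eq_square)
  have "C = (x \<bullet> C) *\<^sub>R x" using \<open>x \<bullet> x = 1\<close> by (rule Cx)
  also have "\<dots> = 0" using \<open>x \<bullet> C = 0\<close> by simp
  finally have "C = 0" .
  moreover have "Q = 0"
  proof -
    have "Q *v axis j 1 = 0" for j by (rule Q0) (simp add: inner_axis)
    then show ?thesis by (simp add: vec_eq_iff matrix_vector_mult_basis column_def)
  qed
  ultimately show ?thesis by simp
qed

lemma nf_zero_iff:
  fixes a :: "nat \<Rightarrow> real"
  assumes n: "CARD('n::{finite,linorder}) \<ge> 2" and a: "a \<in> params_k K CARD('n) t"
  shows "(nf_matrix t a = (0 :: 'n square_matrix) \<and> nf_vector t a = (0 :: 'n point)) \<longleftrightarrow>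
    (\<forall>i\<in>{1..m_k CARD('n)}. a i = 0)"
proof (cases "t = Type_J")
  case False
  have 1: "1 \<in> {1..m_k CARD('n)}" by (simp add: m_k_eq Suc_leI)
  have a1: "a 1 > 0" using a False by (cases t) auto
  then have "(first_coord (a 1) :: 'n point) \<bullet> first_coord (a 1) \<noteq> 0"
    by (simp add: first_coord_inner)
  then have "(first_coord (a 1) :: 'n point) \<noteq> 0" by auto
  then have "nf_vector t a \<noteq> (0 :: 'n point)" using False by (cases t) auto
  moreover have "\<exists>i\<in>{1..m_k CARD('n)}. a i \<noteq> 0" using 1 a1 by (intro bexI[of _ 1]) auto
  ultimately show ?thesis by blast
next
  case True
  show ?thesis
  proof
    assume "nf_matrix t a = (0 :: 'n square_matrix) \<and> nf_vector t a = (0 :: 'n point)"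
    then have Q: "Q_JT a = (0 :: 'n square_matrix)" using True by simp
    show "\<forall>i\<in>{1..m_k CARD('n)}. a i = 0"
    proof
      fix i assume i: "i \<in> {1..m_k CARD('n)}"
      show "a i = 0"
      proof (cases "i \<le> CARD('n) div 2")
        case i_le: True
        then have i': "i \<in> {1..CARD('n) div 2}" and k: "2 * i - 1 + 1 \<in> {1..CARD('n)}" using i by auto
        have "a i *\<^sub>R (unit_vec (2 * i - 1 + 1) :: 'n point) = 0"
          using J_blocks_unit_vec(1)[OF disjoint_blocks_JT Q_JT_eq i', of a] unfolding Q by simp
        moreover have "(unit_vec (2 * i - 1 + 1) :: 'n point) \<noteq> 0"
          by (simp add: unit_vec_def axis_eq_0_iff)
        ultimately show ?thesis by simp
      next
        case False
        then have "odd CARD('n)" "i = m_k CARD('n)" using i unfolding m_k_eq by (auto; presburger)+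
        then show ?thesis using a True by simp
      qed
    qed
  next
    assume 0: "\<forall>i\<in>{1..m_k CARD('n)}. a i = 0"
    have "a r = 0" if "r \<in> {1..CARD('n) div 2}" for r
      using 0 that by (auto simp: m_k_eq)
    then have "J_blocks {1..CARD('n) div 2} (\<lambda>r. 2 * r - 1) a = (0 :: 'n square_matrix)"
      unfolding J_blocks_def vec_eq_iff vec_lambda_beta zero_index
      by (intro allI sum.neutral ballI) simp
    then have "Q_JT a = (0 :: 'n square_matrix)"
      unfolding Q_JT_eq by simp
    then show "nf_matrix t a = (0 :: 'n square_matrix) \<and> nf_vector t a = (0 :: 'n point)"
      using True by simp
  qed
qed

lemma lorentz_gen_zero_iff: "lorentz_gen Q C = (\<lambda>p. 0) \<longleftrightarrow> Q = 0 \<and> C = 0"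
proof
  assume 0: "lorentz_gen Q C = (\<lambda>p. 0)"
  have "lorentz_gen Q C (1, 0) = 0" "\<And>j. lorentz_gen Q C (0, axis j 1) = 0" unfolding 0 by simp_all
  then show "Q = 0 \<and> C = 0"
    by (simp add: lorentz_gen_def zero_prod_def vec_eq_iff matrix_vector_mult_basis column_def)
qed (simp add: lorentz_gen_def zero_prod_def fun_eq_iff)

lemma conjugate_zero:
  assumes "lorentz_conjugate M M'" "M = (\<lambda>p. 0)"
  shows "M' = (\<lambda>p. 0)"
proof -
  obtain L where L: "L \<in> lorentz_group" "\<And>p. L (M p) = M' (L p)"
    using assms(1) by (auto simp: lorentz_conjugate_def)
  obtain L' where L': "\<And>p. L (L' p) = p" using lorentz_group_inverse[OF L(1)] by metis
  show ?thesis
  proof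
    fix p
    have "M' p = L (M (L' p))" by (simp only: L(2) L')
    then show "M' p = 0" by (simp add: assms(2) linear_0[OF lorentz_group_linear[OF L(1)]])
  qed
qed

text \<open>
  The field is strongly convex on the ball only if it is zero, and being zero is invariant under
  conjugation.
\<close>

lemma strongly_convex_on_ball_iff:
  assumes n: "CARD('n::{finite,linorder}) \<ge> 2" and K: "K < 0" and a: "a \<in> params_k K CARD('n) t"
    and W: "W \<in> orbit_k (nf_k t a :: 'n vfield)"
  shows "(\<forall>x\<in>ball 0 1. strongly_convex (klein_metric K) W x) \<longleftrightarrow> (\<forall>i\<in>{1..m_k CARD('n)}. a i = 0)"
proof -
  obtain Q and C :: "'n point" where QC: "transpose Q = - Q" "W = field_k Q C"
    and conj: "lorentz_conjugate (nf_gen t a) (lorentz_gen Q C)"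
    using W unfolding nf_k_eq orbit_k_iff[OF nf_matrix_skew] by blast
  have sc: "strongly_convex (klein_metric K) W x \<longleftrightarrow>
      lorentz_form (lorentz_gen Q C (1, x)) (lorentz_gen Q C (1, x)) < \<bar>K\<bar> * (1 - x \<bullet> x)"
    if "x \<in> ball 0 1" for x
    unfolding strongly_convex_klein_iff[OF n K that] QC(2)
    by (rule klein_metric_field_k_less_one[OF QC(1) that K])
  have "(\<forall>x\<in>ball 0 1. strongly_convex (klein_metric K) W x) \<longleftrightarrow> Q = 0 \<and> C = 0"
  proof
    assume "\<forall>x\<in>ball 0 1. strongly_convex (klein_metric K) W x"
    then show "Q = 0 \<and> C = 0"
      using sc by (intro bounded_field_k_is_zero[OF n QC(1), of C "\<bar>K\<bar>"]) (auto intro: less_imp_le)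
  next
    assume "Q = 0 \<and> C = 0"
    then have 0: "lorentz_gen Q C = (\<lambda>p. 0)" by (simp add: lorentz_gen_zero_iff)
    show "\<forall>x\<in>ball 0 1. strongly_convex (klein_metric K) W x"
    proof
      fix x :: "'n point" assume x: "x \<in> ball 0 1"
      then have "\<bar>K\<bar> * (1 - x \<bullet> x) > 0"
        using K unfolding ball_inner_less_one by (intro mult_pos_pos) auto
      then show "strongly_convex (klein_metric K) W x" unfolding sc[OF x] 0 by simp
    qed
  qed
  also have "\<dots> \<longleftrightarrow> nf_matrix t a = (0 :: 'n square_matrix) \<and> nf_vector t a = (0 :: 'n point)"
    unfolding lorentz_gen_zero_iff[symmetric]
    using conjugate_zero[OF conj] conjugate_zero[OF lorentz_conjugate_sym[OF conj]] by blast
  also have "\<dots> \<longleftrightarrow> (\<forall>i\<in>{1..m_k CARD('n)}. a i = 0)" by (rule nf_zero_iff[OF n a])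
  finally show ?thesis .
qed

(*
  The conjuncts, in order:
  (e) one copy of the parameter space for each of the two values of sigma;
  (e) no extension to the whole space;
  (k) the normal forms represent exactly the points of the moduli space;
  (k) type and parameters are determined by the point, except for a 1 in type (T), all positive
      values of which are conjugate under Lorentz boosts;
  (k) the globally defined metrics.
*)
theorem proposition10:
  fixes K :: real
  assumes "CARD('n::{finite,linorder}) \<ge> 2" and "K < 0"
  shows "
    bij_betw (\<lambda>(\<sigma>, a). orbit_e (nf_e \<sigma> a :: 'n vfield))
      (sigmas K \<times> params_e CARD('n)) (moduli_e K)
    \<and>
    (\<forall>W \<in> (fields_e K :: 'n vfield set). \<forall>U. open U \<and> U \<noteq> {} \<and>
       (\<forall>x\<in>U. strongly_convex euclid_metric W x) \<longrightarrow>
       \<not> (\<exists>V \<in> fields_e K. (\<forall>x. strongly_convex euclid_metric V x) \<and>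
            (\<forall>x\<in>U. \<forall>y. randers_F euclid_metric V x y = randers_F euclid_metric W x y)))
    \<and>
    (\<lambda>(t, a). orbit_k (nf_k t a :: 'n vfield)) ` (SIGMA t:UNIV. params_k K CARD('n) t)
      = moduli_k K
    \<and>
    (\<forall>t t'. \<forall>a \<in> params_k K CARD('n) t. \<forall>a' \<in> params_k K CARD('n) t'.
       orbit_k (nf_k t a :: 'n vfield) = orbit_k (nf_k t' a') \<longleftrightarrow>
       t = t' \<and> (\<forall>i \<in> {1..m_k CARD('n)}. a i = a' i \<or> (t = Type_T \<and> i = 1)))
    \<and>
    (\<forall>t. \<forall>a \<in> params_k K CARD('n) t. \<forall>W \<in> orbit_k (nf_k t a :: 'n vfield).
       (\<forall>x \<in> ball 0 1. strongly_convex (klein_metric K) W x) \<longleftrightarrow>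
       (\<forall>i \<in> {1..m_k CARD('n)}. a i = 0))"
proof (intro conjI allI ballI)
  show "bij_betw (\<lambda>(\<sigma>, a). orbit_e (nf_e \<sigma> a :: 'n vfield))
      (sigmas K \<times> params_e CARD('n)) (moduli_e K)"
    by (rule bij_betw_moduli_e[OF assms(2)])
next
  fix W :: "'n vfield" and U
  show "open U \<and> U \<noteq> {} \<and> (\<forall>x\<in>U. strongly_convex euclid_metric W x) \<longrightarrow>
       \<not> (\<exists>V \<in> fields_e K. (\<forall>x. strongly_convex euclid_metric V x) \<and>
            (\<forall>x\<in>U. \<forall>y. randers_F euclid_metric V x y = randers_F euclid_metric W x y))"
    using fields_e_not_global[OF _ assms(2,1)] by blast
qed (rule moduli_k_eq[OF assms] orbit_nf_k_eq_iff_params[OF assms(1)]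
    strongly_convex_on_ball_iff[OF assms]; assumption)+

end
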